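(* For every $\zeta\in(0,1/2)$ there are constants $C,c>0$ such that, for every sufficiently large $n$, there are an $n$-vertex triangle-free graph $G_n$ and an integer $k_n\le C\sqrt{n\log n}$ with the following property. If $D_n$ is a uniformly random orientation of $G_n$, then \[ \mathbb{P}\Bigl(\exists U\subseteq V(G_n),\ |U|\ge k_n:\ \operatorname{fas}(D_n[U])\le\bigl(\tfrac12-\zeta\bigr)e(G_n[U])\Bigr)\le \exp\bigl[-c\sqrt n\,(\log n)^{3/2}\bigr]. \] Moreover, on the complementary event (that is, whenever $\operatorname{fas}(D_n[U])>(\frac12-\zeta)e(G_n[U])$ for all $U\subseteq V(G_n)$ with $|U|\ge k_n$), the following hold: (i) $\vec{\alpha}(D_n)<k_n$; (ii) every $W\subseteq V(G_n)$ with $|W|\ge k_n$ satisfies $\vec{\chi}(D_n[W])\ge \frac{|W|}{k_n-1}$; (iii) at least $c\sqrt n\,(\log n)^{3/2}$ arc edits, each edit deleting or reversing one arc, must be performed on $D_n$ before an acyclic set of order $k_n$ can be created. In particular, every digraph obtained from $D_n$ using fewer than $c\sqrt n\,(\log n)^{3/2}$ such edits still has acyclic number less than $k_n$ and dichromatic number at least $n/(k_n-1)$.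
   Context: All graphs are finite and simple; $\log$ is the natural logarithm; $e(G)$ is the number of edges of $G$, and $G[U]$, $D[U]$ denote the induced subgraph/subdigraph on a vertex set $U$. An oriented graph is an orientation of a finite simple graph (each edge receives exactly one of its two directions). A uniformly random orientation of $G$ directs each edge independently, each direction having probability $1/2$. A vertex set of an oriented graph $D$ is acyclic if it induces no directed cycle. The acyclic number $\vec{\alpha}(D)$ is the maximum size of an acyclic vertex set; the dichromatic number $\vec{\chi}(D)$ is the minimum number of acyclic sets in a partition of $V(D)$; the feedback arc set number $\operatorname{fas}(D)$ is the minimum number of arcs whose deletion makes $D$ acyclic. *)

theory Defs
  imports "HOL-Probability.Probability" "HOL-Library.Disjoint_Sets"
begin

section \<open>Graphs and orientations\<close>

text \<open>
  An undirected graph is a vertex set \<open>V\<close> together with a set \<open>E\<close> of two-element subsets of \<open>V\<close>.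
  A digraph is a vertex set together with a relation on it, the set of its arcs; the operations
  that do not depend on the vertex set take the arc set alone.
\<close>

definition simple_graph :: "'a set \<Rightarrow> 'a set set \<Rightarrow> bool" where
  "simple_graph V E \<longleftrightarrow> finite V \<and> (\<forall>e\<in>E. e \<subseteq> V \<and> card e = 2)"

definition triangle_free :: "'a set set \<Rightarrow> bool" where
  "triangle_free E \<longleftrightarrow> \<not> (\<exists>x y z. {x, y} \<in> E \<and> {y, z} \<in> E \<and> {x, z} \<in> E)"

definition induced_edges :: "'a set set \<Rightarrow> 'a set \<Rightarrow> 'a set set" where
  "induced_edges E U = {e \<in> E. e \<subseteq> U}"

definition induced_arcs :: "('a \<times> 'a) set \<Rightarrow> 'a set \<Rightarrow> ('a \<times> 'a) set" where
  "induced_arcs D U = D \<inter> (U \<times> U)"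

definition orientation_of :: "'a set set \<Rightarrow> ('a \<times> 'a) set \<Rightarrow> bool" where
  "orientation_of E D \<longleftrightarrow>
     (\<forall>(u, v)\<in>D. {u, v} \<in> E) \<and>
     (\<forall>u v. {u, v} \<in> E \<longrightarrow> ((u, v) \<in> D) \<noteq> ((v, u) \<in> D))"

text \<open>
  For a two-element set \<open>e\<close>, \<open>directions e\<close> consists of the two arcs along \<open>e\<close>. The function drawn
  from \<open>Pi_pmf\<close> chooses one of them for every edge, independently and with probability 1/2 each;
  its value outside \<open>E\<close> is irrelevant.
\<close>

definition directions :: "'a set \<Rightarrow> ('a \<times> 'a) set" where
  "directions e = {(u, v). e = {u, v}}"

definition random_orientation :: "'a set set \<Rightarrow> ('a \<times> 'a) set pmf" where
  "random_orientation E =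
     map_pmf (\<lambda>f. f ` E) (Pi_pmf E undefined (\<lambda>e. pmf_of_set (directions e)))"


section \<open>Acyclic sets and the parameters of a digraph\<close>

text \<open>
  \<open>acyclic\<close> (no vertex is related to itself by the transitive closure) says that there is no closed
  directed walk of positive length, equivalently no directed cycle.
\<close>

definition acyclic_set :: "('a \<times> 'a) set \<Rightarrow> 'a set \<Rightarrow> bool" where
  "acyclic_set D S \<longleftrightarrow> acyclic (induced_arcs D S)"

definition acyclic_number :: "'a set \<Rightarrow> ('a \<times> 'a) set \<Rightarrow> nat" where
  "acyclic_number V D = Max {card S |S. S \<subseteq> V \<and> acyclic_set D S}"

definition dichromatic_number :: "'a set \<Rightarrow> ('a \<times> 'a) set \<Rightarrow> nat" where
  "dichromatic_number V D =
     (LEAST m. \<exists>P. partition_on V P \<and> card P = m \<and> (\<forall>S\<in>P. acyclic_set D S))"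

definition fas :: "('a \<times> 'a) set \<Rightarrow> nat" where
  "fas D = (LEAST m. \<exists>F. F \<subseteq> D \<and> card F = m \<and> acyclic (D - F))"


section \<open>Arc edits\<close>

text \<open>The relational power \<open>arc_edit ^^ m\<close> describes sequences of exactly \<open>m\<close> successive edits.\<close>

definition arc_edit :: "('a \<times> 'a) set \<Rightarrow> ('a \<times> 'a) set \<Rightarrow> bool" where
  "arc_edit D D' \<longleftrightarrow>
     (\<exists>(u, v)\<in>D. D' = D - {(u, v)} \<or> D' = insert (v, u) (D - {(u, v)}))"


section \<open>The random orientation is uniform on all orientations\<close>

lemma finite_edges: "simple_graph V E \<Longrightarrow> finite E"
  unfolding simple_graph_def by (meson PowI finite_Pow_iff rev_finite_subset subsetI)

lemma directions_insert: "directions {u, v} = {(u, v), (v, u)}"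
  by (auto simp: directions_def doubleton_eq_iff)

lemma random_orientation_uniform:
  assumes "simple_graph V E"
  shows "random_orientation E = pmf_of_set {D. orientation_of E D}"
proof -
  let ?P = "PiE_dflt E undefined directions"
  have fin: "finite E" using assms by (rule finite_edges)
  have edge: "\<exists>u v. e = {u, v} \<and> u \<noteq> v" if "e \<in> E" for e
    using that assms unfolding simple_graph_def by (meson card_2_iff)
  have dir: "finite (directions e)" "directions e \<noteq> {}" if "e \<in> E" for e
    using edge[OF that] by (auto simp: directions_insert)
  have finP: "finite ?P"
    by (rule finite_PiE_dflt) (use fin dir in auto)
  have memP: "f e = (u, v) \<Longrightarrow> e = {u, v}" if "f \<in> ?P" "e \<in> E" for f e u v
  proof -
    assume "f e = (u, v)"
    moreover have "f e \<in> directions e" using that by (simp add: PiE_dflt_def)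
    ultimately have "(u, v) \<in> directions e" by metis
    then show "e = {u, v}" by (simp add: directions_def)
  qed
  have arc_in: "(u, v) \<in> f ` E \<longleftrightarrow> {u, v} \<in> E \<and> f {u, v} = (u, v)" if "f \<in> ?P" for f u v
  proof
    assume "(u, v) \<in> f ` E"
    then obtain e where e: "e \<in> E" "f e = (u, v)" by force
    then have "e = {u, v}" using memP[OF that] by blast
    then show "{u, v} \<in> E \<and> f {u, v} = (u, v)" using e by simp
  next
    assume "{u, v} \<in> E \<and> f {u, v} = (u, v)"
    then show "(u, v) \<in> f ` E" by (metis image_eqI)
  qed
  have neP: "?P \<noteq> {}"
  proof -
    have "(\<lambda>e. if e \<in> E then SOME x. x \<in> directions e else undefined) \<in> ?P"
      using dir(2) by (auto simp: PiE_dflt_def some_in_eq)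
    then show ?thesis by blast
  qed
  have inj: "inj_on (\<lambda>f. f ` E) ?P"
  proof (rule inj_onI)
    fix f g assume f: "f \<in> ?P" and g: "g \<in> ?P" and eq: "f ` E = g ` E"
    show "f = g"
    proof
      fix e
      show "f e = g e"
      proof (cases "e \<in> E")
        case True
        obtain u v where uv: "f e = (u, v)" by fastforce
        then have e: "e = {u, v}" using memP f True by blast
        have "(u, v) \<in> g ` E" using uv True eq by (metis image_eqI)
        then show ?thesis using arc_in[OF g] e uv by metis
      next
        case False
        then show ?thesis using f g by (simp add: PiE_dflt_def)
      qed
    qed
  qed
  have "(\<lambda>f. f ` E) ` ?P = {D. orientation_of E D}"
  proof (intro equalityI subsetI)
    fix D assume "D \<in> (\<lambda>f. f ` E) ` ?P"
    then obtain f where f: "f \<in> ?P" and D: "D = f ` E" by blast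
    have "((u, v) \<in> D) \<noteq> ((v, u) \<in> D)" if uvE: "{u, v} \<in> E" for u v
    proof -
      have "u \<noteq> v" using edge[OF uvE] by (auto simp: doubleton_eq_iff)
      moreover have "f {u, v} = (u, v) \<or> f {u, v} = (v, u)"
        using f uvE directions_insert[of u v] by (auto simp: PiE_dflt_def)
      ultimately show ?thesis
        using arc_in[OF f, of u v] arc_in[OF f, of v u] uvE
        unfolding D insert_commute[of v u] by (metis prod.inject)
    qed
    moreover have "{u, v} \<in> E" if "(u, v) \<in> D" for u v
      using that arc_in[OF f] D by simp
    ultimately show "D \<in> {D. orientation_of E D}"
      unfolding orientation_of_def by blast
  next
    fix D assume "D \<in> {D. orientation_of E D}"
    then have D1: "\<And>u v. (u, v) \<in> D \<Longrightarrow> {u, v} \<in> E"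
      and D2: "\<And>u v. {u, v} \<in> E \<Longrightarrow> ((u, v) \<in> D) \<noteq> ((v, u) \<in> D)"
      unfolding orientation_of_def by blast+
    define f where "f e = (if e \<in> E then THE x. x \<in> D \<and> x \<in> directions e else undefined)" for e
    have f_arc: "f {u, v} = (u, v)" if uv: "(u, v) \<in> D" for u v
    proof -
      have "(THE x. x \<in> D \<and> x \<in> directions {u, v}) = (u, v)"
        using uv D1[OF uv] D2[of u v]
        by (intro the_equality) (auto simp: directions_insert)
      then show ?thesis using D1[OF uv] by (simp add: f_def)
    qed
    have some_arc: "\<exists>u v. (u, v) \<in> D \<and> e = {u, v}" if "e \<in> E" for e
      using edge[OF that] D2 that by (metis insert_commute)
    have fE: "f e \<in> D \<and> f e \<in> directions e" if "e \<in> E" for e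
    proof -
      obtain u v where uv: "(u, v) \<in> D" "e = {u, v}" using some_arc[OF \<open>e \<in> E\<close>] by blast
      then show ?thesis using f_arc[OF uv(1)] by (simp add: directions_insert)
    qed
    then have "f \<in> ?P" by (simp add: PiE_dflt_def f_def)
    moreover have "f ` E = D"
    proof (intro equalityI subsetI)
      fix x assume "x \<in> f ` E"
      then show "x \<in> D" using fE by blast
    next
      fix x assume x: "x \<in> D"
      obtain u v where uv: "x = (u, v)" by (cases x)
      then show "x \<in> f ` E" using f_arc D1 x by (metis image_eqI)
    qed
    ultimately show "D \<in> (\<lambda>f. f ` E) ` ?P" by blast
  qed
  then show ?thesis
    using fin dir unfolding random_orientation_def
    by (simp add: Pi_pmf_of_set map_pmf_of_set_inj[OF inj neP finP])
qed

end

theory Submission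
  imports Defs "HOL-Real_Asymp.Real_Asymp"
begin

text \<open>
  The graph is a union of two ``bites''. The vertex set carries two random partitions into parts of
  size about \<open>n powr (1/8)\<close>, and each bite is the blow-up, along one of the partitions, of a random base
  graph on the parts with edge density about \<open>sqrt (ln n / n)\<close>. Since neighbourhoods in a blow-up are
  clustered, few pairs of parts have a common neighbour; so triangles inside a base graph are rare and
  can be pruned, and only a small proportion of the edges of one bite closes a path of the other
  bite and has to be discarded. A set of \<open>k\<close> vertices, \<open>k\<close> of order \<open>sqrt (n * ln n)\<close>, cannot be
  clustered in both partitions; it therefore contains a large transversal of one of them. On such a
  transversal the edges of the corresponding bite are independent given the other bite, and a lower
  tail estimate survives the union bound. Thus all \<open>k\<close>-sets span at least \<open>A * k * ln n\<close> edges, with \<open>A\<close> as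
  large as desired, which is what the union bound over vertex sets and vertex orders requires in
  order to control \<open>fas\<close> of a random orientation.
\<close>

section \<open>Random subsets of a finite set\<close>

text \<open>Without blowing up, a pair of vertices would have about \<open>n * p\<^sup>2\<close>,
  that is about \<open>ln n\<close>, common neighbours in a random graph of the required density,
  and two such graphs would block nearly all edges of each other. A blow-up lowers this by the
  factor \<open>M\<close>. The price is correlation: \<open>k1 = k0 / M\<close> parts span on
  average fewer than \<open>k1\<close> base edges, so a union bound cannot exclude unions of parts
  with hardly any edges. This forces the second partition. The pairs forbidden in one bite are read
  off the other base graph before pruning. So open pairs depend on the other base graph alone, which
  keeps the trials independent, and pruning can only help triangle-freeness; its cost in edges is
  bounded separately. The upper tails that must survive a union bound over sets have the form
  \<open>y ^ t\<close> with \<open>y\<close> a negative power of \<open>n\<close>, and a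
  \<open>t\<close> that is a constant multiple of the size of the sets suffices. The constant
  \<open>B\<close> enters \<open>k0\<close> but not \<open>p\<close>, so it can be enlarged until
  the number of edges per vertex is what \<open>\<zeta>\<close> demands.\<close>

lemma Pi_pmf_lower_tail:
  fixes q :: "'a \<Rightarrow> 'b pmf" and P :: "'a \<Rightarrow> 'b \<Rightarrow> bool" and p0 l t :: real
  assumes fin: "finite A" and BA: "B \<subseteq> A"
    and p0: "\<And>a. a \<in> B \<Longrightarrow> p0 \<le> measure_pmf.prob (q a) {x. P a x}" and l: "0 \<le> l"
  shows "measure_pmf.prob (Pi_pmf A d q) {f. real (card {a \<in> B. P a (f a)}) \<le> t}
    \<le> exp (l * t) * (1 - p0 * (1 - exp (- l))) ^ card B"
proof -
  let ?M = "Pi_pmf A d q"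
  \<comment> \<open>Exponential moments: the product of these factors is
    \<open>exp (- l * X)\<close> for the number \<open>X\<close> of hits in \<open>B\<close>, and
    independence turns its expectation into a product. The free parameter \<open>l\<close> becomes
    \<open>1\<close> for random subsets and \<open>2 * \<zeta>\<close> for orientations.\<close>
  define F where "F a x = (if a \<in> B \<and> P a x then exp (- l) else 1)" for a x
  have finB: "finite B" using fin BA finite_subset by blast
  have F01: "0 \<le> F a x" "F a x \<le> 1" for a x using l by (auto simp: F_def)
  have prodF: "(\<Prod>a\<in>A. F a (f a)) = exp (- l * real (card {a \<in> B. P a (f a)}))" for f
  proof -
    have "(\<Prod>a\<in>A. F a (f a)) = (\<Prod>a\<in>{a \<in> B. P a (f a)}. F a (f a))"
      by (rule prod.mono_neutral_right) (use fin BA in \<open>auto simp: F_def\<close>)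
    also have "\<dots> = (\<Prod>a\<in>{a \<in> B. P a (f a)}. exp (- l))"
      by (rule prod.cong) (auto simp: F_def)
    finally show ?thesis by (simp add: exp_of_nat_mult[symmetric] mult.commute)
  qed
  have int: "integrable (measure_pmf M') G" if "\<And>x. 0 \<le> G x" "\<And>x. G x \<le> 1"
    for M' :: "'c pmf" and G :: "'c \<Rightarrow> real"
    by (rule measure_pmf.integrable_const_bound[where B = 1]) (use that in auto)
  have EF: "measure_pmf.expectation (q a) (F a) \<le> 1 - p0 * (1 - exp (- l))" if "a \<in> B" for a
  proof -
    have "measure_pmf.expectation (q a) (F a)
        = measure_pmf.expectation (q a) (\<lambda>x. 1 - (1 - exp (- l)) * indicator {x. P a x} x)"
      by (rule Bochner_Integration.integral_cong) (use that in \<open>auto simp: F_def\<close>)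
    also have "\<dots> = 1 - (1 - exp (- l)) * measure_pmf.prob (q a) {x. P a x}"
      by (subst Bochner_Integration.integral_diff) (auto intro!: integrable_mult_right int)
    also have "\<dots> \<le> 1 - (1 - exp (- l)) * p0"
      using p0[OF that] l by (intro diff_left_mono mult_left_mono) auto
    finally show ?thesis by (simp add: mult.commute)
  qed
  have E0: "0 \<le> measure_pmf.expectation (q a) (F a)" for a
    by (rule Bochner_Integration.integral_nonneg) (use F01 in auto)
  have "measure_pmf.prob ?M {f. real (card {a \<in> B. P a (f a)}) \<le> t}
      = measure_pmf.expectation ?M (indicator {f. real (card {a \<in> B. P a (f a)}) \<le> t})"
    by simp
  also have "\<dots> \<le> measure_pmf.expectation ?M (\<lambda>f. exp (l * t) * (\<Prod>a\<in>A. F a (f a)))"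
  proof (rule integral_mono)
    show "integrable (measure_pmf ?M) (\<lambda>f. exp (l * t) * (\<Prod>a\<in>A. F a (f a)))"
      by (intro integrable_mult_right int prod_nonneg prod_le_1) (use F01 in auto)
    show "indicator {f. real (card {a \<in> B. P a (f a)}) \<le> t} f
        \<le> exp (l * t) * (\<Prod>a\<in>A. F a (f a))" for f
    proof (cases "real (card {a \<in> B. P a (f a)}) \<le> t")
      case True
      then have "0 \<le> l * t - l * real (card {a \<in> B. P a (f a)})"
        using l by (simp add: mult_left_mono)
      then show ?thesis unfolding prodF
        by (simp add: exp_add[symmetric] indicator_def)
    qed (auto simp: prodF indicator_def)
  qed (auto intro!: int simp: indicator_def)
  also have "\<dots> = exp (l * t) * (\<Prod>a\<in>A. measure_pmf.expectation (q a) (F a))"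
    by (subst Bochner_Integration.integral_mult_right_zero, subst expectation_prod_Pi_pmf)
      (use fin F01 in \<open>auto intro!: int\<close>)
  also have "(\<Prod>a\<in>A. measure_pmf.expectation (q a) (F a)) = (\<Prod>a\<in>B. measure_pmf.expectation (q a) (F a))"
  proof (rule prod.mono_neutral_right)
    have "F a = (\<lambda>_. 1)" if "a \<in> A - B" for a using that by (auto simp: F_def)
    then show "\<forall>a\<in>A - B. measure_pmf.expectation (q a) (F a) = 1" by simp
  qed (use fin BA in auto)
  also have "\<dots> \<le> (\<Prod>a\<in>B. 1 - p0 * (1 - exp (- l)))"
    by (rule prod_mono) (use EF E0 in auto)
  finally show ?thesis by simp
qed

lemma prob_UN_le:
  assumes "finite I" and "\<And>i. i \<in> I \<Longrightarrow> measure_pmf.prob M (X i) \<le> b"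
  shows "measure_pmf.prob M (\<Union>i\<in>I. X i) \<le> real (card I) * b"
proof -
  have "measure_pmf.prob M (\<Union>i\<in>I. X i) \<le> (\<Sum>i\<in>I. measure_pmf.prob M (X i))"
    by (rule measure_pmf.finite_measure_subadditive_finite) (use assms in auto)
  also have "\<dots> \<le> (\<Sum>i\<in>I. b)" by (rule sum_mono) (use assms in auto)
  finally show ?thesis by simp
qed

text \<open>A single term of the exponential series gives \<open>t ^ t / fact t \<le> exp t\<close>,
  and \<open>exp 1 \<le> 3\<close>.\<close>

lemma binomial_le_power_div: "real (a choose t) \<le> (3 * real a / real t) ^ t"
proof (cases "t = 0")
  case False
  have "real t ^ t / fact t \<le> exp (real t)"
  proof -
    have "(\<Sum>i\<in>{t}. real t ^ i /\<^sub>R fact i) \<le> (\<Sum>i. real t ^ i /\<^sub>R fact i)"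
      by (rule sum_le_suminf[OF summable_exp_generic]) auto
    then show ?thesis by (simp add: exp_def divide_inverse mult.commute)
  qed
  also have "exp (real t) = exp 1 ^ t" by (simp add: exp_of_nat_mult[symmetric])
  also have "\<dots> \<le> 3 ^ t" by (rule power_mono) (use exp_le in auto)
  finally have f: "real t ^ t \<le> 3 ^ t * fact t" by (simp add: field_simps)
  have "real (a choose t) * real t ^ t \<le> real (a choose t) * (3 ^ t * fact t)"
    by (rule mult_left_mono) (use f in auto)
  also have "\<dots> = 3 ^ t * real ((a choose t) * fact t)" by simp
  also have "\<dots> \<le> 3 ^ t * real (a ^ t)"
    by (intro mult_left_mono of_nat_mono binomial_fact_pow) auto
  finally show ?thesis using False
    by (simp add: power_divide power_mult_distrib pos_le_divide_eq)
qed simp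

definition random_subset :: "'a set \<Rightarrow> real \<Rightarrow> 'a set pmf" where
  "random_subset E p = map_pmf (\<lambda>f. {x \<in> E. f x}) (Pi_pmf E False (\<lambda>_. bernoulli_pmf p))"

lemma set_pmf_random_subset: "H \<in> set_pmf (random_subset E p) \<Longrightarrow> H \<subseteq> E"
  by (auto simp: random_subset_def)

lemma prob_random_subset_superset:
  assumes "finite E" "S \<subseteq> E" "0 \<le> p" "p \<le> 1"
  shows "measure_pmf.prob (random_subset E p) {H. S \<subseteq> H} = p ^ card S"
proof -
  have "measure_pmf.prob (random_subset E p) {H. S \<subseteq> H}
      = measure_pmf.prob (Pi_pmf E False (\<lambda>_. bernoulli_pmf p))
          (Pi E (\<lambda>x. if x \<in> S then {True} else UNIV))"
    unfolding random_subset_def measure_map_pmf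
    by (rule arg_cong[where f = "measure_pmf.prob _"])
       (use assms(2) in \<open>auto simp: Pi_def split: if_splits\<close>)
  also have "\<dots> = (\<Prod>x\<in>E. if x \<in> S then p else 1)"
    unfolding measure_Pi_pmf_Pi[OF assms(1)]
    by (rule prod.cong) (use assms(3,4) in \<open>auto simp: measure_pmf_single\<close>)
  also have "\<dots> = (\<Prod>x\<in>S. p)"
    using assms(1,2) by (simp add: prod.If_cases Int_absorb1)
  finally show ?thesis by simp
qed

text \<open>The case \<open>l = 1\<close>: since \<open>1 - exp (- 1) \<ge> 1/2\<close>, the moment
  is at most \<open>exp (- p * card S / 2)\<close>, and the threshold gives back half of that
  exponent.\<close>

lemma prob_random_subset_lower_tail:
  assumes "finite E" "S \<subseteq> E" "0 \<le> p" "p \<le> 1"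
  shows "measure_pmf.prob (random_subset E p) {H. real (card (S \<inter> H)) \<le> p * real (card S) / 4}
    \<le> exp (- (p * real (card S) / 4))"
proof -
  let ?c = "real (card S)"
  have e: "{a \<in> S. f a} = S \<inter> {x \<in> E. f x}" for f using assms(2) by auto
  have "measure_pmf.prob (random_subset E p) {H. real (card (S \<inter> H)) \<le> p * ?c / 4}
      = measure_pmf.prob (Pi_pmf E False (\<lambda>_. bernoulli_pmf p))
         {f. real (card {a \<in> S. f a}) \<le> p * ?c / 4}"
    unfolding random_subset_def measure_map_pmf e by (simp add: vimage_def)
  also have "\<dots> \<le> exp (1 * (p * ?c / 4)) * (1 - p * (1 - exp (- 1))) ^ card S"
  proof (rule Pi_pmf_lower_tail[where P = "\<lambda>a x. x"])
    have "{x. x} = {True}" by auto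
    then show "p \<le> measure_pmf.prob (bernoulli_pmf p) {x. x}"
      using assms by (simp add: measure_pmf_single)
  qed (use assms in auto)
  also have "(1 - p * (1 - exp (- 1))) ^ card S \<le> exp (- p / 2) ^ card S"
  proof (rule power_mono)
    have e2: "exp (- 1 :: real) \<le> 1 / 2"
      using exp_ge_add_one_self[of "1::real"] by (simp add: exp_minus field_simps)
    have "1 - p * (1 - exp (- 1)) \<le> 1 - p * (1 / 2)"
      using e2 assms by (intro diff_left_mono mult_left_mono) auto
    also have "\<dots> \<le> exp (- p / 2)" using exp_ge_add_one_self[of "- p / 2"] by simp
    finally show "1 - p * (1 - exp (- 1)) \<le> exp (- p / 2)" .
    have "p * (1 - exp (- 1)) \<le> 1 * 1" by (rule mult_mono) (use assms in auto)
    then show "0 \<le> 1 - p * (1 - exp (- 1))" by simp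
  qed
  also have "exp (1 * (p * ?c / 4)) * exp (- p / 2) ^ card S = exp (- (p * ?c / 4))"
    by (simp add: exp_of_nat_mult[symmetric] exp_add[symmetric] field_simps)
  finally show ?thesis by simp
qed

text \<open>Configurations that share edges are correlated, disjoint ones are independent:
  \<open>t\<close> of them appear together with probability \<open>p ^ (r * t)\<close>, and the
  choice of the family costs \<open>(3 * card F / t) ^ t\<close>. So \<open>x\<close> is, up to the
  factor 3, the expected number of members of \<open>F\<close> divided by \<open>t\<close>.\<close>

lemma prob_disjoint_members_le:
  assumes fin: "finite E" and p: "0 \<le> p" "p \<le> 1" and F: "finite F"
    and mem: "\<And>A. A \<in> F \<Longrightarrow> A \<subseteq> E \<and> card A = r"
    and x: "3 * real (card F) * p ^ r \<le> x * real t"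
    and x0: "0 \<le> x"
  shows "measure_pmf.prob (random_subset E p)
      {H. \<exists>T\<subseteq>F. card T = t \<and> disjoint T \<and> \<Union>T \<subseteq> H} \<le> x ^ t"
proof (cases "t = 0")
  case False
  let ?I = "{T. T \<subseteq> F \<and> card T = t}"
  have finT: "finite T" if "T \<subseteq> F" for T using that F finite_subset by blast
  have "measure_pmf.prob (random_subset E p) {H. \<exists>T\<subseteq>F. card T = t \<and> disjoint T \<and> \<Union>T \<subseteq> H}
      = measure_pmf.prob (random_subset E p) (\<Union>T\<in>?I. {H. disjoint T \<and> \<Union>T \<subseteq> H})"
    by (rule arg_cong[where f = "measure_pmf.prob _"]) auto
  also have "\<dots> \<le> real (card ?I) * p ^ (r * t)"
  proof (rule prob_UN_le)
    fix T assume T: "T \<in> ?I"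
    show "measure_pmf.prob (random_subset E p) {H. disjoint T \<and> \<Union>T \<subseteq> H} \<le> p ^ (r * t)"
    proof (cases "disjoint T")
      case True
      have "card (\<Union>T) = (\<Sum>A\<in>T. card A)"
      proof (rule card_Union_disjoint)
        show "finite A" if "A \<in> T" for A by (rule finite_subset[OF _ fin]) (use that T mem in blast)
        show "pairwise disjnt T"
          using True unfolding disjoint_def pairwise_def disjnt_def by simp
      qed
      also have "\<dots> = (\<Sum>A\<in>T. r)" by (rule sum.cong) (use T mem in auto)
      finally have c: "card (\<Union>T) = r * t" using T by simp
      have "\<Union>T \<subseteq> E" using T mem by blast
      then show ?thesis using True prob_random_subset_superset[OF fin _ p, of "\<Union>T"] c by simp
    qed (use p in auto)
  qed (use F in simp)
  also have "card ?I = card F choose t" using n_subsets[OF F] by simp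
  also have "real (card F choose t) * p ^ (r * t) \<le> (3 * real (card F) / real t) ^ t * p ^ (r * t)"
    by (rule mult_right_mono[OF binomial_le_power_div]) (use p in auto)
  also have "\<dots> = (3 * real (card F) * p ^ r / real t) ^ t"
    by (simp add: power_mult power_mult_distrib power_divide)
  also have "\<dots> \<le> x ^ t"
    by (rule power_mono) (use x p False in \<open>auto simp: pos_divide_le_eq\<close>)
  finally show ?thesis .
qed simp

section \<open>Codegrees, transversals and triangle removal\<close>

definition pairs_on :: "'a set \<Rightarrow> 'a set set" where
  "pairs_on X = {e. e \<subseteq> X \<and> card e = 2}"

lemma finite_pairs_on: "finite X \<Longrightarrow> finite (pairs_on X)"
  by (auto simp: pairs_on_def)

lemma doubleton_in_pairs_on: "{a, b} \<in> pairs_on X \<longleftrightarrow> a \<in> X \<and> b \<in> X \<and> a \<noteq> b"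
  by (auto simp: pairs_on_def card_insert_if)

lemma pairs_onE:
  assumes "e \<in> pairs_on X"
  obtains a b where "e = {a, b}" "a \<noteq> b" "a \<in> X" "b \<in> X"
  using assms by (auto simp: pairs_on_def card_2_iff)

definition nbrs :: "'a set set \<Rightarrow> 'a \<Rightarrow> 'a set" where
  "nbrs H v = {w. {v, w} \<in> H}"

definition codeg_pos :: "'a set set \<Rightarrow> 'a \<Rightarrow> 'a \<Rightarrow> bool" where
  "codeg_pos H a b \<longleftrightarrow> (\<exists>w. {a, w} \<in> H \<and> {b, w} \<in> H)"

text \<open>The factor 2 allows for edges seen from both ends, as \<open>S\<close> and
  \<open>J\<close> may overlap.\<close>

lemma sum_nbrs_le:
  assumes fin: "finite X" and H: "H \<subseteq> pairs_on V" and sub: "S \<subseteq> X" "J \<subseteq> X"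
  shows "(\<Sum>w\<in>S. card (nbrs H w \<inter> J)) \<le> 2 * card (induced_edges H X)"
proof -
  let ?I = "induced_edges H X"
  have finS: "finite S" and finJ: "finite J" using sub fin finite_subset by blast+
  have finI: "finite ?I" by (rule finite_subset[of _ "Pow X"]) (use fin in \<open>auto simp: induced_edges_def\<close>)
  have card2: "card (directions e) = 2" "finite (directions e)" if "e \<in> ?I" for e
  proof -
    have "e \<in> pairs_on V" using that H by (auto simp: induced_edges_def)
    then obtain a b where "e = {a, b}" "a \<noteq> b" by (rule pairs_onE)
    then show "card (directions e) = 2" "finite (directions e)" by (simp_all add: directions_insert)
  qed
  have "(\<Sum>w\<in>S. card (nbrs H w \<inter> J)) = card (SIGMA w:S. nbrs H w \<inter> J)"
    using finS finJ by (subst card_SigmaI) auto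
  also have "\<dots> \<le> card (\<Union>e\<in>?I. directions e)"
    by (rule card_mono)
       (use finI card2 sub in \<open>auto simp: nbrs_def induced_edges_def directions_def\<close>)
  also have "\<dots> \<le> (\<Sum>e\<in>?I. card (directions e))" by (rule card_UN_le[OF finI])
  also have "\<dots> = 2 * card ?I" using card2 by simp
  finally show ?thesis .
qed

text \<open>Each pair is charged to a common neighbour \<open>w\<close>, which accounts for at most
  the square of \<open>card (N w)\<close>. Outside \<open>J\<close>, the \<open>w\<close> with few
  neighbours in \<open>J\<close> are limited by the cherry bound. For those with many, and for
  \<open>w\<close> in \<open>J\<close>, sparsity bounds the sum of \<open>card (N w)\<close>, and
  the degree bound converts it into a sum of squares.\<close>

lemma card_codeg_pos_le:
  fixes H :: "'a set set"
  assumes finV: "finite V" and H: "H \<subseteq> pairs_on V" and K: "1 \<le> K" and j: "1 \<le> j"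
    and deg: "\<And>w. w \<in> V \<Longrightarrow> card (nbrs H w) \<le> \<Delta>"
    and sparse: "\<And>X. X \<subseteq> V \<Longrightarrow> card X \<le> 2 * j \<Longrightarrow> card (induced_edges H X) \<le> K * j"
    and cherry: "\<And>J. J \<subseteq> V \<Longrightarrow> card J = j \<Longrightarrow> card {w \<in> V - J. 2 \<le> card (nbrs H w \<inter> J)} \<le> \<theta>"
    and J: "J \<subseteq> V" "card J = j"
  shows "card {(a, b) \<in> J \<times> J. a \<noteq> b \<and> codeg_pos H a b} \<le> \<theta> * (2 * K + 1)\<^sup>2 + \<Delta> * (4 * K * j)"
proof -
  define N where "N w = nbrs H w \<inter> J" for w
  define A1 where "A1 = {w \<in> V - J. 2 \<le> card (N w) \<and> card (N w) \<le> 2 * K}"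
  define A2 where "A2 = {w \<in> V - J. 2 * K + 1 \<le> card (N w)}"
  have finJ: "finite J" using J finV finite_subset by blast
  have finN: "finite (N w)" for w using finJ by (simp add: N_def)
  have nbrsV: "nbrs H w \<subseteq> V" for w
    using H by (auto simp: nbrs_def pairs_on_def)
  have finA: "finite A1" "finite A2" using finV by (auto simp: A1_def A2_def)
  have NA: "card (N w) \<le> \<Delta>" if "w \<in> V" for w
    using card_mono[of "nbrs H w" "N w"] deg[OF that] nbrsV[of w] finV finite_subset
    by (fastforce simp: N_def)
  \<comment> \<open>Otherwise \<open>j\<close> of these vertices and \<open>J\<close> would span
    more than \<open>K * j\<close> edges on at most \<open>2 * j\<close> vertices. The bound on
    \<open>card A2\<close> is what allows sparsity to be applied to all of \<open>A2\<close>
    afterwards.\<close>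
  have A2j: "card A2 < j"
  proof (rule ccontr)
    assume "\<not> card A2 < j"
    then obtain S where S: "S \<subseteq> A2" "card S = j" "finite S"
      by (metis obtain_subset_with_card_n not_le)
    have "card (J \<union> S) \<le> 2 * j" using card_Un_le[of J S] J S by simp
    then have e: "card (induced_edges H (J \<union> S)) \<le> K * j"
      by (intro sparse) (use S J in \<open>auto simp: A2_def\<close>)
    have "j * (2 * K + 1) = (\<Sum>w\<in>S. 2 * K + 1)" using S by simp
    also have "\<dots> \<le> (\<Sum>w\<in>S. card (N w))" by (rule sum_mono) (use S in \<open>auto simp: A2_def\<close>)
    also have "\<dots> \<le> 2 * card (induced_edges H (J \<union> S))"
      unfolding N_def by (rule sum_nbrs_le[OF _ H]) (use S finJ in auto)
    also have "\<dots> \<le> 2 * (K * j)" using e by simp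
    finally show False using j by (simp add: algebra_simps)
  qed
  have s2: "(\<Sum>w\<in>A2. card (N w)) \<le> 2 * (K * j)"
  proof -
    have "card (J \<union> A2) \<le> 2 * j" using card_Un_le[of J A2] J A2j by simp
    then have e: "card (induced_edges H (J \<union> A2)) \<le> K * j"
      by (intro sparse) (use J in \<open>auto simp: A2_def\<close>)
    have "(\<Sum>w\<in>A2. card (N w)) \<le> 2 * card (induced_edges H (J \<union> A2))"
      unfolding N_def by (rule sum_nbrs_le[OF _ H]) (use finA finJ in auto)
    then show ?thesis using e by simp
  qed
  have s3: "(\<Sum>w\<in>J. card (N w)) \<le> 2 * (K * j)"
  proof -
    have "card (induced_edges H J) \<le> K * j" by (rule sparse) (use J in auto)
    moreover have "(\<Sum>w\<in>J. card (N w)) \<le> 2 * card (induced_edges H J)"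
      unfolding N_def by (rule sum_nbrs_le[OF finJ H]) auto
    ultimately show ?thesis by simp
  qed
  have sq: "(\<Sum>w\<in>A. (card (N w))\<^sup>2) \<le> \<Delta> * (\<Sum>w\<in>A. card (N w))" if "A \<subseteq> V" for A
    unfolding sum_distrib_left power2_eq_square
    by (rule sum_mono) (use NA that in \<open>auto intro!: mult_right_mono\<close>)
  have "{(a, b) \<in> J \<times> J. a \<noteq> b \<and> codeg_pos H a b} \<subseteq> (\<Union>w\<in>A1 \<union> A2 \<union> J. N w \<times> N w)"
  proof clarify
    fix a b assume ab: "a \<in> J" "b \<in> J" "a \<noteq> b" "codeg_pos H a b"
    then obtain w where w: "{a, w} \<in> H" "{b, w} \<in> H" by (auto simp: codeg_pos_def)
    then have N: "a \<in> N w" "b \<in> N w" using ab by (auto simp: N_def nbrs_def insert_commute)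
    have "card {a, b} \<le> card (N w)" by (rule card_mono[OF finN]) (use N in auto)
    then have "2 \<le> card (N w)" using ab by simp
    moreover have "w \<in> V" using w H by (auto simp: pairs_on_def)
    ultimately have "w \<in> A1 \<union> A2 \<union> J" by (auto simp: A1_def A2_def)
    then show "(a, b) \<in> (\<Union>w\<in>A1 \<union> A2 \<union> J. N w \<times> N w)" using N by blast
  qed
  then have "card {(a, b) \<in> J \<times> J. a \<noteq> b \<and> codeg_pos H a b} \<le> card (\<Union>w\<in>A1 \<union> A2 \<union> J. N w \<times> N w)"
    by (rule card_mono[rotated]) (use finA finJ finN in auto)
  also have "\<dots> \<le> (\<Sum>w\<in>A1 \<union> A2 \<union> J. card (N w \<times> N w))"
    by (rule card_UN_le) (use finA finJ in auto)
  also have "\<dots> = (\<Sum>w\<in>A1 \<union> A2 \<union> J. (card (N w))\<^sup>2)"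
    by (simp add: card_cartesian_product power2_eq_square)
  also have "\<dots> \<le> (\<Sum>w\<in>A1. (card (N w))\<^sup>2) + (\<Sum>w\<in>A2. (card (N w))\<^sup>2) + (\<Sum>w\<in>J. (card (N w))\<^sup>2)"
  proof -
    have un: "sum f (A \<union> B) \<le> sum f A + sum f B" if "finite A" "finite B"
      for f :: "'a \<Rightarrow> nat" and A B
      using sum.union_inter[OF that, of f] by linarith
    show ?thesis
      using un[of "A1 \<union> A2" J "\<lambda>w. (card (N w))\<^sup>2"] un[of A1 A2 "\<lambda>w. (card (N w))\<^sup>2"] finA finJ
      by simp
  qed
  also have "(\<Sum>w\<in>A1. (card (N w))\<^sup>2) \<le> (\<Sum>w\<in>A1. (2 * K + 1)\<^sup>2)"
    by (intro sum_mono power_mono) (auto simp: A1_def)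
  also have "(\<Sum>w\<in>A1. (2 * K + 1)\<^sup>2) = card A1 * (2 * K + 1)\<^sup>2" by simp
  also have "card A1 \<le> \<theta>"
  proof -
    have "card A1 \<le> card {w \<in> V - J. 2 \<le> card (nbrs H w \<inter> J)}"
      by (rule card_mono) (use finV in \<open>auto simp: A1_def N_def\<close>)
    then show ?thesis using cherry[OF J] by simp
  qed
  also have "(\<Sum>w\<in>A2. (card (N w))\<^sup>2) \<le> \<Delta> * (2 * (K * j))"
    by (rule order_trans[OF sq mult_left_mono[OF s2]]) (auto simp: A2_def)
  also have "(\<Sum>w\<in>J. (card (N w))\<^sup>2) \<le> \<Delta> * (2 * (K * j))"
    by (rule order_trans[OF sq mult_left_mono[OF s3]]) (use J in auto)
  finally show ?thesis by (simp add: algebra_simps)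
qed

text \<open>Sort \<open>T\<close> by \<open>g\<close>, so that fibres become intervals of at most
  \<open>M\<close> positions, and deal the positions out modulo \<open>M\<close>. Two positions of
  one fibre with equal residue would be at least \<open>M\<close> apart, so the fibre would have
  more than \<open>M\<close> elements.\<close>

lemma balanced_transversals:
  fixes g :: "nat \<Rightarrow> 'b::linorder"
  assumes T: "finite T" "card T = M * k" and fib: "\<And>y. card {x \<in> T. g x = y} \<le> M"
  shows "\<exists>C. T = (\<Union>a<M. C a) \<and> (\<forall>a<M. card (C a) \<le> k \<and> inj_on g (C a))"
proof -
  define xs where "xs = sort_key g (sorted_list_of_set T)"
  have xs: "set xs = T" "distinct xs" "sorted (map g xs)" "length xs = M * k"
    using T by (auto simp: xs_def)
  define C where "C a = (\<lambda>i. xs ! i) ` {i. i < M * k \<and> i mod M = a}" for a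
  show ?thesis
  proof (intro exI[of _ C] conjI allI impI)
    show "T = (\<Union>a<M. C a)"
    proof (intro equalityI subsetI)
      fix x assume "x \<in> T"
      then obtain i where i: "i < M * k" "x = xs ! i" using xs by (metis in_set_conv_nth)
      then have "0 < M" by (cases M) auto
      then have "x \<in> C (i mod M)" "i mod M < M" using i by (auto simp: C_def)
      then show "x \<in> (\<Union>a<M. C a)" by blast
    qed (use xs in \<open>auto simp: C_def\<close>)
    fix a assume a: "a < M"
    have "card (C a) \<le> card {i. i < M * k \<and> i mod M = a}" unfolding C_def by (rule card_image_le) simp
    also have "\<dots> \<le> card {..<k}"
    proof (rule card_inj_on_le)
      show "inj_on (\<lambda>i. i div M) {i. i < M * k \<and> i mod M = a}"
        by (intro inj_onI) (metis (mono_tags, lifting) div_mult_mod_eq mem_Collect_eq)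
      show "(\<lambda>i. i div M) ` {i. i < M * k \<and> i mod M = a} \<subseteq> {..<k}"
        using a by (auto simp: div_less_iff_less_mult mult.commute)
    qed simp
    finally show "card (C a) \<le> k" by simp
    have key: False if i: "i < i'" "i' < M * k" "i mod M = a" "i' mod M = a"
      and eq: "g (xs ! i) = g (xs ! i')" for i i'
    proof -
      have "M dvd i' - i" using i by (metis mod_eq_dvd_iff_nat less_imp_le)
      then have le: "i + M \<le> i'" using i(1) by (auto dest: dvd_imp_le)
      have "g (xs ! l) = g (xs ! i)" if "l \<in> {i..i + M}" for l
      proof -
        have l: "i \<le> l" "l \<le> i'" "l < length xs" using that le i xs by auto
        then have "map g xs ! i \<le> map g xs ! l" "map g xs ! l \<le> map g xs ! i'"
          using sorted_nth_mono[OF xs(3), of i l] sorted_nth_mono[OF xs(3), of l i'] i xs by auto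
        then show ?thesis using eq l i xs by simp
      qed
      then have "(\<lambda>l. xs ! l) ` {i..i + M} \<subseteq> {x \<in> T. g x = g (xs ! i)}"
      proof -
        assume *: "\<And>l. l \<in> {i..i + M} \<Longrightarrow> g (xs ! l) = g (xs ! i)"
        have "xs ! l \<in> T" if "l \<in> {i..i + M}" for l
          using that le i xs nth_mem[of l xs] by simp
        then show ?thesis using * by blast
      qed
      then have "card ((\<lambda>l. xs ! l) ` {i..i + M}) \<le> card {x \<in> T. g x = g (xs ! i)}"
        by (rule card_mono[rotated]) (use T in simp)
      moreover have "inj_on (\<lambda>l. xs ! l) {i..i + M}"
        by (rule inj_on_nth[OF xs(2)]) (use le i xs in auto)
      ultimately show False using fib[of "g (xs ! i)"] by (simp add: card_image)
    qed
    show "inj_on g (C a)"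
    proof (intro inj_onI)
      fix x y assume "x \<in> C a" "y \<in> C a" and eq: "g x = g y"
      then obtain i i' where i: "i < M * k" "i mod M = a" "x = xs ! i"
        and i': "i' < M * k" "i' mod M = a" "y = xs ! i'"
        by (auto simp: C_def)
      show "x = y"
        using key[of i i'] key[of i' i] i i' eq by (metis nat_neq_iff)
    qed
  qed
qed

text \<open>Splitting \<open>T\<close> into transversals of \<open>g\<close> transfers a bound on the number of related pairs in
  small sets of parts to sets \<open>T\<close> that may meet the parts in many vertices.\<close>

lemma card_related_pairs_le:
  fixes g :: "nat \<Rightarrow> 'b::linorder"
  assumes T: "finite T" "card T = M * k" "g ` T \<subseteq> W" and fib: "\<And>y. card {x \<in> T. g x = y} \<le> M"
    and R: "\<And>J. J \<subseteq> W \<Longrightarrow> card J \<le> 2 * k \<Longrightarrow> card {(a, b) \<in> J \<times> J. a \<noteq> b \<and> R a b} \<le> q"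
  shows "card {(x, y) \<in> T \<times> T. g x = g y \<or> R (g x) (g y)} \<le> card T * M + M\<^sup>2 * q"
proof -
  obtain C where C: "T = (\<Union>a<M. C a)" "\<forall>a<M. card (C a) \<le> k \<and> inj_on g (C a)"
    using balanced_transversals[OF T(1,2) fib] by blast
  define P where "P a b = {(x, y) \<in> C a \<times> C b. g x \<noteq> g y \<and> R (g x) (g y)}" for a b
  have Cf: "finite (C a)" if "a < M" for a using C(1) T(1) that by (auto intro: finite_subset)
  have Pq: "card (P a b) \<le> q" if ab: "a < M" "b < M" for a b
  proof -
    \<comment> \<open>The ends of a related pair may lie in different transversals, so two of them
      are taken together; hence \<open>2 * k\<close> in the assumption on \<open>R\<close>.\<close>
    let ?J = "g ` C a \<union> g ` C b"
    have fJ: "finite ?J" using Cf ab by auto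
    have "card ?J \<le> card (g ` C a) + card (g ` C b)" by (rule card_Un_le)
    also have "\<dots> \<le> card (C a) + card (C b)"
      by (intro add_mono card_image_le Cf ab)
    also have "\<dots> \<le> 2 * k" using C(2) ab by (auto simp: add_mono mult_2)
    finally have "card {(a, b) \<in> ?J \<times> ?J. a \<noteq> b \<and> R a b} \<le> q"
      by (intro R) (use C(1) T(3) ab in auto)
    moreover have "card (P a b) \<le> card {(a, b) \<in> ?J \<times> ?J. a \<noteq> b \<and> R a b}"
    proof (rule card_inj_on_le)
      show "inj_on (map_prod g g) (P a b)"
        by (rule inj_on_subset[OF map_prod_inj_on, of g "C a" g "C b"])
           (use C(2) ab in \<open>auto simp: P_def\<close>)
      show "map_prod g g ` P a b \<subseteq> {(a, b) \<in> ?J \<times> ?J. a \<noteq> b \<and> R a b}" by (auto simp: P_def)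
      show "finite {(a, b) \<in> ?J \<times> ?J. a \<noteq> b \<and> R a b}"
        by (rule finite_subset[of _ "?J \<times> ?J"]) (use fJ in auto)
    qed
    ultimately show ?thesis by simp
  qed
  have finP: "finite (P a b)" if "a < M" "b < M" for a b
    by (rule finite_subset[of _ "C a \<times> C b"]) (use Cf that in \<open>auto simp: P_def\<close>)
  have "{(x, y) \<in> T \<times> T. g x = g y \<or> R (g x) (g y)}
      \<subseteq> (SIGMA x:T. {y \<in> T. g y = g x}) \<union> (\<Union>(a, b)\<in>{..<M} \<times> {..<M}. P a b)"
    using C(1) by (fastforce simp: P_def)
  then have "card {(x, y) \<in> T \<times> T. g x = g y \<or> R (g x) (g y)}
      \<le> card ((SIGMA x:T. {y \<in> T. g y = g x}) \<union> (\<Union>(a, b)\<in>{..<M} \<times> {..<M}. P a b))"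
    by (rule card_mono[rotated]) (use T(1) finP in auto)
  also have "\<dots> \<le> card (SIGMA x:T. {y \<in> T. g y = g x}) + card (\<Union>(a, b)\<in>{..<M} \<times> {..<M}. P a b)"
    by (rule card_Un_le)
  also have "card (SIGMA x:T. {y \<in> T. g y = g x}) \<le> card T * M"
  proof -
    have "card (SIGMA x:T. {y \<in> T. g y = g x}) = (\<Sum>x\<in>T. card {y \<in> T. g y = g x})"
      using T(1) by (subst card_SigmaI) auto
    also have "\<dots> \<le> (\<Sum>x\<in>T. M)" by (rule sum_mono) (rule fib)
    finally show ?thesis by simp
  qed
  also have "card (\<Union>(a, b)\<in>{..<M} \<times> {..<M}. P a b) \<le> (\<Sum>(a, b)\<in>{..<M} \<times> {..<M}. card (P a b))"
    using card_UN_le[of "{..<M} \<times> {..<M}" "\<lambda>(a, b). P a b"] by (simp add: case_prod_unfold)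
  also have "\<dots> \<le> (\<Sum>(a, b)\<in>{..<M} \<times> {..<M}. q)"
    by (rule sum_mono) (use Pq in auto)
  also have "\<dots> = M\<^sup>2 * q" by (simp add: case_prod_unfold power2_eq_square)
  finally show ?thesis by simp
qed

text \<open>Triangles are sets of edges, so \<open>disjoint\<close> means edge-disjoint. The third
  vertex ranges over all of \<open>V\<close> because such a triangle, too, can cost \<open>X\<close>
  an edge when it is removed.\<close>

definition triangles_meeting :: "'a set \<Rightarrow> 'a set \<Rightarrow> 'a set set set" where
  "triangles_meeting V X =
     {{{a, b}, {b, c}, {a, c}} |a b c. a \<in> X \<and> b \<in> X \<and> c \<in> V \<and> a \<noteq> b \<and> b \<noteq> c \<and> a \<noteq> c}"

lemma card_triangle: "a \<noteq> b \<Longrightarrow> b \<noteq> c \<Longrightarrow> a \<noteq> c \<Longrightarrow> card {{a, b}, {b, c}, {a, c}} = 3"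
  by (auto simp: card_insert_if doubleton_eq_iff)

text \<open>Removing the edges of a maximal edge-disjoint family of triangles destroys all triangles.\<close>

lemma triangle_free_subgraph:
  assumes finV: "finite V" and H: "H \<subseteq> pairs_on V"
  shows "\<exists>H'\<subseteq>H. triangle_free H' \<and>
    (\<forall>X\<subseteq>V. \<forall>t. \<not> (\<exists>T\<subseteq>triangles_meeting V X. card T = t \<and> disjoint T \<and> \<Union>T \<subseteq> H) \<longrightarrow>
       card (induced_edges (H - H') X) \<le> 3 * t)"
proof -
  let ?Q = "{T. T \<subseteq> triangles_meeting V V \<and> disjoint T \<and> \<Union>T \<subseteq> H}"
  have finH: "finite H" using H finV finite_pairs_on finite_subset by blast
  have "?Q \<subseteq> Pow (Pow H)" by auto
  then have "finite ?Q" using finH by (auto intro: finite_subset)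
  moreover have "{} \<in> ?Q" by auto
  ultimately obtain T where T: "T \<in> ?Q" and max: "\<And>T'. T' \<in> ?Q \<Longrightarrow> T \<subseteq> T' \<Longrightarrow> T' = T"
    using finite_has_maximal[of ?Q] by (metis (no_types, lifting) empty_iff)
  have Tsub: "T \<subseteq> triangles_meeting V V" "disjoint T" "\<Union>T \<subseteq> H" using T by auto
  have finT: "finite T" using Tsub(3) finH by (auto intro: finite_subset[of T "Pow H"])
  let ?H' = "H - \<Union>T"
  have "triangle_free ?H'"
    unfolding triangle_free_def
  proof safe
    fix x y z assume e: "{x, y} \<in> H" "{y, z} \<in> H" "{x, z} \<in> H"
      and n: "{x, y} \<notin> \<Union>T" "{y, z} \<notin> \<Union>T" "{x, z} \<notin> \<Union>T"
    let ?t = "{{x, y}, {y, z}, {x, z}}"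
    have d: "x \<in> V" "y \<in> V" "z \<in> V" "x \<noteq> y" "y \<noteq> z" "x \<noteq> z"
      using subsetD[OF H e(1)] subsetD[OF H e(2)] subsetD[OF H e(3)]
      unfolding doubleton_in_pairs_on by blast+
    have disj: "A \<inter> ?t = {}" if "A \<in> T" for A using n that by auto
    have "insert ?t T \<in> ?Q"
      using Tsub e d disj by (auto simp: triangles_meeting_def disjoint_def)
    then have "insert ?t T = T" using max by blast
    then have "?t \<in> T" by blast
    then show False using n by blast
  qed
  moreover have "card (induced_edges (H - ?H') X) \<le> 3 * t"
    if X: "X \<subseteq> V" and no: "\<not> (\<exists>T\<subseteq>triangles_meeting V X. card T = t \<and> disjoint T \<and> \<Union>T \<subseteq> H)" for X t
  proof -
    \<comment> \<open>Only these members of \<open>T\<close> contain an edge inside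
      \<open>X\<close>, and more than \<open>t\<close> of them would contain a forbidden
      family.\<close>
    let ?S = "T \<inter> triangles_meeting V X"
    have finS: "finite ?S" using finT by simp
    have "card ?S \<le> t"
    proof (rule ccontr)
      assume "\<not> card ?S \<le> t"
      then obtain S where S: "S \<subseteq> ?S" "card S = t"
        by (metis obtain_subset_with_card_n nat_le_linear)
      then have ST: "S \<subseteq> T" by blast
      have dS: "disjoint S"
        unfolding disjoint_def
      proof (intro ballI impI)
        fix A B assume "A \<in> S" "B \<in> S" "A \<noteq> B"
        then show "A \<inter> B = {}" using Tsub(2) ST unfolding disjoint_def by (meson subsetD)
      qed
      have "\<Union>S \<subseteq> H" by (rule order_trans[OF Union_mono[OF ST] Tsub(3)])
      then show False using no S dS by (metis Int_subset_iff)
    qed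
    have c3: "card A = 3" "finite A" if "A \<in> ?S" for A
      using that by (auto simp: triangles_meeting_def card_triangle)
    have "induced_edges (H - ?H') X \<subseteq> \<Union>?S"
    proof
      fix e assume e: "e \<in> induced_edges (H - ?H') X"
      then obtain A where A: "A \<in> T" "e \<in> A" "e \<subseteq> X" by (auto simp: induced_edges_def)
      then obtain a b c where abc: "A = {{a, b}, {b, c}, {a, c}}" "a \<in> V" "b \<in> V" "c \<in> V"
        "a \<noteq> b" "b \<noteq> c" "a \<noteq> c"
        using subsetD[OF Tsub(1) A(1)] unfolding triangles_meeting_def by blast
      \<comment> \<open>Renamings of the vertices that put the edge inside \<open>X\<close> first,
        as \<open>triangles_meeting\<close> asks.\<close>
      have P: "A = {{b, c}, {c, a}, {b, a}}" "A = {{a, c}, {c, b}, {a, b}}"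
        using abc(1) by (auto simp: insert_commute)
      have "A \<in> triangles_meeting V X"
      proof -
        consider "e = {a, b}" | "e = {b, c}" | "e = {a, c}" using A(2) abc(1) by blast
        then show ?thesis
        proof cases
          case 1 then show ?thesis using abc A(3) unfolding triangles_meeting_def by blast
        next
          case 2 then show ?thesis using abc(2-) P(1) A(3) unfolding triangles_meeting_def by blast
        next
          case 3 then show ?thesis using abc(2-) P(2) A(3) unfolding triangles_meeting_def by blast
        qed
      qed
      then show "e \<in> \<Union>?S" using A by blast
    qed
    then have "card (induced_edges (H - ?H') X) \<le> card (\<Union>?S)"
      by (rule card_mono[rotated]) (use finS c3 in auto)
    also have "\<dots> \<le> (\<Sum>A\<in>?S. card A)" by (rule card_Union_le_sum_card)
    also have "\<dots> = 3 * card ?S" using c3 by simp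
    finally show ?thesis using \<open>card ?S \<le> t\<close> by simp
  qed
  ultimately show ?thesis by (intro exI[of _ ?H']) auto
qed

lemma card_triangles_meeting:
  assumes "finite V" "X \<subseteq> V"
  shows "finite (triangles_meeting V X)" "card (triangles_meeting V X) \<le> card X * card X * card V"
proof -
  have fX: "finite X" using assms finite_subset by blast
  have sub: "triangles_meeting V X \<subseteq> (\<lambda>(a, b, c). {{a, b}, {b, c}, {a, c}}) ` (X \<times> X \<times> V)"
    by (auto simp: triangles_meeting_def image_def)
  have fin: "finite ((\<lambda>(a, b, c). {{a, b}, {b, c}, {a, c}}) ` (X \<times> X \<times> V))"
    using fX assms(1) by auto
  show "finite (triangles_meeting V X)" using sub fin by (rule finite_subset)
  have "card (triangles_meeting V X) \<le> card (X \<times> X \<times> V)"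
    by (rule order_trans[OF card_mono[OF fin sub] card_image_le]) (use fX assms in auto)
  then show "card (triangles_meeting V X) \<le> card X * card X * card V"
    by (simp add: card_cartesian_product mult.assoc)
qed

section \<open>Random base graphs and crossing partitions\<close>

lemma prob_ex_subset_le:
  assumes V: "finite V" and b: "0 \<le> b"
    and P: "\<And>J. J \<subseteq> V \<Longrightarrow> card J = j \<Longrightarrow> measure_pmf.prob M {H. P J H} \<le> b"
  shows "measure_pmf.prob M {H. \<exists>J\<subseteq>V. card J = j \<and> P J H} \<le> real (card V) ^ j * b"
proof -
  let ?I = "{J. J \<subseteq> V \<and> card J = j}"
  have "{H. \<exists>J\<subseteq>V. card J = j \<and> P J H} = (\<Union>J\<in>?I. {H. P J H})" by auto
  then have "measure_pmf.prob M {H. \<exists>J\<subseteq>V. card J = j \<and> P J H} \<le> real (card ?I) * b"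
    using prob_UN_le[of ?I M "\<lambda>J. {H. P J H}" b] V P by auto
  also have "\<dots> \<le> real (card V) ^ j * b"
  proof (rule mult_right_mono[OF _ b])
    have "card V choose j \<le> (card V choose j) * fact j" by simp
    also have "\<dots> \<le> card V ^ j" by (rule binomial_fact_pow)
    finally have "real (card V choose j) \<le> real (card V ^ j)" by (rule of_nat_mono)
    then show "real (card ?I) \<le> real (card V) ^ j" using n_subsets[OF V, of j] by simp
  qed
  finally show ?thesis .
qed

text \<open>The case \<open>r = 1\<close> of the bound for disjoint families, as distinct singletons
  are disjoint.\<close>

lemma prob_random_subset_upper_tail:
  assumes fin: "finite E" and p: "0 \<le> p" "p \<le> 1" and S: "S \<subseteq> E"
    and x: "3 * real (card S) * p \<le> x * real t" and x0: "0 \<le> x"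
  shows "measure_pmf.prob (random_subset E p) {H. t \<le> card (S \<inter> H)} \<le> x ^ t"
proof -
  have finS: "finite S" using S fin finite_subset by blast
  let ?F = "(\<lambda>e. {e}) ` S"
  have "measure_pmf.prob (random_subset E p) {H. t \<le> card (S \<inter> H)}
      \<le> measure_pmf.prob (random_subset E p) {H. \<exists>T\<subseteq>?F. card T = t \<and> disjoint T \<and> \<Union>T \<subseteq> H}"
  proof (rule measure_pmf.finite_measure_mono)
    show "{H. t \<le> card (S \<inter> H)} \<subseteq> {H. \<exists>T\<subseteq>?F. card T = t \<and> disjoint T \<and> \<Union>T \<subseteq> H}"
    proof clarify
      fix H assume "t \<le> card (S \<inter> H)"
      then obtain R where R: "R \<subseteq> S \<inter> H" "card R = t" by (metis obtain_subset_with_card_n)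
      then show "\<exists>T\<subseteq>?F. card T = t \<and> disjoint T \<and> \<Union>T \<subseteq> H"
        by (intro exI[of _ "(\<lambda>e. {e}) ` R"]) (auto simp: card_image disjoint_def)
    qed
  qed simp
  also have "\<dots> \<le> x ^ t"
    by (rule prob_disjoint_members_le[where r = 1])
       (use assms finS in \<open>auto simp: card_image\<close>)
  finally show ?thesis .
qed

lemma card_pairs_on_le: "finite X \<Longrightarrow> card (pairs_on X) \<le> card X * card X"
  unfolding pairs_on_def
  by (simp add: n_subsets choose_two mult_le_mono2 div_le_dividend order_trans[OF div_le_dividend])

section \<open>Rare events in a random base graph: large degrees, dense spots, cherries,
  triangles\<close>

context
  fixes V :: "'a set" and p :: real
  assumes finV: "finite V" and p: "0 \<le> p" "p \<le> 1"
begin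

lemma prob_large_degree:
  assumes x: "3 * real (card V) * p \<le> x * real t" and x0: "0 \<le> x"
  shows "measure_pmf.prob (random_subset (pairs_on V) p)
      {H. H \<subseteq> pairs_on V \<and> (\<exists>w\<in>V. t \<le> card (nbrs H w))} \<le> real (card V) * x ^ t"
proof -
  \<comment> \<open>The star at \<open>w\<close>. The event demands
    \<open>H \<subseteq> pairs_on V\<close>, which holds on the support, so every neighbour of
    \<open>w\<close> comes from an edge of this star.\<close>
  define S where "S w = (\<lambda>v. {w, v}) ` (V - {w})" for w
  have cS: "card (S w) \<le> card V" for w
    unfolding S_def using card_image_le[of "V - {w}" "\<lambda>v. {w, v}"] card_mono[of V "V - {w}"] finV
    by fastforce
  have "measure_pmf.prob (random_subset (pairs_on V) p)
      {H. H \<subseteq> pairs_on V \<and> (\<exists>w\<in>V. t \<le> card (nbrs H w))}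
    \<le> measure_pmf.prob (random_subset (pairs_on V) p) (\<Union>w\<in>V. {H. t \<le> card (S w \<inter> H)})"
  proof (rule measure_pmf.finite_measure_mono)
    show "{H. H \<subseteq> pairs_on V \<and> (\<exists>w\<in>V. t \<le> card (nbrs H w))} \<subseteq> (\<Union>w\<in>V. {H. t \<le> card (S w \<inter> H)})"
    proof clarify
      fix H w assume H: "H \<subseteq> pairs_on V" "w \<in> V" "t \<le> card (nbrs H w)"
      have "card (nbrs H w) \<le> card (S w \<inter> H)"
      proof (rule card_inj_on_le)
        show "inj_on (\<lambda>v. {w, v}) (nbrs H w)" by (auto simp: inj_on_def doubleton_eq_iff)
        show "(\<lambda>v. {w, v}) ` nbrs H w \<subseteq> S w \<inter> H"
        proof clarify
          fix v assume v: "v \<in> nbrs H w"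
          then have "{w, v} \<in> pairs_on V" using H(1) by (auto simp: nbrs_def)
          then show "{w, v} \<in> S w \<inter> H" using v by (auto simp: S_def doubleton_in_pairs_on nbrs_def)
        qed
        show "finite (S w \<inter> H)" using finV by (simp add: S_def)
      qed
      then have "t \<le> card (S w \<inter> H)" using H(3) by linarith
      then show "H \<in> (\<Union>w\<in>V. {H. t \<le> card (S w \<inter> H)})" using H(2) by blast
    qed
  qed simp
  also have "\<dots> \<le> real (card V) * x ^ t"
  proof (rule prob_UN_le[OF finV])
    fix w assume w: "w \<in> V"
    have "3 * real (card (S w)) * p \<le> 3 * real (card V) * p"
      using cS[of w] p by (intro mult_right_mono) auto
    then show "measure_pmf.prob (random_subset (pairs_on V) p) {H. t \<le> card (S w \<inter> H)} \<le> x ^ t"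
      by (intro prob_random_subset_upper_tail finite_pairs_on finV p x0)
         (use w x in \<open>auto simp: S_def doubleton_in_pairs_on\<close>)
  qed
  finally show ?thesis .
qed

lemma prob_dense_spot:
  assumes x: "3 * (real s * real s) * p \<le> x * real t" and x0: "0 \<le> x"
  shows "measure_pmf.prob (random_subset (pairs_on V) p)
      {H. \<exists>X\<subseteq>V. card X = s \<and> H \<subseteq> pairs_on V \<and> t \<le> card (induced_edges H X)} \<le> real (card V) ^ s * x ^ t"
proof (rule prob_ex_subset_le[OF finV])
  fix X assume X: "X \<subseteq> V" "card X = s"
  have finX: "finite X" using X finV finite_subset by blast
  have "measure_pmf.prob (random_subset (pairs_on V) p)
      {H. H \<subseteq> pairs_on V \<and> t \<le> card (induced_edges H X)}
    \<le> measure_pmf.prob (random_subset (pairs_on V) p) {H. t \<le> card (pairs_on X \<inter> H)}"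
  proof (rule measure_pmf.finite_measure_mono)
    have "card (induced_edges H X) \<le> card (pairs_on X \<inter> H)" if "H \<subseteq> pairs_on V" for H
      by (rule card_mono)
         (use finite_pairs_on[OF finX] that in \<open>auto simp: induced_edges_def pairs_on_def\<close>)
    then show "{H. H \<subseteq> pairs_on V \<and> t \<le> card (induced_edges H X)} \<subseteq> {H. t \<le> card (pairs_on X \<inter> H)}"
      by (auto intro: order_trans)
  qed simp
  also have "\<dots> \<le> x ^ t"
  proof (rule prob_random_subset_upper_tail[OF finite_pairs_on[OF finV] p _ _ x0])
    have "real (card (pairs_on X)) \<le> real (card X * card X)"
      by (rule of_nat_mono[OF card_pairs_on_le[OF finX]])
    then have "3 * real (card (pairs_on X)) * p \<le> 3 * (real s * real s) * p"
      using X(2) p by (intro mult_right_mono) auto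
    then show "3 * real (card (pairs_on X)) * p \<le> x * real t" using x by linarith
    show "pairs_on X \<subseteq> pairs_on V" using X by (auto simp: pairs_on_def)
  qed
  finally show "measure_pmf.prob (random_subset (pairs_on V) p)
      {H. H \<subseteq> pairs_on V \<and> t \<le> card (induced_edges H X)} \<le> x ^ t" .
qed (use x0 in simp)

lemma prob_many_cherries:
  assumes x: "3 * (real (card V) * real j * real j) * p ^ 2 \<le> x * real t" and x0: "0 \<le> x"
  shows "measure_pmf.prob (random_subset (pairs_on V) p)
      {H. \<exists>J\<subseteq>V. card J = j \<and> t \<le> card {w \<in> V - J. 2 \<le> card (nbrs H w \<inter> J)}}
    \<le> real (card V) ^ j * x ^ t"
proof (rule prob_ex_subset_le[OF finV])
  fix J assume J: "J \<subseteq> V" "card J = j"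
  have finJ: "finite J" using J finV finite_subset by blast
  let ?F = "{{{w, a}, {w, b}} |w a b. w \<in> V - J \<and> a \<in> J \<and> b \<in> J \<and> a \<noteq> b}"
  have Fsub: "?F \<subseteq> (\<lambda>(w, a, b). {{w, a}, {w, b}}) ` (V \<times> J \<times> J)" by auto
  have finF: "finite ?F" by (rule finite_subset[OF Fsub]) (use finV finJ in auto)
  have "card ?F \<le> card (V \<times> J \<times> J)"
    by (rule order_trans[OF card_mono[OF _ Fsub] card_image_le]) (use finV finJ in auto)
  then have cF: "card ?F \<le> card V * j * j" using J by (simp add: card_cartesian_product mult.assoc)
  have "measure_pmf.prob (random_subset (pairs_on V) p)
      {H. t \<le> card {w \<in> V - J. 2 \<le> card (nbrs H w \<inter> J)}}
    \<le> measure_pmf.prob (random_subset (pairs_on V) p)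
      {H. \<exists>T\<subseteq>?F. card T = t \<and> disjoint T \<and> \<Union>T \<subseteq> H}"
  proof (rule measure_pmf.finite_measure_mono)
    show "{H. t \<le> card {w \<in> V - J. 2 \<le> card (nbrs H w \<inter> J)}}
      \<subseteq> {H. \<exists>T\<subseteq>?F. card T = t \<and> disjoint T \<and> \<Union>T \<subseteq> H}"
    proof clarify
      fix H assume "t \<le> card {w \<in> V - J. 2 \<le> card (nbrs H w \<inter> J)}"
      then obtain S where S: "S \<subseteq> {w \<in> V - J. 2 \<le> card (nbrs H w \<inter> J)}" "card S = t"
        by (rule obtain_subset_with_card_n)
      have "\<exists>a b. a \<noteq> b \<and> a \<in> nbrs H w \<inter> J \<and> b \<in> nbrs H w \<inter> J" if "w \<in> S" for w
      proof -
        have "2 \<le> card (nbrs H w \<inter> J)" using S that by auto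
        then obtain R where "R \<subseteq> nbrs H w \<inter> J" "card R = 2" by (metis obtain_subset_with_card_n)
        then show ?thesis by (auto simp: card_2_iff)
      qed
      then obtain a b where ab: "\<And>w. w \<in> S \<Longrightarrow> a w \<noteq> b w \<and> a w \<in> nbrs H w \<inter> J \<and> b w \<in> nbrs H w \<inter> J"
        by metis
      let ?c = "\<lambda>w. {{w, a w}, {w, b w}}"
      have SV: "w \<in> V - J" if "w \<in> S" for w using S that by auto
      \<comment> \<open>Centres lie outside \<open>J\<close> and leaves inside, so an edge
        determines its centre.\<close>
      have d: "?c w \<inter> ?c w' = {}" if "w \<in> S" "w' \<in> S" "w \<noteq> w'" for w w'
        using that ab[of w] ab[of w'] SV[of w] SV[of w'] by (auto simp: doubleton_eq_iff)
      have "inj_on ?c S" using d by (intro inj_onI) blast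
      then have "card (?c ` S) = t" using S by (simp add: card_image)
      moreover have "?c ` S \<subseteq> ?F"
      proof
        fix A assume "A \<in> ?c ` S"
        then obtain w where "w \<in> S" "A = ?c w" by blast
        then show "A \<in> ?F" using ab[of w] SV[of w] by blast
      qed
      moreover have "disjoint (?c ` S)"
        unfolding disjoint_def
      proof (intro ballI impI)
        fix A B assume AB: "A \<in> ?c ` S" "B \<in> ?c ` S" "A \<noteq> B"
        obtain w where w: "w \<in> S" "A = ?c w" using AB(1) by (rule imageE)
        obtain w' where w': "w' \<in> S" "B = ?c w'" using AB(2) by (rule imageE)
        show "A \<inter> B = {}" using d[OF w(1) w'(1)] w(2) w'(2) AB(3) by metis
      qed
      moreover have "\<Union>(?c ` S) \<subseteq> H" using ab by (auto simp: nbrs_def)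
      ultimately show "\<exists>T\<subseteq>?F. card T = t \<and> disjoint T \<and> \<Union>T \<subseteq> H" by blast
    qed
  qed simp
  also have "\<dots> \<le> x ^ t"
  proof (rule prob_disjoint_members_le[OF finite_pairs_on[OF finV] p finF _ _ x0, where r = 2])
    fix A assume "A \<in> ?F"
    then obtain w a b where A: "A = {{w, a}, {w, b}}" "w \<in> V - J" "a \<in> J" "b \<in> J" "a \<noteq> b" by blast
    have "{w, a} \<noteq> {w, b}" using A by (simp add: doubleton_eq_iff)
    moreover have "w \<noteq> a" "w \<noteq> b" using A by auto
    ultimately show "A \<subseteq> pairs_on V \<and> card A = 2"
      using A J by (auto simp: doubleton_in_pairs_on card_insert_if)
  next
    have "real (card ?F) \<le> real (card V * j * j)" by (rule of_nat_mono[OF cF])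
    then have "3 * real (card ?F) * p ^ 2 \<le> 3 * (real (card V) * real j * real j) * p ^ 2"
      by (intro mult_right_mono) auto
    then show "3 * real (card ?F) * p ^ 2 \<le> x * real t" using x by linarith
  qed
  finally show "measure_pmf.prob (random_subset (pairs_on V) p)
      {H. t \<le> card {w \<in> V - J. 2 \<le> card (nbrs H w \<inter> J)}} \<le> x ^ t" .
qed (use x0 in simp)

lemma prob_many_triangles:
  assumes x: "3 * (real s * real s * real (card V)) * p ^ 3 \<le> x * real t" and x0: "0 \<le> x"
  shows "measure_pmf.prob (random_subset (pairs_on V) p)
      {H. \<exists>X\<subseteq>V. card X = s \<and> (\<exists>T\<subseteq>triangles_meeting V X. card T = t \<and> disjoint T \<and> \<Union>T \<subseteq> H)}
    \<le> real (card V) ^ s * x ^ t"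
proof (rule prob_ex_subset_le[OF finV])
  fix X assume X: "X \<subseteq> V" "card X = s"
  show "measure_pmf.prob (random_subset (pairs_on V) p)
      {H. \<exists>T\<subseteq>triangles_meeting V X. card T = t \<and> disjoint T \<and> \<Union>T \<subseteq> H} \<le> x ^ t"
  proof (rule prob_disjoint_members_le[OF finite_pairs_on[OF finV] p _ _ _ x0, where r = 3])
    show "finite (triangles_meeting V X)" by (rule card_triangles_meeting[OF finV X(1)])
    show "A \<subseteq> pairs_on V \<and> card A = 3" if "A \<in> triangles_meeting V X" for A
      using that X(1) by (auto simp: triangles_meeting_def card_triangle doubleton_in_pairs_on)
    have "real (card (triangles_meeting V X)) \<le> real (s * s * card V)"
      using card_triangles_meeting(2)[OF finV X(1)] X(2) by (intro of_nat_mono) simp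
    then have "3 * real (card (triangles_meeting V X)) * p ^ 3 \<le> 3 * (real s * real s * real (card V)) * p ^ 3"
      using p by (intro mult_right_mono) auto
    then show "3 * real (card (triangles_meeting V X)) * p ^ 3 \<le> x * real t" using x by linarith
  qed
qed (use x0 in simp)

end

lemma pmf_exists_not:
  assumes "measure_pmf.prob M A < 1"
  shows "\<exists>x\<in>set_pmf M. x \<notin> A"
proof (rule ccontr)
  assume "\<not> ?thesis"
  then have "AE x in M. x \<in> A" by (auto simp: AE_measure_pmf_iff)
  then have "measure_pmf.prob M A = 1" by (simp add: measure_pmf.prob_eq_1)
  then show False using assms by simp
qed

text \<open>A random relation of density \<open>p\<close> works: rows and columns have mean size
  \<open>card V * p\<close>, well below \<open>M\<close>. The double factor in \<open>spots\<close>
  comes from choosing both \<open>A\<close> and \<open>B\<close>. Each of the four bad events has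
  probability at most \<open>1/8\<close>.\<close>

lemma sparse_incidence_exists:
  fixes V :: "'a set"
  assumes finV: "finite V" and p: "0 \<le> p" "p \<le> 1"
    and rows: "3 * real (card V) * p \<le> real M / 2" "real (card V) * (1/2) ^ M \<le> 1/8"
    and size: "real n < p * real (card V * card V) / 4" "exp (- real n) \<le> 1/8"
    and spots: "3 * (real s * real s) * p \<le> y * real k" "0 \<le> y"
      "real (card V) ^ s * (real (card V) ^ s * y ^ k) \<le> 1/8"
  shows "\<exists>I\<subseteq>V \<times> V. n \<le> card I \<and> (\<forall>a. card {e \<in> I. fst e = a} \<le> M) \<and> (\<forall>b. card {e \<in> I. snd e = b} \<le> M)
    \<and> (\<forall>A\<subseteq>V. \<forall>B\<subseteq>V. card A = s \<longrightarrow> card B = s \<longrightarrow> card (I \<inter> A \<times> B) < k)"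
proof -
  let ?E = "V \<times> V"
  let ?M = "random_subset ?E p"
  have finE: "finite ?E" using finV by simp
  define X1 where "X1 = (\<Union>a\<in>V. {I. M \<le> card (({a} \<times> V) \<inter> I)})"
  define X2 where "X2 = (\<Union>b\<in>V. {I. M \<le> card ((V \<times> {b}) \<inter> I)})"
  define X3 where "X3 = {I. real (card (?E \<inter> I)) \<le> p * real (card ?E) / 4}"
  define X4 where "X4 = {I. \<exists>A\<subseteq>V. card A = s \<and> (\<exists>B\<subseteq>V. card B = s \<and> k \<le> card ((A \<times> B) \<inter> I))}"
  have "measure_pmf.prob ?M X1 \<le> real (card V) * (1/2) ^ M" unfolding X1_def
    by (intro prob_UN_le finV prob_random_subset_upper_tail finE p)
       (use rows in \<open>auto simp: card_cartesian_product\<close>)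
  then have 1: "measure_pmf.prob ?M X1 \<le> 1/8" using rows by linarith
  have "measure_pmf.prob ?M X2 \<le> real (card V) * (1/2) ^ M" unfolding X2_def
    by (intro prob_UN_le finV prob_random_subset_upper_tail finE p)
       (use rows in \<open>auto simp: card_cartesian_product\<close>)
  then have 2: "measure_pmf.prob ?M X2 \<le> 1/8" using rows by linarith
  have "measure_pmf.prob ?M X3 \<le> exp (- (p * real (card ?E) / 4))"
    unfolding X3_def by (rule prob_random_subset_lower_tail[OF finE order_refl p])
  also have "\<dots> \<le> exp (- real n)" using size by (simp add: card_cartesian_product)
  finally have 3: "measure_pmf.prob ?M X3 \<le> 1/8" using size by linarith
  have "measure_pmf.prob ?M X4 \<le> real (card V) ^ s * (real (card V) ^ s * y ^ k)"
    unfolding X4_def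
  proof (intro prob_ex_subset_le finV)
    fix A B assume A: "A \<subseteq> V" "card A = s" and B: "B \<subseteq> V" "card B = s"
    show "measure_pmf.prob ?M {I. k \<le> card ((A \<times> B) \<inter> I)} \<le> y ^ k"
      by (rule prob_random_subset_upper_tail[OF finE p])
         (use A B spots in \<open>auto simp: card_cartesian_product\<close>)
  qed (use spots in auto)
  then have 4: "measure_pmf.prob ?M X4 \<le> 1/8" using spots by linarith
  have "measure_pmf.prob ?M (X1 \<union> X2 \<union> X3 \<union> X4) < 1"
    using measure_Un_le[of "X1 \<union> X2 \<union> X3" ?M X4] measure_Un_le[of "X1 \<union> X2" ?M X3]
      measure_Un_le[of X1 ?M X2] 1 2 3 4 by simp
  then obtain I where I: "I \<in> set_pmf ?M" "I \<notin> X1" "I \<notin> X2" "I \<notin> X3" "I \<notin> X4"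
    using pmf_exists_not by blast
  have IE: "I \<subseteq> ?E" using set_pmf_random_subset[OF I(1)] .
  have "real n < real (card I)"
    using I(4) size IE by (simp add: X3_def card_cartesian_product Int_absorb1)
  then have c: "n \<le> card I" by simp
  have r: "card {e \<in> I. fst e = a} \<le> M" for a
  proof (cases "a \<in> V")
    case True
    have "{e \<in> I. fst e = a} = ({a} \<times> V) \<inter> I" using IE by auto
    then show ?thesis using I(2) True by (auto simp: X1_def not_le less_imp_le)
  next
    case False
    then have "{e \<in> I. fst e = a} = {}" using IE by auto
    then show ?thesis by (metis card.empty le0)
  qed
  have r': "card {e \<in> I. snd e = b} \<le> M" for b
  proof (cases "b \<in> V")
    case True
    have "{e \<in> I. snd e = b} = (V \<times> {b}) \<inter> I" using IE by auto
    then show ?thesis using I(3) True by (auto simp: X2_def not_le less_imp_le)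
  next
    case False
    then have "{e \<in> I. snd e = b} = {}" using IE by auto
    then show ?thesis by (metis card.empty le0)
  qed
  have "card (I \<inter> A \<times> B) < k" if "A \<subseteq> V" "B \<subseteq> V" "card A = s" "card B = s" for A B
    using I(5) that unfolding X4_def by (auto simp: not_le Int_commute)
  then show ?thesis using IE c r r' by blast
qed

lemma ex_superset_with_card:
  assumes "finite V" "A \<subseteq> V" "card A \<le> s" "s \<le> card V"
  shows "\<exists>B. A \<subseteq> B \<and> B \<subseteq> V \<and> card B = s"
  using exists_subset_between[OF assms(3,4,2,1)] by blast

text \<open>The vertices are \<open>n\<close> incident pairs; \<open>f\<close> and \<open>g\<close> are the two coordinates. A set of vertices that is
  clustered in both partitions would be a dense spot of the incidence relation.\<close>

lemma crossing_partitions_exist: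
  assumes p: "0 \<le> p" "p \<le> 1"
    and rows: "3 * real m * p \<le> real M / 2" "real m * (1/2) ^ M \<le> 1/8"
    and size: "real n < p * real (m * m) / 4" "exp (- real n) \<le> 1/8"
    and spots: "3 * (real s * real s) * p \<le> y * real k" "0 \<le> y"
      "real m ^ s * (real m ^ s * y ^ k) \<le> 1/8" and sm: "s \<le> m"
  shows "\<exists>f g :: nat \<Rightarrow> nat. f ` {..<n} \<subseteq> {..<m} \<and> g ` {..<n} \<subseteq> {..<m}
    \<and> (\<forall>y. card {x \<in> {..<n}. f x = y} \<le> M) \<and> (\<forall>y. card {x \<in> {..<n}. g x = y} \<le> M)
    \<and> (\<forall>U\<subseteq>{..<n}. card U = k \<longrightarrow> s \<le> card (f ` U) \<or> s \<le> card (g ` U))"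
proof -
  have "\<exists>I\<subseteq>{..<m} \<times> {..<m}. n \<le> card I \<and> (\<forall>a. card {e \<in> I. fst e = a} \<le> M)
    \<and> (\<forall>b. card {e \<in> I. snd e = b} \<le> M)
    \<and> (\<forall>A\<subseteq>{..<m}. \<forall>B\<subseteq>{..<m}. card A = s \<longrightarrow> card B = s \<longrightarrow> card (I \<inter> A \<times> B) < k)"
    by (rule sparse_incidence_exists[where p = p and y = y]) (use assms in auto)
  then obtain I where I: "I \<subseteq> {..<m} \<times> {..<m}" "n \<le> card I"
    and I34: "\<forall>a. card {e \<in> I. fst e = a} \<le> M" "\<forall>b. card {e \<in> I. snd e = b} \<le> M"
    and I5: "\<forall>A\<subseteq>{..<m}. \<forall>B\<subseteq>{..<m}. card A = s \<longrightarrow> card B = s \<longrightarrow> card (I \<inter> A \<times> B) < k"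
    by (elim exE conjE) (rule that)
  have finI: "finite I" using I(1) by (rule finite_subset) simp
  obtain I' where I': "I' \<subseteq> I" "card I' = n" using I(2) by (metis obtain_subset_with_card_n)
  have "finite I'" using I' finI finite_subset by blast
  then obtain h where h: "bij_betw h {..<n} I'"
    using ex_bij_betw_nat_finite[of I'] I'(2) by (auto simp: lessThan_atLeast0)
  have inj: "inj_on h {..<n}" and hI: "h ` {..<n} \<subseteq> I" using h I' by (auto simp: bij_betw_def)
  have fib: "card {x \<in> {..<n}. c (h x) = y} \<le> M" if "card {e \<in> I. c e = y} \<le> M"
    for c :: "nat \<times> nat \<Rightarrow> nat" and y
  proof -
    have "card {x \<in> {..<n}. c (h x) = y} \<le> card {e \<in> I. c e = y}"
      by (rule card_inj_on_le[of h]) (use hI finI in \<open>auto intro: inj_on_subset[OF inj]\<close>)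
    then show ?thesis using that by simp
  qed
  have crossing: "s \<le> card ((fst \<circ> h) ` U) \<or> s \<le> card ((snd \<circ> h) ` U)"
    if U: "U \<subseteq> {..<n}" "card U = k" for U
  proof (rule ccontr)
    assume neg: "\<not> ?thesis"
    have sub: "(fst \<circ> h) ` U \<subseteq> {..<m}" "(snd \<circ> h) ` U \<subseteq> {..<m}" using hI I(1) U by fastforce+
    \<comment> \<open>Both images are padded to exactly \<open>s\<close> elements, the size for
      which the incidence bound is stated; the \<open>k\<close> incident pairs of \<open>U\<close>
      then lie in one box \<open>A \<times> B\<close>.\<close>
    obtain A where A: "(fst \<circ> h) ` U \<subseteq> A" "A \<subseteq> {..<m}" "card A = s"
      using ex_superset_with_card[OF _ sub(1), of s] neg sm by auto
    obtain B where B: "(snd \<circ> h) ` U \<subseteq> B" "B \<subseteq> {..<m}" "card B = s"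
      using ex_superset_with_card[OF _ sub(2), of s] neg sm by auto
    have "h ` U \<subseteq> I \<inter> A \<times> B" using A B hI U by (force simp: mem_Times_iff)
    then have "card (h ` U) \<le> card (I \<inter> A \<times> B)" by (rule card_mono[rotated]) (use finI in simp)
    moreover have "card (h ` U) = k" using U inj by (simp add: card_image inj_on_subset)
    ultimately show False using I5[rule_format, OF A(2) B(2) A(3) B(3)] by simp
  qed
  have img: "(fst \<circ> h) ` {..<n} \<subseteq> {..<m}" "(snd \<circ> h) ` {..<n} \<subseteq> {..<m}" using hI I(1) by fastforce+
  have fibs: "card {x \<in> {..<n}. (fst \<circ> h) x = y} \<le> M" "card {x \<in> {..<n}. (snd \<circ> h) x = y} \<le> M" for y
    using fib[of fst y] fib[of snd y] I34 by simp_all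
  show ?thesis
    by (intro exI[of _ "fst \<circ> h"] exI[of _ "snd \<circ> h"] conjI allI impI img fibs crossing)
qed

section \<open>Two bites\<close>

lemma codeg_pos_sym: "codeg_pos H a b \<longleftrightarrow> codeg_pos H b a"
  by (auto simp: codeg_pos_def)

text \<open>The base graphs \<open>R\<close> and \<open>B\<close> live on the parts of the partitions given by \<open>f\<close> and \<open>g\<close>. The
  condition on \<open>g\<close> excludes the pairs over which the blow-up of \<open>B\<close> could close a triangle.\<close>

definition bite :: "'v set \<Rightarrow> ('v \<Rightarrow> 'a) \<Rightarrow> ('v \<Rightarrow> 'a) \<Rightarrow> 'a set set \<Rightarrow> 'a set set \<Rightarrow> 'v set set" where
  "bite W f g R B = {{x, y} |x y. x \<in> W \<and> y \<in> W \<and> {f x, f y} \<in> R \<and> g x \<noteq> g y \<and> \<not> codeg_pos B (g x) (g y)}"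

text \<open>Pairs of parts and not of vertices: one base edge decides all vertex pairs above it, so
  the pairs of parts are the independent trials.\<close>

definition open_edges :: "('v \<Rightarrow> 'a) \<Rightarrow> ('v \<Rightarrow> 'a) \<Rightarrow> 'a set set \<Rightarrow> 'v set \<Rightarrow> 'a set set" where
  "open_edges f g B T = {{f x, f y} |x y. x \<in> T \<and> y \<in> T \<and> g x \<noteq> g y \<and> \<not> codeg_pos B (g x) (g y)}"

lemma in_bite_iff:
  "{x, y} \<in> bite W f g R B \<longleftrightarrow>
     x \<in> W \<and> y \<in> W \<and> {f x, f y} \<in> R \<and> g x \<noteq> g y \<and> \<not> codeg_pos B (g x) (g y)"
  (is "?l \<longleftrightarrow> ?r x y")
proof
  assume ?l
  then obtain a b where ab: "{x, y} = {a, b}" "?r a b" unfolding bite_def by blast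
  then have "(a = x \<and> b = y) \<or> (a = y \<and> b = x)" by (auto simp: doubleton_eq_iff)
  then show "?r x y"
  proof (elim disjE conjE)
    assume "a = y" "b = x"
    then show ?thesis using ab(2) codeg_pos_sym[of B "g x" "g y"] insert_commute[of "f x" "f y" "{}"] by auto
  qed (use ab(2) in simp)
next
  assume "?r x y"
  then show ?l unfolding bite_def by blast
qed

text \<open>The condition \<open>g x \<noteq> g y\<close> forces
  \<open>x \<noteq> y\<close>.\<close>

lemma bite_subset: "bite W f g R B \<subseteq> pairs_on W"
  by (auto simp: bite_def doubleton_in_pairs_on)

text \<open>The part of \<open>y\<close> is a common neighbour of the parts of \<open>x\<close> and
  \<open>z\<close>. The second bite consults the unpruned \<open>R\<close>, so edges of
  \<open>R'\<close> are seen as well.\<close>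

lemma bite_bite_codeg:
  assumes "{x, y} \<in> bite W f g R' B" "{y, z} \<in> bite W f g R' B" "R' \<subseteq> R"
  shows "{x, z} \<notin> bite W g f B' R"
proof
  assume "{x, z} \<in> bite W g f B' R"
  then have "\<not> codeg_pos R (f x) (f z)" unfolding in_bite_iff by blast
  moreover have "{f x, f y} \<in> R" "{f z, f y} \<in> R"
    using assms unfolding in_bite_iff by (auto simp: insert_commute)
  ultimately show False unfolding codeg_pos_def by blast
qed

lemma bite_triangle_free: "triangle_free R \<Longrightarrow> triangle_free (bite W f g R B)"
  unfolding triangle_free_def in_bite_iff by blast

text \<open>Either all three edges lie in one bite, and \<open>f\<close> or \<open>g\<close>
  projects the triangle to one in a pruned base graph, or two of them form a path in one bite that
  the third closes with an edge of the other.\<close>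

lemma bites_triangle_free:
  assumes "R' \<subseteq> R" "B' \<subseteq> B" "triangle_free R'" "triangle_free B'"
  shows "triangle_free (bite W f g R' B \<union> bite W g f B' R)"
  unfolding triangle_free_def
proof (intro notI, elim exE conjE)
  fix x y z
  let ?r = "bite W f g R' B" and ?b = "bite W g f B' R"
  assume e: "{x, y} \<in> ?r \<union> ?b" "{y, z} \<in> ?r \<union> ?b" "{x, z} \<in> ?r \<union> ?b"
  have c: "{y, x} = {x, y}" "{z, y} = {y, z}" "{z, x} = {x, z}" by auto
  have rrr: "\<not> ({x, y} \<in> ?r \<and> {y, z} \<in> ?r \<and> {x, z} \<in> ?r)"
    using bite_triangle_free[OF assms(3), of W f g B] unfolding triangle_free_def by blast
  have bbb: "\<not> ({x, y} \<in> ?b \<and> {y, z} \<in> ?b \<and> {x, z} \<in> ?b)"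
    using bite_triangle_free[OF assms(4), of W g f R] unfolding triangle_free_def by blast
  have r: "{u, w} \<notin> ?b" if "{u, v} \<in> ?r" "{v, w} \<in> ?r" for u v w
    by (rule bite_bite_codeg[OF that assms(1)])
  have b: "{u, w} \<notin> ?r" if "{u, v} \<in> ?b" "{v, w} \<in> ?b" for u v w
    by (rule bite_bite_codeg[OF that assms(2)])
  show False
    using e rrr bbb r[of x y z] r[of y x z] r[of x z y] b[of x y z] b[of y x z] b[of x z y]
    unfolding c by blast
qed

text \<open>An open pair picked by \<open>R\<close> either survives pruning, and is then the image
  under \<open>f\<close> of a bite edge inside \<open>T\<close>, or it is a pruned edge on the image
  of \<open>T\<close>.\<close>

lemma card_open_edges_le_bite:
  assumes finU: "finite U" and T: "T \<subseteq> U" "U \<subseteq> W" and RR: "R' \<subseteq> R"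
    and fin: "finite R" "finite T"
  shows "card (open_edges f g B T \<inter> R)
    \<le> card (induced_edges (bite W f g R' B) U) + card (induced_edges (R - R') (f ` T))"
proof -
  let ?I = "induced_edges (bite W f g R' B) U"
  have finI: "finite ?I" by (rule finite_subset[of _ "Pow U"]) (use finU in \<open>auto simp: induced_edges_def\<close>)
  have finD: "finite (induced_edges (R - R') (f ` T))"
    by (rule finite_subset[of _ R]) (use fin in \<open>auto simp: induced_edges_def\<close>)
  have "open_edges f g B T \<inter> R \<subseteq> (`) f ` ?I \<union> induced_edges (R - R') (f ` T)"
  proof
    fix e assume e: "e \<in> open_edges f g B T \<inter> R"
    then obtain x y where xy: "e = {f x, f y}" "x \<in> T" "y \<in> T" "g x \<noteq> g y"
      "\<not> codeg_pos B (g x) (g y)"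
      unfolding open_edges_def by blast
    show "e \<in> (`) f ` ?I \<union> induced_edges (R - R') (f ` T)"
    proof (cases "e \<in> R'")
      case True
      have "{x, y} \<in> bite W f g R' B" unfolding in_bite_iff using xy True T by blast
      moreover have "{x, y} \<subseteq> U" using xy T by blast
      ultimately have "{x, y} \<in> ?I" by (simp add: induced_edges_def)
      moreover have "e = f ` {x, y}" using xy by simp
      ultimately show ?thesis by blast
    next
      case False
      then show ?thesis using e xy by (auto simp: induced_edges_def)
    qed
  qed
  then have "card (open_edges f g B T \<inter> R) \<le> card ((`) f ` ?I \<union> induced_edges (R - R') (f ` T))"
    by (rule card_mono[rotated]) (use finI finD in simp)
  also have "\<dots> \<le> card ((`) f ` ?I) + card (induced_edges (R - R') (f ` T))" by (rule card_Un_le)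
  also have "card ((`) f ` ?I) \<le> card ?I" by (rule card_image_le[OF finI])
  finally show ?thesis by simp
qed

text \<open>Injectivity of \<open>f\<close> keeps open ordered pairs distinct when they are mapped
  to arcs between parts, and an unordered pair of parts carries at most two arcs.\<close>

lemma card_open_edges_ge:
  assumes T: "finite T" and inj: "inj_on f T"
  shows "card T * card T
    \<le> 2 * card (open_edges f g B T) + card {(x, y) \<in> T \<times> T. g x = g y \<or> codeg_pos B (g x) (g y)}"
proof -
  let ?O = "{(x, y) \<in> T \<times> T. g x \<noteq> g y \<and> \<not> codeg_pos B (g x) (g y)}"
  let ?C = "{(x, y) \<in> T \<times> T. g x = g y \<or> codeg_pos B (g x) (g y)}"
  let ?E = "open_edges f g B T"
  have finO: "finite ?O" and finC: "finite ?C" using T by (auto intro: finite_subset[of _ "T \<times> T"])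
  have Eim: "?E = (\<lambda>(x, y). {f x, f y}) ` ?O"
    unfolding open_edges_def
  proof (intro equalityI subsetI)
    fix e assume "e \<in> (\<lambda>(x, y). {f x, f y}) ` ?O"
    then obtain z where "z \<in> ?O" "e = (\<lambda>(x, y). {f x, f y}) z" by (rule imageE)
    then show "e \<in> {{f x, f y} |x y. x \<in> T \<and> y \<in> T \<and> g x \<noteq> g y \<and> \<not> codeg_pos B (g x) (g y)}"
      by (cases z) auto
  next
    fix e assume "e \<in> {{f x, f y} |x y. x \<in> T \<and> y \<in> T \<and> g x \<noteq> g y \<and> \<not> codeg_pos B (g x) (g y)}"
    then obtain x y where xy: "e = {f x, f y}" "x \<in> T" "y \<in> T" "g x \<noteq> g y"
      "\<not> codeg_pos B (g x) (g y)"
      unfolding mem_Collect_eq by (elim exE conjE)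
    then show "e \<in> (\<lambda>(x, y). {f x, f y}) ` ?O" by (intro image_eqI[of _ _ "(x, y)"]) simp_all
  qed
  then have finE: "finite ?E" using finO by simp
  have dir: "finite (directions e)" "card (directions e) \<le> 2" if "e \<in> ?E" for e
  proof -
    obtain x y where "e = {f x, f y}" 
      using \<open>e \<in> ?E\<close> unfolding open_edges_def mem_Collect_eq by (elim exE conjE)
    then have d: "directions e = {(f x, f y), (f y, f x)}" using directions_insert by metis
    show "finite (directions e)" unfolding d by simp
    show "card (directions e) \<le> 2" unfolding d by (cases "f x = f y") simp_all
  qed
  have TT: "T \<times> T = ?O \<union> ?C" by auto
  have "card (T \<times> T) \<le> card ?O + card ?C"
    by (rule ord_eq_le_trans[OF arg_cong[OF TT, of card] card_Un_le])
  moreover have "card ?O \<le> card (\<Union>e\<in>?E. directions e)"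
  proof (rule card_inj_on_le)
    show "inj_on (map_prod f f) ?O"
      by (rule inj_on_subset[OF map_prod_inj_on[OF inj inj]]) auto
    show "map_prod f f ` ?O \<subseteq> (\<Union>e\<in>?E. directions e)"
      by (auto simp: open_edges_def directions_def)
    show "finite (\<Union>e\<in>?E. directions e)" using finE dir by auto
  qed
  moreover have "card (\<Union>e\<in>?E. directions e) \<le> (\<Sum>e\<in>?E. card (directions e))"
    by (rule card_UN_le[OF finE])
  moreover have "(\<Sum>e\<in>?E. card (directions e)) \<le> (\<Sum>e\<in>?E. 2)" by (rule sum_mono[OF dir(2)])
  ultimately show ?thesis by (simp add: card_cartesian_product)
qed

section \<open>Two independent base graphs\<close>

lemma prob_pair_pmf_le:
  assumes "\<And>x. x \<in> set_pmf M \<Longrightarrow> measure_pmf.prob N {y. P x y} \<le> b" and b: "0 \<le> b"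
  shows "measure_pmf.prob (pair_pmf M N) {(x, y). P x y} \<le> b"
proof -
  have "emeasure (pair_pmf M N) {(x, y). P x y}
      = (\<integral>\<^sup>+x. emeasure (measure_pmf N) {y. P x y} \<partial>measure_pmf M)"
  proof -
    have "emeasure (pair_pmf M N) {(x, y). P x y}
        = (\<integral>\<^sup>+z. indicator {(x, y). P x y} z \<partial>measure_pmf (pair_pmf M N))" by simp
    also have "\<dots> = (\<integral>\<^sup>+x. \<integral>\<^sup>+y. indicator {(x, y). P x y} (x, y) \<partial>measure_pmf N \<partial>measure_pmf M)"
      by (rule nn_integral_pair_pmf')
    also have "\<dots> = (\<integral>\<^sup>+x. \<integral>\<^sup>+y. indicator {y. P x y} y \<partial>measure_pmf N \<partial>measure_pmf M)"
      by (simp add: indicator_def)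
    finally show ?thesis by simp
  qed
  also have "\<dots> \<le> (\<integral>\<^sup>+x. ennreal b \<partial>measure_pmf M)"
  proof (rule nn_integral_mono_AE)
    show "AE x in measure_pmf M. emeasure (measure_pmf N) {y. P x y} \<le> ennreal b"
      using assms by (auto simp: AE_measure_pmf_iff measure_pmf.emeasure_eq_measure intro: ennreal_leI)
  qed
  also have "\<dots> = ennreal b" by simp
  finally show ?thesis using b by (simp add: measure_pmf.emeasure_eq_measure)
qed

lemma prob_pair_pmf_le':
  assumes "\<And>y. y \<in> set_pmf N \<Longrightarrow> measure_pmf.prob M {x. P x y} \<le> b" and b: "0 \<le> b"
  shows "measure_pmf.prob (pair_pmf M N) {(x, y). P x y} \<le> b"
proof -
  have "measure_pmf.prob (pair_pmf M N) {(x, y). P x y}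
      = measure_pmf.prob (pair_pmf N M) {(y, x). P x y}"
    by (subst pair_commute_pmf) (simp add: vimage_def case_prod_unfold)
  also have "\<dots> \<le> b" by (rule prob_pair_pmf_le) (use assms in auto)
  finally show ?thesis .
qed

text \<open>\<open>P\<close> and \<open>Q\<close> are known to be unlikely only when the other graph
  is good, so goodness is made part of the events \<open>?C\<close> and \<open>?D\<close>. The four
  probabilities add up to at most \<open>5/8\<close>.\<close>

lemma mutually_good_pair_exists:
  assumes G: "measure_pmf.prob M {x. \<not> G x} \<le> 1/4"
    and P: "\<And>y. G y \<Longrightarrow> measure_pmf.prob M {x. P x y} \<le> 1/16"
    and Q: "\<And>y. G y \<Longrightarrow> measure_pmf.prob M {x. Q x y} \<le> 1/16"
  shows "\<exists>x\<in>set_pmf M. \<exists>y\<in>set_pmf M. G x \<and> G y \<and> \<not> P x y \<and> \<not> Q y x"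
proof -
  let ?M = "pair_pmf M M"
  let ?A = "{(x, y). \<not> G x}" and ?B = "{(x, y). \<not> G y}"
    and ?C = "{(x, y). G y \<and> P x y}" and ?D = "{(x, y). G x \<and> Q y x}"
  have A: "measure_pmf.prob ?M ?A \<le> 1/4" by (rule prob_pair_pmf_le') (use G in auto)
  have B: "measure_pmf.prob ?M ?B \<le> 1/4" by (rule prob_pair_pmf_le) (use G in auto)
  have C: "measure_pmf.prob ?M ?C \<le> 1/16"
  proof (rule prob_pair_pmf_le')
    show "measure_pmf.prob M {x. G y \<and> P x y} \<le> 1/16" for y using P[of y] by (cases "G y") auto
  qed simp
  have D: "measure_pmf.prob ?M ?D \<le> 1/16"
  proof (rule prob_pair_pmf_le)
    show "measure_pmf.prob M {y. G x \<and> Q y x} \<le> 1/16" for x using Q[of x] by (cases "G x") auto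
  qed simp
  have "measure_pmf.prob ?M (?A \<union> ?B \<union> ?C \<union> ?D) < 1"
    using measure_Un_le[of "?A \<union> ?B \<union> ?C" ?M ?D] measure_Un_le[of "?A \<union> ?B" ?M ?C]
      measure_Un_le[of ?A ?M ?B] A B C D by simp
  then obtain z where "z \<in> set_pmf ?M" "z \<notin> ?A \<union> ?B \<union> ?C \<union> ?D" using pmf_exists_not by blast
  then show ?thesis by (cases z) auto
qed

section \<open>The choice of parameters\<close>

text \<open>There are \<open>m\<close> parts of size at most \<open>M\<close>, where \<open>M\<close> is about \<open>n powr (1/8)\<close>; \<open>M * h\<close> is about
  \<open>sqrt (n * ln n)\<close> and \<open>B\<close> is a large constant. A base graph has edge density \<open>p\<close>, so that its
  blow-up has degrees of order \<open>M * h\<close>, but only \<open>m * p\<^sup>2\<close>, a negative power of \<open>n\<close>, common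
  neighbours for a pair of parts.\<close>

locale two_bites =
  fixes n M h m B :: nat
  assumes B: "2 ^ 23 \<le> B" and n16: "16 \<le> n" and M4: "4 \<le> M" and h: "2 ^ 27 \<le> h"
    and sq: "real n * ln (real n) \<le> (real (M * h))\<^sup>2"
    and mM: "32 * n \<le> m * M" "m * M \<le> 33 * n" "m \<le> n"
    and small: "2 ^ 28 * real B * (real (M * h))\<^sup>2 \<le> real n * real M * real n powr (- 1 / 16)"
    and spot: "real B * real (M * h) * real n \<le> (real m)\<^sup>2 * real n powr (- 3 / 16)"
    and tail: "real m * (1 / 2) ^ M \<le> 1 / 16" "real m * (1 / 2) ^ (198 * h) \<le> 1 / 16"
    and fits: "B * (M * h) \<le> m"
begin

definition p where "p = real (M * h) / real n"
text \<open>The ratio for the tails that compete with the number of vertex sets: sixteen factors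
  \<open>y\<close> outweigh one factor \<open>n\<close>.\<close>

definition y where "y = real n powr (- 1 / 16)"
definition k0 where "k0 = B * (M * h)"
text \<open>A set of \<open>k0\<close> vertices splits into \<open>M\<close> transversals of the
  other partition with at most \<open>k1\<close> vertices each.\<close>

definition k1 where "k1 = B * h"
text \<open>Pruning costs at most \<open>3 * t\<close> edges on \<open>k0\<close> parts. This is
  half of the \<open>p * (real k0)\<^sup>2 / 16\<close> edges secured before pruning.\<close>

definition t where "t = nat \<lfloor>p * (real k0)\<^sup>2 / 96\<rfloor>"
definition V where "V = {..<m}"
abbreviation R where "R \<equiv> random_subset (pairs_on V) p"

lemma pos: "0 < real n" "0 < real M" "0 < real h" "0 < real B" "0 < real m" "0 < k0" "0 < k1"
proof -
  have "0 < h" "0 < B" using h B by (auto intro: less_le_trans[rotated])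
  moreover have "0 < m" using mM(1) n16 by (intro gr0I) auto
  ultimately show "0 < real n" "0 < real M" "0 < real h" "0 < real B" "0 < real m" "0 < k0" "0 < k1"
    using n16 M4 by (auto simp: k0_def k1_def)
qed

lemma V: "finite V" "card V = m" by (simp_all add: V_def)

lemma k0_eq: "k0 = M * k1" by (simp add: k0_def k1_def)

lemma k1_ge: "4 * k1 \<le> k0" "8388608 * h \<le> k1" "k0 \<le> m"
proof -
  show "4 * k1 \<le> k0" using M4 by (simp add: k0_eq)
  show "8388608 * h \<le> k1" using B by (simp add: k1_def)
  show "k0 \<le> m" using fits by (simp add: k0_def)
qed

lemma p01: "0 \<le> p" "p \<le> 1"
proof -
  have "M * h \<le> B * (M * h)" using pos by simp
  then have "M * h \<le> n" using fits mM(3) by linarith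
  then have "real (M * h) \<le> real n" by (rule of_nat_mono)
  then show "0 \<le> p" "p \<le> 1" using pos by (auto simp: p_def simp del: of_nat_mult)
qed

lemma ln_ge: "1 \<le> ln (real n)"
proof -
  have "exp 1 \<le> real n" using exp_le n16 by linarith
  then show ?thesis using pos by (simp add: ln_ge_iff)
qed

lemma pk0: "real B * ln (real n) \<le> p * real k0"
proof -
  have "real n * (real B * ln (real n)) = real B * (real n * ln (real n))" by simp
  also have "\<dots> \<le> real B * (real (M * h))\<^sup>2" by (rule mult_left_mono[OF sq]) simp
  also have "\<dots> = real n * (p * real k0)" using pos by (simp add: p_def k0_def power2_eq_square)
  finally show ?thesis using pos by simp
qed

lemma y: "0 < y" "y \<le> 1" "y ^ 16 = 1 / real n" "real n powr (- 3 / 16) = y ^ 3"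
proof -
  show "0 < y" using pos by (simp add: y_def)
  show "y \<le> 1" using powr_mono[of "- 1 / 16" 0 "real n"] n16 by (simp add: y_def)
  have "y ^ 16 = real n powr (real 16 * (- 1 / 16))"
    unfolding y_def using pos by (intro powr_power) simp
  then show "y ^ 16 = 1 / real n" using pos by (simp add: powr_minus_divide)
  show "real n powr (- 3 / 16) = y ^ 3" using pos by (simp add: y_def powr_power)
qed

text \<open>From \<open>y ^ 16 = 1 / n\<close>; the summand \<open>1\<close> in \<open>a + 1\<close>
  leaves a spare factor \<open>1 / n\<close>, at most \<open>1 / 16\<close>.\<close>

lemma decay:
  assumes "16 * (a + 1) \<le> b"
  shows "real n ^ a * y ^ b \<le> 1 / 16"
proof -
  have "y ^ b \<le> y ^ (16 * (a + 1))" by (rule power_decreasing) (use assms y in auto)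
  also have "\<dots> = (1 / real n) ^ (a + 1)" by (simp only: power_mult y)
  finally have "real n ^ a * y ^ b \<le> real n ^ a * (1 / real n) ^ (a + 1)" by (rule mult_left_mono) simp
  also have "\<dots> = 1 / real n" using pos by (simp add: power_divide)
  also have "\<dots> \<le> 1 / 16" using n16 by (simp add: field_simps)
  finally show ?thesis .
qed

lemma decay_m:
  assumes "16 * (a + 1) \<le> b"
  shows "real m ^ a * y ^ b \<le> 1 / 16"
proof -
  have "real m ^ a * y ^ b \<le> real n ^ a * y ^ b"
    by (intro mult_right_mono power_mono) (use mM y in auto)
  then show ?thesis using decay[OF assms] by linarith
qed

text \<open>The left side equals \<open>p * k1\<close>, and \<open>33 / B\<close> times it bounds
  the mean codegree \<open>m * p\<^sup>2\<close>. One smallness condition thus serves both sparsity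
  and codegrees.\<close>

lemma kappa: "real B * ((real (M * h))\<^sup>2 / (real n * real M)) \<le> y / 2 ^ 28"
proof -
  have "2 ^ 28 * real B * (real (M * h))\<^sup>2 \<le> real n * real M * y" using small by (simp add: y_def)
  then show ?thesis using pos by (simp add: field_simps)
qed

lemma mp: "real m * p \<le> 33 * real h"
proof -
  have "real (m * M) \<le> real (33 * n)" by (rule of_nat_mono[OF mM(2)])
  then have "(real m * real M) * real h \<le> (33 * real n) * real h" by (intro mult_right_mono) auto
  then show ?thesis using pos by (simp add: p_def field_simps)
qed

lemma mp2: "real m * p\<^sup>2 \<le> 33 * (y / 2 ^ 28) / real B"
proof -
  have "real (m * M) \<le> real (33 * n)" by (rule of_nat_mono[OF mM(2)])
  then have "(real m * real M) * (real (M * h))\<^sup>2 \<le> (33 * real n) * (real (M * h))\<^sup>2"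
    by (intro mult_right_mono) auto
  then have "real m * p\<^sup>2 \<le> 33 * ((real (M * h))\<^sup>2 / (real n * real M))"
    using pos by (simp add: p_def field_simps power2_eq_square)
  also have "\<dots> \<le> 33 * ((y / 2 ^ 28) / real B)"
    using kappa pos by (intro mult_left_mono) (simp_all add: field_simps)
  finally show ?thesis by simp
qed

lemma mp2': "2 ^ 20 * (real m * p\<^sup>2) \<le> y / 2 ^ 20"
proof -
  have "33 * (y / 2 ^ 28) / real B \<le> 33 * (y / 2 ^ 28) / 2 ^ 23"
  proof (rule divide_left_mono)
    have "real (2 ^ 23) \<le> real B" by (rule of_nat_mono[OF B])
    then show "2 ^ 23 \<le> real B" by simp
  qed (use y pos in auto)
  then have "real m * p\<^sup>2 \<le> 33 * (y / 2 ^ 28) / 2 ^ 23" using mp2 by linarith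
  then show ?thesis using y by simp
qed

lemma k1p: "2 * real k1 * p \<le> y / 2 ^ 27"
proof -
  have "2 * real k1 * p = 2 * (real B * ((real (M * h))\<^sup>2 / (real n * real M)))"
    using pos by (simp add: k1_def p_def power2_eq_square)
  also have "\<dots> \<le> 2 * (y / 2 ^ 28)" by (rule mult_left_mono[OF kappa]) simp
  finally show ?thesis by simp
qed

text \<open>Since \<open>B \<ge> 2 ^ 23\<close>, the product \<open>p * k0\<close> is so large that
  rounding \<open>t\<close> down is harmless and \<open>y ^ t\<close> beats the choice of
  \<open>k0\<close> parts.\<close>

lemma t_bounds: "p * (real k0)\<^sup>2 / 192 \<le> real t" "3 * real t \<le> p * (real k0)\<^sup>2 / 32" "16 * (k0 + 1) \<le> t"
proof -
  let ?z = "p * (real k0)\<^sup>2 / 96"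
  have B': "2 ^ 23 \<le> real B" using of_nat_mono[OF B, where 'a = real] by simp
  have "2 ^ 23 * 1 \<le> real B * ln (real n)" by (rule mult_mono) (use B' ln_ge in auto)
  then have "2 ^ 23 \<le> p * real k0" using pk0 by linarith
  then have "2 ^ 23 * real k0 \<le> (p * real k0) * real k0" by (rule mult_right_mono) simp
  then have z: "65536 * real k0 \<le> ?z" by (simp add: power2_eq_square)
  have k1: "1 \<le> real k0" using pos by simp
  have t: "real t \<le> ?z" "?z - 1 \<le> real t" 
  proof -
    have "0 \<le> ?z" using p01 by simp
    then have "real t = real_of_int \<lfloor>?z\<rfloor>" by (simp add: t_def)
    then show "real t \<le> ?z" "?z - 1 \<le> real t" by linarith+
  qed
  show "p * (real k0)\<^sup>2 / 192 \<le> real t" using t z k1 by linarith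
  show "3 * real t \<le> p * (real k0)\<^sup>2 / 32" using t by linarith
  have "real (16 * (k0 + 1)) \<le> real t" using t z k1 by simp
  then show "16 * (k0 + 1) \<le> t" by linarith
qed

text \<open>The range \<open>2 * k1\<close> is that of \<open>card_related_pairs_le\<close>, and the
  factor 32 makes related pairs at most one in 32 on a transversal. The last clause bounds the loss
  from pruning.\<close>

definition good :: "nat set set \<Rightarrow> bool" where
  "good H \<longleftrightarrow> H \<subseteq> pairs_on V
    \<and> (\<forall>J\<subseteq>V. card J \<le> 2 * k1 \<longrightarrow> 32 * card {(a, b) \<in> J \<times> J. a \<noteq> b \<and> codeg_pos H a b} \<le> k1\<^sup>2)
    \<and> \<not> (\<exists>X\<subseteq>V. card X = k0 \<and> (\<exists>T\<subseteq>triangles_meeting V X. card T = t \<and> disjoint T \<and> \<Union>T \<subseteq> H))"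

text \<open>\<open>card_codeg_pos_le\<close> with \<open>j = 2 * k1\<close> and
  \<open>K = 64\<close>. Multiplied by 32, its two terms are below \<open>0.26 * k1\<^sup>2\<close>
  and \<open>0.39 * k1\<^sup>2\<close>; the second estimate uses
  \<open>2 ^ 23 * h \<le> k1\<close>.\<close>

lemma codegree_good:
  assumes H: "H \<subseteq> pairs_on V"
    and deg: "\<not> (\<exists>w\<in>V. 198 * h \<le> card (nbrs H w))"
    and sparse: "\<not> (\<exists>X\<subseteq>V. card X = 4 * k1 \<and> H \<subseteq> pairs_on V \<and> 128 * k1 \<le> card (induced_edges H X))"
    and cherry: "\<not> (\<exists>J\<subseteq>V. card J = 2 * k1 \<and> k1\<^sup>2 div 2 ^ 21 \<le> card {w \<in> V - J. 2 \<le> card (nbrs H w \<inter> J)})"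
    and J: "J \<subseteq> V" "card J \<le> 2 * k1"
  shows "32 * card {(a, b) \<in> J \<times> J. a \<noteq> b \<and> codeg_pos H a b} \<le> k1\<^sup>2"
proof -
  have le: "2 * k1 \<le> m" "4 * k1 \<le> m" using k1_ge by linarith+
  obtain J' where J': "J \<subseteq> J'" "J' \<subseteq> V" "card J' = 2 * k1"
    using ex_superset_with_card[OF V(1) J] le V(2) by auto
  have finJ': "finite J'" using J' V(1) finite_subset by blast
  have "card {(a, b) \<in> J' \<times> J'. a \<noteq> b \<and> codeg_pos H a b}
      \<le> (k1\<^sup>2 div 2 ^ 21) * (2 * 64 + 1)\<^sup>2 + (198 * h) * (4 * 64 * (2 * k1))"
  proof (rule card_codeg_pos_le[OF V(1) H _ _ _ _ _ J'(2,3)])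
    show "card (nbrs H w) \<le> 198 * h" if "w \<in> V" for w using deg that by (meson linear)
    show "card {w \<in> V - I. 2 \<le> card (nbrs H w \<inter> I)} \<le> k1\<^sup>2 div 2 ^ 21"
      if "I \<subseteq> V" "card I = 2 * k1" for I using cherry that by (meson linear)
    fix X assume X: "X \<subseteq> V" "card X \<le> 2 * (2 * k1)"
    obtain X' where X': "X \<subseteq> X'" "X' \<subseteq> V" "card X' = 4 * k1"
      using ex_superset_with_card[OF V(1) X(1), of "4 * k1"] X(2) le V(2) by auto
    have finX': "finite X'" using X' V(1) finite_subset by blast
    have "card (induced_edges H X) \<le> card (induced_edges H X')"
      by (rule card_mono) (use X' finX' in \<open>auto simp: induced_edges_def intro: finite_subset[of _ "Pow X'"]\<close>)
    also have "\<dots> \<le> 128 * k1" using sparse X' H by (meson linear)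
    finally show "card (induced_edges H X) \<le> 64 * (2 * k1)" by simp
  qed (use pos in auto)
  moreover have "card {(a, b) \<in> J \<times> J. a \<noteq> b \<and> codeg_pos H a b}
      \<le> card {(a, b) \<in> J' \<times> J'. a \<noteq> b \<and> codeg_pos H a b}"
    by (rule card_mono) (use J' finJ' in \<open>auto intro: finite_subset[of _ "J' \<times> J'"]\<close>)
  moreover have "2 ^ 21 * (k1\<^sup>2 div 2 ^ 21) \<le> k1\<^sup>2" by simp
  moreover have "2 ^ 23 * (h * k1) \<le> k1\<^sup>2"
    using mult_right_mono[OF k1_ge(2), of k1] by (simp add: power2_eq_square mult.assoc)
  ultimately show ?thesis by simp
qed

lemma prob_not_good: "measure_pmf.prob R {H. \<not> good H} \<le> 1 / 4"
proof -
  let ?E1 = "{H. H \<subseteq> pairs_on V \<and> (\<exists>w\<in>V. 198 * h \<le> card (nbrs H w))}"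
  let ?E2 = "{H. \<exists>X\<subseteq>V. card X = 4 * k1 \<and> H \<subseteq> pairs_on V \<and> 128 * k1 \<le> card (induced_edges H X)}"
  let ?E3 = "{H. \<exists>J\<subseteq>V. card J = 2 * k1 \<and> k1\<^sup>2 div 2 ^ 21 \<le> card {w \<in> V - J. 2 \<le> card (nbrs H w \<inter> J)}}"
  let ?E4 = "{H. \<exists>X\<subseteq>V. card X = k0 \<and> (\<exists>T\<subseteq>triangles_meeting V X. card T = t \<and> disjoint T \<and> \<Union>T \<subseteq> H)}"
  have 1: "measure_pmf.prob R ?E1 \<le> 1 / 16"
  proof -
    \<comment> \<open>\<open>198 = 6 * 33\<close>, where \<open>33 * h\<close> bounds the mean
      degree; this gives the ratio \<open>1 / 2\<close>.\<close>
    have "3 * real (card V) * p \<le> 1 / 2 * real (198 * h)" using mp V(2) by simp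
    from prob_large_degree[OF V(1) p01 this] show ?thesis using tail(2) V(2) by simp
  qed
  have 2: "measure_pmf.prob R ?E2 \<le> 1 / 16"
  proof -
    have "48 * real k1 * (real k1 * p) \<le> 48 * real k1 * y"
      using k1p y(1) by (intro mult_left_mono) auto
    moreover have "48 * real k1 * y \<le> 128 * real k1 * y"
      by (intro mult_right_mono) (use y in auto)
    ultimately have "3 * (real (4 * k1) * real (4 * k1)) * p \<le> y * real (128 * k1)"
      by (simp add: ac_simps)
    from prob_dense_spot[OF V(1) p01 this] show ?thesis
      using decay_m[of "4 * k1" "128 * k1"] pos y(1) V(2) by simp
  qed
  have kb: "2 ^ 50 \<le> k1"
    using k1_ge(2) h by simp
  \<comment> \<open>Rounding down loses at most half, because \<open>k1\<close> is huge.\<close>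
  have th: "2 ^ 22 * (k1\<^sup>2 div 2 ^ 21) \<ge> k1\<^sup>2"
  proof -
    have "k1\<^sup>2 = 2 ^ 21 * (k1\<^sup>2 div 2 ^ 21) + k1\<^sup>2 mod 2 ^ 21" by simp
    moreover have "k1\<^sup>2 mod 2 ^ 21 < 2 ^ 21" by simp
    moreover have "2 ^ 50 * 2 ^ 50 \<le> k1\<^sup>2" unfolding power2_eq_square by (rule mult_mono) (use kb in auto)
    ultimately show ?thesis by simp
  qed
  have 3: "measure_pmf.prob R ?E3 \<le> 1 / 16"
  proof -
    have thr: "(real k1)\<^sup>2 \<le> 2 ^ 22 * real (k1\<^sup>2 div 2 ^ 21)"
      using of_nat_mono[OF th, where 'a = real] by simp
    have "3 * (real m * real (2 * k1) * real (2 * k1)) * p ^ 2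
        = 12 * (real m * p\<^sup>2) * (real k1)\<^sup>2" by (simp add: power2_eq_square)
    also have "\<dots> \<le> (y / 2 ^ 22) * (2 ^ 22 * real (k1\<^sup>2 div 2 ^ 21))"
      by (rule mult_mono[OF _ thr]) (use mp2' y(1) in auto)
    finally have "3 * (real (card V) * real (2 * k1) * real (2 * k1)) * p ^ 2
        \<le> y * real (k1\<^sup>2 div 2 ^ 21)" using V(2) by simp
    from prob_many_cherries[OF V(1) p01 this] have "measure_pmf.prob R ?E3
        \<le> real m ^ (2 * k1) * y ^ (k1\<^sup>2 div 2 ^ 21)" using y(1) V(2) by simp
    also have "\<dots> \<le> 1 / 16"
    proof (rule decay_m)
      have "2 ^ 50 * k1 \<le> k1\<^sup>2" using mult_right_mono[OF kb, of k1] by (simp add: power2_eq_square)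
      moreover have "16 * (2 * k + 1) \<le> d"
        if "1125899906842624 * k \<le> s" "s \<le> 4194304 * d" "1 \<le> k" for k s d :: nat
      proof -
        have "4194304 * (48 * k) \<le> 4194304 * d" using that(1,2) by linarith
        then have "48 * k \<le> d" by simp
        then show ?thesis using that(3) by simp
      qed
      ultimately show "16 * (2 * k1 + 1) \<le> k1\<^sup>2 div 2 ^ 21" using th pos(7) by simp
    qed
    finally show ?thesis .
  qed
  have 4: "measure_pmf.prob R ?E4 \<le> 1 / 16"
  proof -
    have a: "3 * (real m * p\<^sup>2) \<le> y / 192" using mp2' y(1) by simp
    have "3 * (real k0 * real k0 * real (card V)) * p ^ 3
        = (3 * (real m * p\<^sup>2)) * (p * (real k0)\<^sup>2)"
      using V(2) by (simp add: power2_eq_square power3_eq_cube)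
    also have "\<dots> \<le> (y / 192) * (p * (real k0)\<^sup>2)"
      by (rule mult_right_mono[OF a]) (use p01 in auto)
    also have "\<dots> = y * (p * (real k0)\<^sup>2 / 192)" by simp
    also have "\<dots> \<le> y * real t" by (rule mult_left_mono[OF t_bounds(1)]) (use y in auto)
    finally have "3 * (real k0 * real k0 * real (card V)) * p ^ 3 \<le> y * real t" .
    from prob_many_triangles[OF V(1) p01 this] show ?thesis
      using decay_m[OF t_bounds(3)] y(1) V(2) by simp
  qed
  \<comment> \<open>Restriction to the support supplies \<open>H \<subseteq> pairs_on V\<close>, the
    first clause of \<open>good\<close>.\<close>
  have "measure_pmf.prob R {H. \<not> good H} = measure_pmf.prob R ({H. \<not> good H} \<inter> set_pmf R)"
    by (simp add: measure_Int_set_pmf)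
  also have "\<dots> \<le> measure_pmf.prob R (?E1 \<union> ?E2 \<union> ?E3 \<union> ?E4)"
  proof (rule measure_pmf.finite_measure_mono)
    show "{H. \<not> good H} \<inter> set_pmf R \<subseteq> ?E1 \<union> ?E2 \<union> ?E3 \<union> ?E4"
    proof
      fix H assume H: "H \<in> {H. \<not> good H} \<inter> set_pmf R"
      then have sub: "H \<subseteq> pairs_on V" using set_pmf_random_subset by blast
      show "H \<in> ?E1 \<union> ?E2 \<union> ?E3 \<union> ?E4"
      proof (rule ccontr)
        assume neg: "H \<notin> ?E1 \<union> ?E2 \<union> ?E3 \<union> ?E4"
        have "good H"
          unfolding good_def using neg sub codegree_good[OF sub] by simp
        then show False using H by blast
      qed
    qed
  qed simp
  also have "\<dots> \<le> 1 / 4"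
    using measure_Un_le[of "?E1 \<union> ?E2 \<union> ?E3" R ?E4] measure_Un_le[of "?E1 \<union> ?E2" R ?E3]
      measure_Un_le[of ?E1 R ?E2] 1 2 3 4 by simp
  finally show ?thesis .
qed

text \<open>Once \<open>H'\<close> is given, the open pairs of a transversal \<open>T\<close> are fixed, so the number of those that
  the independent random graph \<open>H\<close> picks is binomial.\<close>

definition depleted :: "(nat \<Rightarrow> nat) \<Rightarrow> (nat \<Rightarrow> nat) \<Rightarrow> nat set set \<Rightarrow> nat set set \<Rightarrow> bool" where
  "depleted f g H H' \<longleftrightarrow> (\<exists>T\<subseteq>{..<n}. card T = k0 \<and>
     (inj_on f T \<and> real (card (open_edges f g H' T \<inter> H)) \<le> p * (real k0)\<^sup>2 / 16))"

lemma card_open_edges_good: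
  assumes H': "good H'" and g: "g ` {..<n} \<subseteq> V" "\<forall>a. card {x \<in> {..<n}. g x = a} \<le> M"
    and T: "T \<subseteq> {..<n}" "card T = k0" "inj_on f T"
  shows "(real k0)\<^sup>2 / 4 \<le> real (card (open_edges f g H' T))"
proof -
  let ?C = "{(x, y) \<in> T \<times> T. g x = g y \<or> codeg_pos H' (g x) (g y)}"
  have finT: "finite T" using T finite_subset by blast
  have "card ?C \<le> card T * M + M\<^sup>2 * (k1\<^sup>2 div 32)"
  proof (rule card_related_pairs_le[OF finT _ _ _])
    show "card T = M * k1" using T k0_eq by simp
    show "g ` T \<subseteq> V" using g T by blast
    show "card {x \<in> T. g x = a} \<le> M" for a
    proof -
      have "card {x \<in> T. g x = a} \<le> card {x \<in> {..<n}. g x = a}"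
        by (rule card_mono) (use T(1) in auto)
      then show ?thesis using g(2) by (meson order_trans)
    qed
    show "card {(a, b) \<in> J \<times> J. a \<noteq> b \<and> codeg_pos H' a b} \<le> k1\<^sup>2 div 32"
      if "J \<subseteq> V" "card J \<le> 2 * k1" for J
    proof -
      have "32 * card {(a, b) \<in> J \<times> J. a \<noteq> b \<and> codeg_pos H' a b} \<le> k1\<^sup>2"
        using H' that by (simp add: good_def)
      then show ?thesis by linarith
    qed
  qed
  then have c: "card ?C \<le> k0 * M + M\<^sup>2 * (k1\<^sup>2 div 32)" using T by simp
  have "32 * (M\<^sup>2 * (k1\<^sup>2 div 32)) = M\<^sup>2 * (32 * (k1\<^sup>2 div 32))" by simp
  also have "\<dots> \<le> M\<^sup>2 * k1\<^sup>2" by (rule mult_left_mono) auto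
  finally have 1: "32 * (M\<^sup>2 * (k1\<^sup>2 div 32)) \<le> k0\<^sup>2" by (simp add: k0_eq power_mult_distrib)
  have "4 * 1 \<le> B * h" using B h by (intro mult_mono) auto
  then have "4 * M \<le> k0" unfolding k0_eq k1_def by simp
  then have 2: "4 * (k0 * M) \<le> k0\<^sup>2" by (simp add: power2_eq_square)
  \<comment> \<open>Of the ordered pairs, at most a quarter share a part of \<open>g\<close> and at
    most one in 32 is related, so more than half are open.\<close>
  have "k0\<^sup>2 \<le> 2 * card (open_edges f g H' T) + card ?C"
    using card_open_edges_ge[OF finT T(3), of g H'] T(2) by (simp add: power2_eq_square)
  then have "k0\<^sup>2 \<le> 4 * card (open_edges f g H' T)" using c 1 2 by linarith
  then have "real (k0\<^sup>2) \<le> real (4 * card (open_edges f g H' T))" by (rule of_nat_mono)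
  then show ?thesis by simp
qed

lemma open_edges_subset:
  assumes "f ` {..<n} \<subseteq> V" "T \<subseteq> {..<n}" "inj_on f T"
  shows "open_edges f g H' T \<subseteq> pairs_on V"
proof
  fix e assume "e \<in> open_edges f g H' T"
  then obtain x z where e: "e = {f x, f z}" "x \<in> T" "z \<in> T" "g x \<noteq> g z"
    unfolding open_edges_def by blast
  then have "f x \<noteq> f z" using assms(3) by (auto dest: inj_onD)
  then show "e \<in> pairs_on V" using e assms(1,2) by (auto simp: doubleton_in_pairs_on)
qed

lemma prob_depleted:
  assumes H': "good H'" and g: "g ` {..<n} \<subseteq> V" "\<forall>a. card {x \<in> {..<n}. g x = a} \<le> M"
    and f: "f ` {..<n} \<subseteq> V"
  shows "measure_pmf.prob R {H. depleted f g H H'} \<le> 1 / 16"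
proof -
  let ?b = "exp (- (p * (real k0)\<^sup>2 / 16))"
  have "measure_pmf.prob R {H. depleted f g H H'} \<le> real (card {..<n}) ^ k0 * ?b"
    unfolding depleted_def
  proof (rule prob_ex_subset_le)
    fix T assume T: "T \<subseteq> {..<n}" "card T = k0"
    show "measure_pmf.prob R {H. inj_on f T \<and>
        real (card (open_edges f g H' T \<inter> H)) \<le> p * (real k0)\<^sup>2 / 16} \<le> ?b"
    proof (cases "inj_on f T")
      case True
      let ?O = "open_edges f g H' T"
      have O: "(real k0)\<^sup>2 / 4 \<le> real (card ?O)" by (rule card_open_edges_good[OF H' g T True])
      then have pO: "p * (real k0)\<^sup>2 / 16 \<le> p * real (card ?O) / 4"
        using mult_left_mono[OF O p01(1)] by simp
      have "measure_pmf.prob R {H. inj_on f T \<and> real (card (?O \<inter> H)) \<le> p * (real k0)\<^sup>2 / 16}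
          \<le> measure_pmf.prob R {H. real (card (?O \<inter> H)) \<le> p * real (card ?O) / 4}"
        by (rule measure_pmf.finite_measure_mono) (use pO in auto)
      also have "\<dots> \<le> exp (- (p * real (card ?O) / 4))"
        by (rule prob_random_subset_lower_tail[OF finite_pairs_on[OF V(1)] open_edges_subset[OF f T(1) True] p01])
      also have "\<dots> \<le> ?b" using pO by simp
      finally show ?thesis .
    qed simp
  qed auto
  also have "\<dots> \<le> 1 / 16"
  proof -
    \<comment> \<open>\<open>32 = 2 * 16\<close>: the exponent in \<open>?b\<close> becomes at least
      \<open>2 * k0 * ln n\<close>, twice the cost of choosing \<open>T\<close>.\<close>
    have "32 * ln (real n) \<le> real B * ln (real n)"
      using of_nat_mono[OF B, where 'a = real] ln_ge by (intro mult_right_mono) auto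
    then have "32 * ln (real n) \<le> p * real k0" using pk0 ln_ge by linarith
    then have "(32 * ln (real n)) * real k0 \<le> (p * real k0) * real k0" by (rule mult_right_mono) simp
    then have "?b \<le> exp (- (real (2 * k0) * ln (real n)))"
      by (simp add: power2_eq_square ac_simps)
    also have "\<dots> = 1 / real n ^ (2 * k0)"
      using pos by (simp only: exp_minus exp_of_nat_mult exp_ln) (simp add: divide_inverse)
    finally have "real n ^ k0 * ?b \<le> real n ^ k0 * (1 / real n ^ (2 * k0))" by (rule mult_left_mono) simp
    also have "\<dots> = 1 / real n ^ k0" using pos by (simp add: mult_2 power_add)
    also have "\<dots> \<le> 1 / real n ^ 1"
      using pos n16 by (intro divide_left_mono power_increasing) auto
    also have "\<dots> \<le> 1 / 16" using n16 by (simp add: field_simps)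
    finally show ?thesis by simp
  qed
  finally show ?thesis .
qed

lemma transversal_edges:
  assumes RR: "R1' \<subseteq> R1" "good R1" and nd: "\<not> depleted f g R1 B1"
    and del: "\<forall>X\<subseteq>V. \<forall>t. \<not> (\<exists>T\<subseteq>triangles_meeting V X. card T = t \<and> disjoint T \<and> \<Union>T \<subseteq> R1) \<longrightarrow>
       card (induced_edges (R1 - R1') X) \<le> 3 * t"
    and f: "f ` {..<n} \<subseteq> V" and U: "U \<subseteq> {..<n}" "k0 \<le> card (f ` U)"
  shows "p * (real k0)\<^sup>2 / 32 \<le> real (card (induced_edges (bite {..<n} f g R1' B1) U))"
proof -
  have finU: "finite U" using U finite_subset by blast
  obtain A where A: "A \<subseteq> f ` U" "card A = k0" using U(2) by (metis obtain_subset_with_card_n)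
  \<comment> \<open>One representative for each of \<open>k0\<close> parts met by
    \<open>U\<close>.\<close>
  then obtain T where T: "T \<subseteq> U" "inj_on f T" "A = f ` T" by (auto simp: subset_image_inj)
  have cT: "card T = k0" using A T by (simp add: card_image)
  have finT: "finite T" using T finU finite_subset by blast
  have finR: "finite R1" using RR(2) finite_pairs_on[OF V(1)] finite_subset by (auto simp: good_def)
  have XV: "f ` T \<subseteq> V" using f T U by blast
  have "\<not> (\<exists>S\<subseteq>triangles_meeting V (f ` T). card S = t \<and> disjoint S \<and> \<Union>S \<subseteq> R1)"
    using RR(2) XV A(2) T(3) unfolding good_def by blast
  then have d: "card (induced_edges (R1 - R1') (f ` T)) \<le> 3 * t" using del XV by blast
  have "p * (real k0)\<^sup>2 / 16 < real (card (open_edges f g B1 T \<inter> R1))"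
    using nd T U(1) cT unfolding depleted_def by (meson not_le order_trans)
  also have "\<dots> \<le> real (card (induced_edges (bite {..<n} f g R1' B1) U)
      + card (induced_edges (R1 - R1') (f ` T)))"
    by (rule of_nat_mono[OF card_open_edges_le_bite[OF finU T(1) U(1) RR(1) finR finT]])
  finally show ?thesis using d t_bounds(2) by simp
qed

lemma crossing_partitions:
  "\<exists>f g :: nat \<Rightarrow> nat. f ` {..<n} \<subseteq> V \<and> g ` {..<n} \<subseteq> V
    \<and> (\<forall>a. card {x \<in> {..<n}. f x = a} \<le> M) \<and> (\<forall>a. card {x \<in> {..<n}. g x = a} \<le> M)
    \<and> (\<forall>U\<subseteq>{..<n}. card U = 16 * k0 \<longrightarrow> k0 \<le> card (f ` U) \<or> k0 \<le> card (g ` U))"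
  unfolding V_def
\<comment> \<open>The incidence density lies slightly above \<open>4 * n / m\<^sup>2\<close>, so
  that even the lower tail leaves \<open>n\<close> pairs, and \<open>32 * n \<le> m * M\<close>
  keeps rows short. Sets of order \<open>16 * k0\<close> yield \<open>48 * k0\<close> factors
  \<open>y\<close> against \<open>m ^ (2 * k0)\<close> boxes.\<close>
proof (rule crossing_partitions_exist[where p = "5 * real n / (real m)\<^sup>2" and y = "y ^ 3"])
  have sp: "real k0 * real n \<le> (real m)\<^sup>2 * y ^ 3"
    using spot y(4) by (simp add: k0_def)
  show "0 \<le> 5 * real n / (real m)\<^sup>2" by simp
  have "5 \<le> k0" using k1_ge(1,2) pos(3) by simp
  then have "5 * real n \<le> real k0 * real n" by (intro mult_right_mono) auto
  also have "\<dots> \<le> (real m)\<^sup>2 * 1"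
    using sp mult_left_mono[OF power_le_one[of y 3], of "(real m)\<^sup>2"] y by simp
  finally show "5 * real n / (real m)\<^sup>2 \<le> 1" using pos by (simp add: divide_le_eq)
  have r: "32 * real n \<le> real m * real M" using of_nat_mono[OF mM(1), where 'a = real] by simp
  then show "3 * real m * (5 * real n / (real m)\<^sup>2) \<le> real M / 2"
    using pos by (simp add: power2_eq_square field_simps)
  show "real m * (1 / 2) ^ M \<le> 1 / 8" using tail(1) by linarith
  show "real n < 5 * real n / (real m)\<^sup>2 * real (m * m) / 4"
    using pos by (simp add: power2_eq_square)
  show "exp (- real n) \<le> 1 / 8"
  proof -
    have "8 \<le> exp (real n)" using exp_ge_add_one_self[of "real n"] n16 by linarith
    then show ?thesis by (simp add: exp_minus field_simps)
  qed
  show "3 * (real k0 * real k0) * (5 * real n / (real m)\<^sup>2) \<le> y ^ 3 * real (16 * k0)"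
  proof -
    have "15 * real k0 * (real k0 * real n) \<le> 16 * real k0 * ((real m)\<^sup>2 * y ^ 3)"
      by (rule mult_mono[OF _ sp]) auto
    then show ?thesis using pos by (simp add: field_simps)
  qed
  show "0 \<le> y ^ 3" using y by simp
  show "real m ^ k0 * (real m ^ k0 * (y ^ 3) ^ (16 * k0)) \<le> 1 / 8"
    using decay_m[of "2 * k0" "3 * (16 * k0)"] pos by (simp add: power_mult[symmetric] mult_2 power_add mult.assoc)
  show "k0 \<le> m" by (rule k1_ge)
qed

theorem dense_triangle_free_graph:
  "\<exists>E. simple_graph {..<n} E \<and> triangle_free E
    \<and> (\<forall>U\<subseteq>{..<n}. card U = 16 * k0 \<longrightarrow>
         real B * ln (real n) * real k0 / 32 \<le> real (card (induced_edges E U)))"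
proof -
  obtain f g :: "nat \<Rightarrow> nat" where fg: "f ` {..<n} \<subseteq> V" "g ` {..<n} \<subseteq> V"
    "\<forall>a. card {x \<in> {..<n}. f x = a} \<le> M" "\<forall>a. card {x \<in> {..<n}. g x = a} \<le> M"
    and cross: "\<forall>U\<subseteq>{..<n}. card U = 16 * k0 \<longrightarrow> k0 \<le> card (f ` U) \<or> k0 \<le> card (g ` U)"
    using crossing_partitions by (elim exE conjE)
  obtain R1 B1 where good: "good R1" "good B1" and nd: "\<not> depleted f g R1 B1" "\<not> depleted g f B1 R1"
    using mutually_good_pair_exists[of R good "depleted f g" "depleted g f"]
      prob_not_good prob_depleted fg by blast
  have sub: "R1 \<subseteq> pairs_on V" "B1 \<subseteq> pairs_on V" using good by (auto simp: good_def)
  obtain R1' where R1': "R1' \<subseteq> R1" "triangle_free R1'"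
    "\<forall>X\<subseteq>V. \<forall>t. \<not> (\<exists>T\<subseteq>triangles_meeting V X. card T = t \<and> disjoint T \<and> \<Union>T \<subseteq> R1) \<longrightarrow>
       card (induced_edges (R1 - R1') X) \<le> 3 * t"
    using triangle_free_subgraph[OF V(1) sub(1)] by (elim exE conjE)
  obtain B1' where B1': "B1' \<subseteq> B1" "triangle_free B1'"
    "\<forall>X\<subseteq>V. \<forall>t. \<not> (\<exists>T\<subseteq>triangles_meeting V X. card T = t \<and> disjoint T \<and> \<Union>T \<subseteq> B1) \<longrightarrow>
       card (induced_edges (B1 - B1') X) \<le> 3 * t"
    using triangle_free_subgraph[OF V(1) sub(2)] by (elim exE conjE)
  let ?Er = "bite {..<n} f g R1' B1" and ?Eb = "bite {..<n} g f B1' R1"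
  let ?E = "?Er \<union> ?Eb"
  have "simple_graph {..<n} ?E"
    using bite_subset[of "{..<n}" f g R1' B1] bite_subset[of "{..<n}" g f B1' R1]
    unfolding simple_graph_def pairs_on_def by blast
  moreover have "triangle_free ?E" by (rule bites_triangle_free[OF R1'(1) B1'(1) R1'(2) B1'(2)])
  moreover have "real B * ln (real n) * real k0 / 32 \<le> real (card (induced_edges ?E U))"
    if U: "U \<subseteq> {..<n}" "card U = 16 * k0" for U
  proof -
    have finU: "finite U" using U finite_subset by blast
    have finI: "finite (induced_edges ?E U)"
      by (rule finite_subset[of _ "Pow U"]) (use finU in \<open>auto simp: induced_edges_def\<close>)
    have mono: "real (card (induced_edges E' U)) \<le> real (card (induced_edges ?E U))" if "E' \<subseteq> ?E" for E'
      by (intro of_nat_mono card_mono[OF finI]) (use that in \<open>auto simp: induced_edges_def\<close>)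
    have "(real B * ln (real n)) * real k0 \<le> (p * real k0) * real k0"
      by (rule mult_right_mono[OF pk0]) simp
    then have "real B * ln (real n) * real k0 / 32 \<le> p * (real k0)\<^sup>2 / 32" by (simp add: power2_eq_square)
    also have "\<dots> \<le> real (card (induced_edges ?E U))"
    proof -
      consider "k0 \<le> card (f ` U)" | "k0 \<le> card (g ` U)" using cross U by blast
      then show ?thesis
      proof cases
        case 1
        show ?thesis
          by (rule order_trans[OF transversal_edges[OF R1'(1) good(1) nd(1) R1'(3) fg(1) U(1) 1] mono]) simp
      next
        case 2
        show ?thesis
          by (rule order_trans[OF transversal_edges[OF B1'(1) good(2) nd(2) B1'(3) fg(2) U(1) 2] mono]) simp
      qed
    qed
    finally show ?thesis .
  qed
  ultimately show ?thesis by blast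
qed

end

section \<open>Feedback arc sets of random orientations\<close>

lemma fas_le:
  assumes "F \<subseteq> D" "acyclic (D - F)"
  shows "fas D \<le> card F"
  unfolding fas_def by (rule Least_le) (use assms in blast)

lemma fas_witness: "\<exists>F\<subseteq>D. card F = fas D \<and> acyclic (D - F)"
  unfolding fas_def by (rule LeastI_ex) (use acyclicI[of "{}"] in \<open>auto intro!: exI[of _ D]\<close>)

text \<open>The height of \<open>x\<close> is the number of vertices of \<open>U\<close> from which
  \<open>x\<close> can be reached. By acyclicity \<open>x\<close> is not among them, so heights stay
  below \<open>card U\<close> and grow strictly along arcs.\<close>

lemma acyclic_height:
  assumes fin: "finite U" and R: "R \<subseteq> U \<times> U" and ac: "acyclic R"
  shows "\<exists>r\<in>U \<rightarrow>\<^sub>E {..<card U}. \<forall>(x, y)\<in>R. r x < (r y :: nat)"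
proof -
  let ?P = "\<lambda>x. {y \<in> U. (y, x) \<in> R\<^sup>+}"
  define r where "r = restrict (\<lambda>x. card (?P x)) U"
  have rU: "r x < card U" if "x \<in> U" for x
    unfolding r_def restrict_apply'[OF that] by (rule psubset_card_mono) (use that fin ac in \<open>auto simp: acyclic_def\<close>)
  have mono: "r x < r y" if "(x, y) \<in> R" for x y
  proof -
    have xy: "x \<in> U" "y \<in> U" using that R by auto
    have "card (?P x) < card (?P y)"
    proof (rule psubset_card_mono)
      have "x \<in> ?P y" "x \<notin> ?P x" using xy that ac by (auto simp: acyclic_def)
      moreover have "?P x \<subseteq> ?P y" using that by (auto intro: trancl_into_trancl)
      ultimately show "?P x \<subset> ?P y" by blast
    qed (use fin in simp)
    then show ?thesis using xy by (simp add: r_def)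
  qed
  have "r \<in> U \<rightarrow>\<^sub>E {..<card U}"
    by (rule PiE_I) (use rU in \<open>auto simp: r_def\<close>)
  then show ?thesis using mono by blast
qed

text \<open>The product of \<open>1 + x + x\<^sup>2 / 2\<close> and
  \<open>1 - x + x\<^sup>2 / 2\<close> is \<open>1 + x ^ 4 / 4\<close>.\<close>

lemma exp_minus_le_quadratic:
  fixes x :: real
  assumes "0 \<le> x"
  shows "exp (- x) \<le> 1 - x + x\<^sup>2 / 2"
proof -
  have pos: "0 < 1 - x + x\<^sup>2 / 2"
  proof -
    have "1 - x + x\<^sup>2 / 2 = ((x - 1)\<^sup>2 + 1) / 2" by (simp add: power2_eq_square field_simps)
    also have "\<dots> > 0" by (smt (verit) divide_pos_pos zero_le_power2)
    finally show ?thesis .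
  qed
  have "1 \<le> 1 + (x\<^sup>2)\<^sup>2 / 4" by simp
  also have "\<dots> = (1 + x + x\<^sup>2 / 2) * (1 - x + x\<^sup>2 / 2)"
    by (simp add: power2_eq_square field_simps)
  also have "\<dots> \<le> exp x * (1 - x + x\<^sup>2 / 2)"
    by (rule mult_right_mono[OF exp_lower_Taylor_quadratic[OF assms]]) (use pos in simp)
  finally show ?thesis by (simp add: exp_minus field_simps)
qed

text \<open>If \<open>fas\<close> is at most \<open>t\<close>, then some height function has at most \<open>t\<close> arcs that do not climb;
  for a fixed height function every edge fails to climb with probability at least 1/2.\<close>

lemma prob_fas_le:
  fixes \<zeta> :: real
  assumes sg: "simple_graph V E" and U: "U \<subseteq> V" and z: "0 \<le> \<zeta>"
  shows "measure_pmf.prob (random_orientation E)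
      {D. real (fas (induced_arcs D U)) \<le> (1/2 - \<zeta>) * real (card (induced_edges E U))}
    \<le> real (card U) ^ card U * exp (- (\<zeta>\<^sup>2 * real (card (induced_edges E U))))"
proof -
  let ?I = "induced_edges E U" and ?q = "\<lambda>e. pmf_of_set (directions e)"
  let ?M = "Pi_pmf E undefined ?q" and ?R = "U \<rightarrow>\<^sub>E {..<card U}"
  let ?t = "(1/2 - \<zeta>) * real (card ?I)"
  let ?bad = "\<lambda>r x. \<not> (r (fst x) < (r (snd x) :: nat))"
  have fin: "finite E" using sg by (rule finite_edges)
  have finU: "finite U" using sg U finite_subset unfolding simple_graph_def by blast
  have edge: "\<exists>u v. e = {u, v} \<and> u \<noteq> v" if "e \<in> E" for e
    using that sg unfolding simple_graph_def by (meson card_2_iff)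
  have IE: "?I \<subseteq> E" by (auto simp: induced_edges_def)
  have dir: "finite (directions e)" "directions e \<noteq> {}" if "e \<in> E" for e
    using edge[OF that] by (auto simp: directions_insert)
  have supp: "f e \<in> directions e" if "f \<in> set_pmf ?M" "e \<in> E" for f e
  proof -
    have "f e \<in> set_pmf (pmf_of_set (directions e))"
      using that unfolding set_Pi_pmf[OF fin] by (simp add: PiE_dflt_def)
    then show ?thesis using dir[OF that(2)] by simp
  qed
  let ?X = "\<lambda>r. {f. real (card {e \<in> ?I. ?bad r (f e)}) \<le> ?t}"
  have "measure_pmf.prob (random_orientation E) {D. real (fas (induced_arcs D U)) \<le> ?t}
      = measure_pmf.prob ?M ({f. real (fas (induced_arcs (f ` E) U)) \<le> ?t} \<inter> set_pmf ?M)"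
    unfolding random_orientation_def measure_map_pmf measure_Int_set_pmf by (simp add: vimage_def)
  also have "\<dots> \<le> measure_pmf.prob ?M (\<Union>r\<in>?R. ?X r)"
  proof (rule measure_pmf.finite_measure_mono)
    show "{f. real (fas (induced_arcs (f ` E) U)) \<le> ?t} \<inter> set_pmf ?M \<subseteq> (\<Union>r\<in>?R. ?X r)"
    proof
      fix f assume f: "f \<in> {f. real (fas (induced_arcs (f ` E) U)) \<le> ?t} \<inter> set_pmf ?M"
      let ?D = "induced_arcs (f ` E) U"
      obtain F where F: "F \<subseteq> ?D" "card F = fas ?D" "acyclic (?D - F)"
        using fas_witness by blast
      have finF: "finite F" using F(1) fin
        by (auto simp: induced_arcs_def intro: finite_subset[of F "f ` E"])
      have "?D - F \<subseteq> U \<times> U" by (auto simp: induced_arcs_def)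
      then obtain r where r: "r \<in> ?R" "\<forall>(x, y)\<in>?D - F. r x < r y"
        using acyclic_height[OF finU _ F(3)] by blast
      have fe: "e = {fst (f e), snd (f e)}" if "e \<in> E" for e
        using supp[of f e] that f by (auto simp: directions_def)
      \<comment> \<open>All arcs outside \<open>F\<close> climb, so an edge that fails to climb
        gives an arc of \<open>F\<close>, and an arc determines its edge.\<close>
      have "card {e \<in> ?I. ?bad r (f e)} \<le> card F"
      proof (rule card_inj_on_le[OF _ _ finF])
        show "inj_on f {e \<in> ?I. ?bad r (f e)}"
          using IE fe by (intro inj_onI) (metis (no_types, lifting) mem_Collect_eq subsetD)
        show "f ` {e \<in> ?I. ?bad r (f e)} \<subseteq> F"
        proof
          fix x assume "x \<in> f ` {e \<in> ?I. ?bad r (f e)}"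
          then obtain e where e: "e \<in> ?I" "?bad r (f e)" "x = f e" by blast
          have "e \<subseteq> U" "e \<in> E" using e(1) by (auto simp: induced_edges_def)
          then have "fst x \<in> U" "snd x \<in> U" using fe[of e] e(3) by blast+
          then have "x \<in> ?D" using \<open>e \<in> E\<close> e(3) by (auto simp: induced_arcs_def mem_Times_iff)
          then show "x \<in> F" using r(2) e(2,3) by (auto simp: case_prod_unfold)
        qed
      qed
      then have "f \<in> ?X r" using f F(2) by auto
      then show "f \<in> (\<Union>r\<in>?R. ?X r)" using r(1) by blast
    qed
  qed simp
  also have "\<dots> \<le> real (card ?R) * exp (- (\<zeta>\<^sup>2 * real (card ?I)))"
  proof (rule prob_UN_le)
    show "finite ?R" using finU by (rule finite_PiE) simp
    fix r
    have half: "1/2 \<le> measure_pmf.prob (?q e) {x. ?bad r x}" if e: "e \<in> ?I" for e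
    proof -
      obtain u v where uv: "e = {u, v}" "u \<noteq> v" using edge e IE by blast
      have d: "directions e = {(u, v), (v, u)}" using uv by (simp add: directions_insert)
      \<comment> \<open>Both directions fail when the heights are equal, otherwise exactly one
        does.\<close>
      have "(u, v) \<in> {x. ?bad r x} \<or> (v, u) \<in> {x. ?bad r x}" by auto
      then have "0 < card ({(u, v), (v, u)} \<inter> {x. ?bad r x})" unfolding card_gt_0_iff by blast
      then have "1 \<le> card ({(u, v), (v, u)} \<inter> {x. ?bad r x})" by simp
      then show ?thesis using uv d by (simp add: measure_pmf_of_set)
    qed
    \<comment> \<open>With \<open>l = 2 * \<zeta>\<close> the exponent per edge is \<open>2 *
      \<zeta> * (1/2 - \<zeta>) + (- \<zeta> + \<zeta>\<^sup>2) = - \<zeta>\<^sup>2\<close>.\<close>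
    have "measure_pmf.prob ?M (?X r)
        \<le> exp (2 * \<zeta> * ?t) * (1 - 1/2 * (1 - exp (- (2 * \<zeta>)))) ^ card ?I"
      by (rule Pi_pmf_lower_tail[OF fin IE half]) (use z in auto)
    also have "(1 - 1/2 * (1 - exp (- (2 * \<zeta>)))) ^ card ?I \<le> exp (- \<zeta> + \<zeta>\<^sup>2) ^ card ?I"
    proof (rule power_mono)
      have "1 - 1/2 * (1 - exp (- (2 * \<zeta>))) \<le> 1 + (- \<zeta> + \<zeta>\<^sup>2)"
      proof -
        have "exp (- (2 * \<zeta>)) \<le> 1 - 2 * \<zeta> + 2 * \<zeta>\<^sup>2"
          using exp_minus_le_quadratic[of "2 * \<zeta>"] z by (simp add: power_mult_distrib)
        then show ?thesis by argo
      qed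
      also have "\<dots> \<le> exp (- \<zeta> + \<zeta>\<^sup>2)" by (rule exp_ge_add_one_self)
      finally show "1 - 1/2 * (1 - exp (- (2 * \<zeta>))) \<le> exp (- \<zeta> + \<zeta>\<^sup>2)" .
      show "0 \<le> 1 - 1/2 * (1 - exp (- (2 * \<zeta>)))"
        using exp_ge_zero[of "- (2 * \<zeta>)"] by argo
    qed
    also have "exp (2 * \<zeta> * ?t) * exp (- \<zeta> + \<zeta>\<^sup>2) ^ card ?I = exp (- (\<zeta>\<^sup>2 * real (card ?I)))"
      by (simp add: exp_of_nat_mult[symmetric] exp_add[symmetric] power2_eq_square algebra_simps)
    finally show "measure_pmf.prob ?M (?X r) \<le> exp (- (\<zeta>\<^sup>2 * real (card ?I)))" by simp
  qed
  also have "card ?R = card U ^ card U" using finU by (simp add: card_PiE)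
  finally show ?thesis by simp
qed

section \<open>Acyclic sets, acyclic partitions and arc edits\<close>

lemma acyclic_set_fas: "acyclic_set D S \<Longrightarrow> fas (induced_arcs D S) = 0"
  using fas_le[of "{}" "induced_arcs D S"] by (simp add: acyclic_set_def)

lemma acyclic_set_mono: "acyclic_set D S \<Longrightarrow> D' \<subseteq> D \<Longrightarrow> S' \<subseteq> S \<Longrightarrow> acyclic_set D' S'"
  unfolding acyclic_set_def by (rule acyclic_subset) (auto simp: induced_arcs_def)

lemma acyclic_number_less:
  assumes "finite V" and "\<And>S. S \<subseteq> V \<Longrightarrow> acyclic_set D S \<Longrightarrow> card S < k"
  shows "acyclic_number V D < k"
proof -
  let ?A = "{card S |S. S \<subseteq> V \<and> acyclic_set D S}"
  have "?A = card ` {S. S \<subseteq> V \<and> acyclic_set D S}" by auto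
  then have "finite ?A" using assms(1) by simp
  moreover have "card {} \<in> ?A"
    by (auto simp: acyclic_set_def induced_arcs_def acyclic_def intro!: exI[of _ "{}"])
  ultimately show ?thesis unfolding acyclic_number_def
    by (subst Max_less_iff) (use assms(2) in auto)
qed

lemma dichromatic_number_ge:
  assumes fin: "finite W" and irr: "\<And>v. (v, v) \<notin> D" and k: "2 \<le> k"
    and small: "\<And>S. S \<subseteq> W \<Longrightarrow> acyclic_set D S \<Longrightarrow> card S < k"
  shows "real (card W) / (real k - 1) \<le> real (dichromatic_number W D)"
proof -
  let ?Q = "\<lambda>m. \<exists>P. partition_on W P \<and> card P = m \<and> (\<forall>S\<in>P. acyclic_set D S)"
  \<comment> \<open>Singletons are acyclic in the absence of loops, so the \<open>LEAST\<close>
    ranges over a nonempty set.\<close>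
  have "partition_on W ((\<lambda>x. {x}) ` W)" by (rule partition_onI) auto
  moreover have "acyclic_set D {x}" for x
    using irr[of x] by (auto simp: acyclic_set_def induced_arcs_def intro!: acyclicI)
  ultimately have "\<exists>m. ?Q m" by blast
  then have "?Q (dichromatic_number W D)" unfolding dichromatic_number_def by (rule LeastI_ex)
  then obtain P where P: "partition_on W P" "card P = dichromatic_number W D"
    "\<forall>S\<in>P. acyclic_set D S" by blast
  have sub: "S \<subseteq> W" if "S \<in> P" for S using P(1) that by (auto simp: partition_on_def)
  have "card W = card (\<Union>P)" using P(1) by (simp add: partition_on_def)
  also have "\<dots> \<le> (\<Sum>S\<in>P. card S)" by (rule card_Union_le_sum_card)
  also have "\<dots> \<le> (\<Sum>S\<in>P. k - 1)"
  proof (rule sum_mono)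
    fix S assume "S \<in> P"
    then have "card S < k" using small sub P(3) by blast
    then show "card S \<le> k - 1" by simp
  qed
  finally have "card W \<le> dichromatic_number W D * (k - 1)" using P(2) by simp
  then have "real (card W) \<le> real (dichromatic_number W D * (k - 1))" by (rule of_nat_mono)
  then show ?thesis using k by (simp add: pos_divide_le_eq of_nat_diff)
qed

text \<open>A reversal is a deletion followed by an insertion, and inserted arcs can be ignored:
  they never destroy a cycle.\<close>

lemma arc_edits_subset:
  assumes "(arc_edit ^^ m) D D'"
  shows "\<exists>F\<subseteq>D. finite F \<and> card F \<le> m \<and> D - F \<subseteq> D'"
  using assms
proof (induction m arbitrary: D')
  case 0
  then show ?case by (intro exI[of _ "{}"]) auto
next
  case (Suc m)
  then obtain D1 where D1: "(arc_edit ^^ m) D D1" "arc_edit D1 D'" by auto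
  obtain F where F: "F \<subseteq> D" "finite F" "card F \<le> m" "D - F \<subseteq> D1" using Suc.IH[OF D1(1)] by blast
  obtain a where a: "D1 - {a} \<subseteq> D'" using D1(2) by (auto simp: arc_edit_def)
  \<comment> \<open>The intersection with \<open>D\<close> is taken because the edited arc may stem
    from an earlier reversal.\<close>
  have "card (insert a F \<inter> D) \<le> card (insert a F)" by (rule card_mono) (use F in auto)
  also have "\<dots> \<le> Suc m" using F(2,3) by (simp add: card_insert_if)
  finally have "card (insert a F \<inter> D) \<le> Suc m" .
  moreover have "D - (insert a F \<inter> D) \<subseteq> D'" using a F(4) by blast
  ultimately show ?case using F(2) by (intro exI[of _ "insert a F \<inter> D"]) auto
qed

text \<open>The original arcs that the edits remove contain a feedback arc set of \<open>D\<close>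
  on \<open>S\<close>.\<close>

lemma fas_le_arc_edits:
  assumes "(arc_edit ^^ m) D D'" and "acyclic_set D' S"
  shows "fas (induced_arcs D S) \<le> m"
proof -
  obtain F where F: "finite F" "card F \<le> m" "D - F \<subseteq> D'" using arc_edits_subset[OF assms(1)] by blast
  have "fas (induced_arcs D S) \<le> card (F \<inter> induced_arcs D S)"
  proof (rule fas_le)
    show "acyclic (induced_arcs D S - F \<inter> induced_arcs D S)"
      by (rule acyclic_subset[OF assms(2)[unfolded acyclic_set_def]])
         (use F(3) in \<open>auto simp: induced_arcs_def\<close>)
  qed simp
  also have "\<dots> \<le> card F" by (rule card_mono) (use F in auto)
  finally show ?thesis using F(2) by simp
qed

lemma arc_edit_irrefl:
  assumes "(arc_edit ^^ m) D D'" and "\<And>v. (v, v) \<notin> D"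
  shows "(v, v) \<notin> D'"
  using assms
proof (induction m arbitrary: D' v)
  case (Suc m)
  then obtain D1 where D1: "(arc_edit ^^ m) D D1" "arc_edit D1 D'" by auto
  then show ?case using Suc.IH[OF D1(1)] Suc.prems(2) by (auto simp: arc_edit_def)
qed auto

section \<open>The theorem\<close>

lemma induced_edges_disjoint_Un:
  assumes E: "finite E" "{} \<notin> E" and disj: "A \<inter> B = {}"
  shows "card (induced_edges E A) + card (induced_edges E B) \<le> card (induced_edges E (A \<union> B))"
proof -
  have "induced_edges E A \<inter> induced_edges E B = {}"
  proof (rule equals0I)
    fix e assume "e \<in> induced_edges E A \<inter> induced_edges E B"
    then have "e \<in> E" "e \<subseteq> A \<inter> B" by (auto simp: induced_edges_def)
    then show False using E(2) disj by auto
  qed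
  then have "card (induced_edges E A) + card (induced_edges E B) = card (induced_edges E A \<union> induced_edges E B)"
    using E(1) by (subst card_Un_disjoint) (auto simp: induced_edges_def)
  also have "\<dots> \<le> card (induced_edges E (A \<union> B))"
    by (rule card_mono) (use E(1) in \<open>auto simp: induced_edges_def\<close>)
  finally show ?thesis .
qed

lemma induced_edges_blocks:
  assumes E: "finite E" "{} \<notin> E" and d: "\<And>U. U \<subseteq> V \<Longrightarrow> card U = k \<Longrightarrow> d \<le> real (card (induced_edges E U))"
    and U: "U \<subseteq> V" "q * k \<le> card U" "finite U"
  shows "real q * d \<le> real (card (induced_edges E U))"
  using U
proof (induction q arbitrary: U)
  case (Suc q)
  then have "k \<le> card U" by simp
  then obtain A where A: "A \<subseteq> U" "card A = k" "finite A" by (rule obtain_subset_with_card_n)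
  have "q * k \<le> card (U - A)" using Suc.prems(2) A by (simp add: card_Diff_subset)
  then have "real q * d \<le> real (card (induced_edges E (U - A)))"
    using Suc.prems by (intro Suc.IH) auto
  moreover have "d \<le> real (card (induced_edges E A))" using A Suc.prems by (intro d) auto
  moreover have "card (induced_edges E A) + card (induced_edges E (U - A)) \<le> card (induced_edges E U)"
    using induced_edges_disjoint_Un[OF E, of A "U - A"] A(1) by (simp add: Un_absorb1)
  ultimately show ?case by (simp add: algebra_simps)
qed simp

text \<open>Disjoint blocks of \<open>k\<close> vertices cover at least half of \<open>U\<close>,
  which explains the factor 2.\<close>

lemma induced_edges_linear:
  assumes E: "finite E" "{} \<notin> E" and d: "\<And>U. U \<subseteq> V \<Longrightarrow> card U = k \<Longrightarrow> d \<le> real (card (induced_edges E U))"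
    and k: "0 < k" "0 \<le> d" and U: "U \<subseteq> V" "k \<le> card U" "finite U"
  shows "real (card U) * (d / (2 * real k)) \<le> real (card (induced_edges E U))"
proof -
  let ?q = "card U div k"
  have "card U = ?q * k + card U mod k" by simp
  moreover have "card U mod k < k" using k by simp
  moreover have "1 * k \<le> ?q * k"
    by (rule mult_right_mono) (use k U in \<open>simp_all add: div_greater_zero_iff Suc_le_eq\<close>)
  ultimately have "card U \<le> 2 * (?q * k)" by linarith
  then have "card U \<le> 2 * ?q * k" by (simp only: mult.assoc)
  then have "real (card U) \<le> real (2 * ?q * k)" by (rule of_nat_mono)
  then have "real (card U) * (d / (2 * real k)) \<le> real (2 * ?q * k) * (d / (2 * real k))"
    by (rule mult_right_mono) (use k in simp)
  also have "\<dots> = real ?q * d" using k by simp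
  also have "\<dots> \<le> real (card (induced_edges E U))"
    by (rule induced_edges_blocks[OF E d U(1) _ U(3)]) auto
  finally show ?thesis .
qed

text \<open>Up to logarithms, \<open>small\<close> needs \<open>M\<close> above
  \<open>n powr (1/16)\<close> and \<open>spot\<close> needs it below \<open>n powr (5/32)\<close>;
  the exponent \<open>1/8\<close> lies between.\<close>

lemma two_bites_parameters:
  assumes B: "2 ^ 23 \<le> B"
  shows "\<forall>\<^sub>F n in sequentially. \<exists>M h m. two_bites n M h m B \<and>
    sqrt (real n * ln (real n)) \<le> real (M * h) \<and> real (M * h) \<le> 2 * sqrt (real n * ln (real n))"
proof -
  define a where "a n = real n powr (1 / 8)" for n
  define s where "s n = sqrt (real n * ln (real n))" for n
  have e: "\<forall>\<^sub>F n in sequentially. 4 \<le> real n powr (1 / 8)"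
    "\<forall>\<^sub>F n in sequentially. 2 ^ 28 * real n powr (1 / 8) \<le> sqrt (real n * ln (real n))"
    "\<forall>\<^sub>F n in sequentially. 4 * (real n powr (1 / 8))\<^sup>2 \<le> sqrt (real n * ln (real n))"
    "\<forall>\<^sub>F n in sequentially. 64 * real n powr (1 / 8) \<le> real n"
    "\<forall>\<^sub>F n in sequentially. 32 * (real n / real n powr (1 / 8) + 1) \<le> real n"
    "\<forall>\<^sub>F n in sequentially. 2 ^ 30 * real B * ln (real n) \<le> real n powr (1 / 16)"
    "\<forall>\<^sub>F n in sequentially. real B * (2 * sqrt (real n * ln (real n))) * real n
       \<le> (16 * real n / real n powr (1 / 8))\<^sup>2 * real n powr (- 3 / 16)"
    "\<forall>\<^sub>F n in sequentially. real n * (1 / 2) powr (real n powr (1 / 8)) \<le> 1 / 16"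
    "\<forall>\<^sub>F n in sequentially. real B * (2 * sqrt (real n * ln (real n))) \<le> 16 * real n / real n powr (1 / 8)"
    "\<forall>\<^sub>F n in sequentially. 16 \<le> n"
    "\<forall>\<^sub>F n in sequentially. 0 \<le> ln (real n)"
    by real_asymp+
  show ?thesis
    using e
  proof eventually_elim
    case (elim n)
    define M where "M = nat \<lceil>a n\<rceil>"
    define h where "h = nat \<lceil>s n / real M\<rceil>"
    define m where "m = 32 * nat \<lceil>real n / real M\<rceil>"
    note el = elim[folded a_def s_def]
    have a4: "4 \<le> a n" using el(1) .
    have M: "a n \<le> real M" "real M \<le> a n + 1" using a4 unfolding M_def by linarith+
    then have M2: "real M \<le> 2 * a n" "0 < real M" "4 \<le> real M" using a4 by linarith+
    have s0: "0 \<le> s n" using el(11) by (simp add: s_def)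
    have "0 \<le> s n / real M" using s0 by simp
    then have h: "s n / real M \<le> real h" "real h \<le> s n / real M + 1" unfolding h_def by linarith+
    have sMh: "s n \<le> real (M * h)" using h(1) M2 by (simp add: pos_divide_le_eq mult.commute)
    have aa: "a n \<le> (a n)\<^sup>2" using a4 by (simp add: power2_eq_square)
    \<comment> \<open>Rounding \<open>h\<close> up adds at most \<open>M\<close> to the product
      \<open>M * h\<close>, hence the factor 2 in \<open>Mh2\<close>.\<close>
    have Ms: "real M \<le> s n" using M2(1) el(3) aa a4 by linarith
    have "real (M * h) = real M * real h" by simp
    also have "\<dots> \<le> real M * (s n / real M + 1)" by (rule mult_left_mono[OF h(2)]) simp
    also have "\<dots> = s n + real M" using M2 by (simp add: algebra_simps)
    finally have Mh2: "real (M * h) \<le> 2 * s n" using Ms by linarith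
    have "0 \<le> real n / real M" by simp
    then have nM: "real n / real M \<le> real (nat \<lceil>real n / real M\<rceil>)"
      "real (nat \<lceil>real n / real M\<rceil>) \<le> real n / real M + 1" by linarith+
    have mr: "32 * (real n / real M) \<le> real m" "real m \<le> 32 * (real n / real M + 1)"
      unfolding m_def of_nat_mult of_nat_numeral by (rule mult_left_mono[OF nM(1)] mult_left_mono[OF nM(2)], simp)+
    have sn: "(s n)\<^sup>2 = real n * ln (real n)" using el(11) by (simp add: s_def)
    have m16: "16 * real n / a n \<le> real m"
    proof -
      have "16 * real n / a n = 32 * (real n / (2 * a n))" by simp
      also have "\<dots> \<le> 32 * (real n / real M)"
        by (intro mult_left_mono divide_left_mono) (use M2 a4 in auto)
      finally show ?thesis using mr(1) by linarith
    qed
    have mn: "real m \<le> real n"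
    proof -
      have "real n / real M \<le> real n / a n" by (rule divide_left_mono) (use M a4 in auto)
      then have "32 * (real n / real M + 1) \<le> 32 * (real n / a n + 1)" by simp
      then show ?thesis by (rule order_trans[OF order_trans[OF mr(2)] el(5)])
    qed
    \<comment> \<open>This reduces the tail with exponent \<open>198 * h\<close> to the one with
      exponent \<open>M\<close>.\<close>
    have hM: "real M \<le> real h"
    proof -
      have "real M * real M \<le> (2 * a n) * (2 * a n)" by (rule mult_mono) (use M2 a4 in auto)
      also have "\<dots> \<le> s n" using el(3) by (simp add: power2_eq_square)
      finally have "real M \<le> s n / real M" using M2 by (simp add: pos_le_divide_eq)
      then show ?thesis using h(1) by linarith
    qed
    have tl: "real m * (1 / 2) ^ M \<le> 1 / 16"
    proof -
      have "(1 / 2 :: real) ^ M = (1 / 2) powr real M" by (simp add: powr_realpow)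
      also have "\<dots> \<le> (1 / 2) powr a n" by (rule powr_mono'[OF M(1)]) auto
      finally have "real m * (1 / 2) ^ M \<le> real n * (1 / 2) powr a n"
        by (intro mult_mono mn) auto
      then show ?thesis using el(8) by linarith
    qed
    have "two_bites n M h m B"
    proof
      show "2 ^ 23 \<le> B" by (rule B)
      show "16 \<le> n" by (rule el(10))
      show "4 \<le> M" using M2(3) by simp
      have "2 ^ 27 * real M \<le> s n" using M2(1) el(2) by simp
      then have "2 ^ 27 \<le> s n / real M" using M2 by (simp add: pos_le_divide_eq)
      then have "2 ^ 27 \<le> real h" using h(1) by linarith
      then show "2 ^ 27 \<le> h" by (metis of_nat_le_iff of_nat_numeral of_nat_power)
      show "real n * ln (real n) \<le> (real (M * h))\<^sup>2"
        using power_mono[OF sMh s0, of 2] sn by simp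
      have "32 * real n \<le> real m * real M" using mr(1) M2 by (simp add: pos_divide_le_eq)
      then have "real (32 * n) \<le> real (m * M)" by simp
      then show "32 * n \<le> m * M" by (simp only: of_nat_le_iff)
      have "real m * real M \<le> 32 * (real n / real M + 1) * real M"
        by (rule mult_right_mono[OF mr(2)]) simp
      also have "\<dots> = 32 * real n + 32 * real M" using M2 by (simp add: algebra_simps)
      also have "\<dots> \<le> 33 * real n" using M2(1) el(4) by linarith
      finally have "real (m * M) \<le> real (33 * n)" by simp
      then show "m * M \<le> 33 * n" by (simp only: of_nat_le_iff)
      show "m \<le> n" using mn by simp
      show "2 ^ 28 * real B * (real (M * h))\<^sup>2 \<le> real n * real M * real n powr (- 1 / 16)"
      proof -
        have "(real (M * h))\<^sup>2 \<le> (2 * s n)\<^sup>2" by (rule power_mono[OF Mh2]) simp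
        also have "\<dots> = 4 * (real n * ln (real n))" using sn by (simp add: power_mult_distrib)
        finally have "2 ^ 28 * real B * (real (M * h))\<^sup>2 \<le> 2 ^ 28 * real B * (4 * (real n * ln (real n)))"
          by (rule mult_left_mono) simp
        also have "\<dots> = real n * (2 ^ 30 * real B * ln (real n))" by simp
        also have "\<dots> \<le> real n * real n powr (1 / 16)" by (rule mult_left_mono[OF el(6)]) simp
        also have "real n powr (1 / 16) = a n * real n powr (- 1 / 16)"
          unfolding a_def by (simp add: powr_add[symmetric])
        also have "real n * (a n * real n powr (- 1 / 16)) \<le> real n * (real M * real n powr (- 1 / 16))"
          by (intro mult_left_mono mult_right_mono M) auto
        finally show ?thesis by (simp add: mult.assoc)
      qed
      show "real B * real (M * h) * real n \<le> (real m)\<^sup>2 * real n powr (- 3 / 16)"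
      proof -
        have "real B * real (M * h) * real n \<le> real B * (2 * s n) * real n"
          by (intro mult_right_mono mult_left_mono Mh2) auto
        also have "\<dots> \<le> (16 * real n / a n)\<^sup>2 * real n powr (- 3 / 16)" by (rule el(7))
        also have "\<dots> \<le> (real m)\<^sup>2 * real n powr (- 3 / 16)"
          by (intro mult_right_mono power_mono m16) (use a4 in auto)
        finally show ?thesis .
      qed
      show "real m * (1 / 2) ^ M \<le> 1 / 16" by (rule tl)
      have "(1 / 2 :: real) ^ (198 * h) \<le> (1 / 2) ^ M"
        by (rule power_decreasing) (use hM in auto)
      then have "real m * (1 / 2) ^ (198 * h) \<le> real m * (1 / 2) ^ M" by (rule mult_left_mono) simp
      then show "real m * (1 / 2) ^ (198 * h) \<le> 1 / 16" using tl by linarith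
      have "real B * real (M * h) \<le> real B * (2 * s n)" by (rule mult_left_mono[OF Mh2]) simp
      then have "real (B * (M * h)) \<le> real m" using el(9) m16 by simp
      then show "B * (M * h) \<le> m" by (simp only: of_nat_le_iff)
    qed
    then show ?case using sMh Mh2 unfolding s_def by blast
  qed
qed

lemma dense_triangle_free_graphs:
  assumes B: "2 ^ 23 \<le> B"
  shows "\<forall>\<^sub>F n in sequentially. \<exists>E k. simple_graph {..<n} E \<and> triangle_free E \<and>
    sqrt (real n * ln (real n)) \<le> real k \<and> real k \<le> 32 * real B * sqrt (real n * ln (real n)) \<and>
    (\<forall>U\<subseteq>{..<n}. k \<le> card U \<longrightarrow>
       real B / 1024 * ln (real n) * real (card U) \<le> real (card (induced_edges E U)))"
  using two_bites_parameters[OF B]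
proof eventually_elim
  case (elim n)
  then obtain M h m where tb: "two_bites n M h m B"
    and Mh: "sqrt (real n * ln (real n)) \<le> real (M * h)" "real (M * h) \<le> 2 * sqrt (real n * ln (real n))"
    by blast
  interpret two_bites n M h m B by (rule tb)
  obtain E where E: "simple_graph {..<n} E" "triangle_free E"
    "\<forall>U\<subseteq>{..<n}. card U = 16 * k0 \<longrightarrow> real B * ln (real n) * real k0 / 32 \<le> real (card (induced_edges E U))"
    using dense_triangle_free_graph by blast
  have fin: "finite E" "{} \<notin> E" using finite_edges[OF E(1)] E(1) by (auto simp: simple_graph_def)
  have "real B / 1024 * ln (real n) * real (card U) \<le> real (card (induced_edges E U))"
    if U: "U \<subseteq> {..<n}" "16 * k0 \<le> card U" for U
  proof -
    let ?d = "real B * ln (real n) * real k0 / 32"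
    have "real (card U) * (?d / (2 * real (16 * k0))) \<le> real (card (induced_edges E U))"
      by (rule induced_edges_linear[OF fin, where V = "{..<n}"])
         (use E(3) U pos ln_ge finite_subset[OF U(1)] in auto)
    \<comment> \<open>\<open>1024 = 32 * 16 * 2\<close>: the edge bound, the order
      \<open>16 * k0\<close>, and the passage from blocks to arbitrary sets.\<close>
    moreover have "?d / (2 * real (16 * k0)) = real B / 1024 * ln (real n)" using pos by simp
    ultimately show ?thesis by (metis mult.commute)
  qed
  moreover have "sqrt (real n * ln (real n)) \<le> real (16 * k0)"
  proof -
    have "M * h \<le> 16 * k0" using pos unfolding k0_def by simp
    then have "real (M * h) \<le> real (16 * k0)" by (rule of_nat_mono)
    then show ?thesis using Mh(1) by linarith
  qed
  moreover have "real (16 * k0) \<le> 32 * real B * sqrt (real n * ln (real n))"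
  proof -
    have "real (16 * k0) = 16 * real B * real (M * h)" by (simp add: k0_def)
    also have "\<dots> \<le> 16 * real B * (2 * sqrt (real n * ln (real n)))" by (rule mult_left_mono[OF Mh(2)]) simp
    finally show ?thesis by simp
  qed
  ultimately show ?case using E by blast
qed

text \<open>Of the factor \<open>n ^ (4 * u)\<close> gained for sets of order \<open>u\<close>, one
  \<open>n ^ u\<close> pays for the set and one for the height functions. The rest is at least
  \<open>n ^ (2 * k)\<close>, and half of its exponent absorbs the sum over
  \<open>u\<close>.\<close>

lemma prob_some_small_fas:
  fixes \<zeta> :: real
  assumes sg: "simple_graph {..<n} E" and z: "0 \<le> \<zeta>" and k: "1 \<le> k" and n: "1 \<le> n"
    and dense: "\<And>U. U \<subseteq> {..<n} \<Longrightarrow> k \<le> card U \<Longrightarrow>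
      4 * ln (real n) * real (card U) \<le> \<zeta>\<^sup>2 * real (card (induced_edges E U))"
  shows "measure_pmf.prob (random_orientation E)
      {D. \<exists>U\<subseteq>{..<n}. k \<le> card U \<and>
         real (fas (induced_arcs D U)) \<le> (1/2 - \<zeta>) * real (card (induced_edges E U))}
    \<le> exp (- (real k * ln (real n)))"
proof -
  let ?P = "\<lambda>U D. real (fas (induced_arcs D U)) \<le> (1/2 - \<zeta>) * real (card (induced_edges E U))"
  let ?M = "random_orientation E"
  have n0: "0 < real n" "1 \<le> real n" using n by auto
  have pw: "exp (- (real j * ln (real n))) = 1 / real n ^ j" for j
    using n0 by (simp only: exp_minus exp_of_nat_mult exp_ln) (simp add: divide_inverse)
  have step: "measure_pmf.prob ?M {D. \<exists>U\<subseteq>{..<n}. card U = u \<and> ?P U D} \<le> 1 / real n ^ (2 * k)"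
    if u: "u \<in> {k..n}" for u
  proof -
    have "measure_pmf.prob ?M {D. \<exists>U\<subseteq>{..<n}. card U = u \<and> ?P U D}
        \<le> real (card {..<n}) ^ u * (real n ^ u * (1 / real n ^ (4 * u)))"
    proof (rule prob_ex_subset_le)
      fix U assume U: "U \<subseteq> {..<n}" "card U = u"
      have "measure_pmf.prob ?M {D. ?P U D}
          \<le> real (card U) ^ card U * exp (- (\<zeta>\<^sup>2 * real (card (induced_edges E U))))"
        by (rule prob_fas_le[OF sg U(1) z])
      also have "\<dots> \<le> real n ^ u * exp (- (real (4 * u) * ln (real n)))"
      proof (rule mult_mono)
        show "real (card U) ^ card U \<le> real n ^ u" using U u by (auto intro: power_mono)
        show "exp (- (\<zeta>\<^sup>2 * real (card (induced_edges E U)))) \<le> exp (- (real (4 * u) * ln (real n)))"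
          using dense[OF U(1)] U u by (simp add: ac_simps)
      qed auto
      finally show "measure_pmf.prob ?M {D. ?P U D} \<le> real n ^ u * (1 / real n ^ (4 * u))"
        unfolding pw .
    qed (use n0 in auto)
    also have "\<dots> = 1 / real n ^ (2 * u)"
    proof -
      have "real n ^ (4 * u) = real n ^ u * real n ^ u * real n ^ (2 * u)"
        by (simp add: power_add[symmetric])
      then show ?thesis using n0 by simp
    qed
    also have "\<dots> \<le> 1 / real n ^ (2 * k)"
      by (intro divide_left_mono power_increasing) (use u n0 in auto)
    finally show ?thesis .
  qed
  have cn: "card U \<le> n" if "U \<subseteq> {..<n}" for U using card_mono[OF _ that] by simp
  have "{D. \<exists>U\<subseteq>{..<n}. k \<le> card U \<and> ?P U D}
      \<subseteq> (\<Union>u\<in>{k..n}. {D. \<exists>U\<subseteq>{..<n}. card U = u \<and> ?P U D})"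
  proof
    fix D assume "D \<in> {D. \<exists>U\<subseteq>{..<n}. k \<le> card U \<and> ?P U D}"
    then obtain U where U: "U \<subseteq> {..<n}" "k \<le> card U" "?P U D" by blast
    then have "card U \<in> {k..n}" using cn by simp
    then show "D \<in> (\<Union>u\<in>{k..n}. {D. \<exists>U\<subseteq>{..<n}. card U = u \<and> ?P U D})" using U by blast
  qed
  then have "measure_pmf.prob ?M {D. \<exists>U\<subseteq>{..<n}. k \<le> card U \<and> ?P U D}
      \<le> measure_pmf.prob ?M (\<Union>u\<in>{k..n}. {D. \<exists>U\<subseteq>{..<n}. card U = u \<and> ?P U D})"
    by (rule measure_pmf.finite_measure_mono) simp
  also have "\<dots> \<le> real (card {k..n}) * (1 / real n ^ (2 * k))"
    by (rule prob_UN_le) (use step in auto)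
  also have "\<dots> \<le> real n ^ k * (1 / real n ^ (2 * k))"
  proof (rule mult_right_mono)
    have "card {k..n} \<le> n" using k by simp
    then have "real (card {k..n}) \<le> real n ^ 1" by simp
    also have "\<dots> \<le> real n ^ k" by (rule power_increasing) (use k n0 in auto)
    finally show "real (card {k..n}) \<le> real n ^ k" .
  qed (use n0 in simp)
  also have "\<dots> = exp (- (real k * ln (real n)))"
    unfolding pw using n0 by (simp add: mult_2 power_add)
  finally show ?thesis .
qed

text \<open>An acyclic set has \<open>fas\<close> equal to \<open>0\<close>, which the lower bound
  excludes from order \<open>k\<close> on; for a \<open>k\<close>-set, bringing \<open>fas\<close>
  down to \<open>0\<close> takes at least \<open>\<tau>\<close> edits.\<close>

lemma large_fas_consequences:
  fixes \<zeta> \<tau> :: real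
  assumes sg: "simple_graph V E" and D: "orientation_of E D" and k: "2 \<le> k" and z: "\<zeta> < 1/2"
    and large: "\<forall>U\<subseteq>V. k \<le> card U \<longrightarrow>
      (1/2 - \<zeta>) * real (card (induced_edges E U)) < real (fas (induced_arcs D U))"
    and dense: "\<And>S. S \<subseteq> V \<Longrightarrow> card S = k \<Longrightarrow> \<tau> \<le> (1/2 - \<zeta>) * real (card (induced_edges E S))"
  shows "acyclic_number V D < k"
    and "\<forall>W\<subseteq>V. k \<le> card W \<longrightarrow>
      real (card W) / (real k - 1) \<le> real (dichromatic_number W (induced_arcs D W))"
    and "\<forall>m D' S. (arc_edit ^^ m) D D' \<and> S \<subseteq> V \<and> card S = k \<and> acyclic_set D' S \<longrightarrow> \<tau> \<le> real m"
    and "\<forall>m D'. (arc_edit ^^ m) D D' \<and> real m < \<tau> \<longrightarrow>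
      acyclic_number V D' < k \<and> real (card V) / (real k - 1) \<le> real (dichromatic_number V D')"
proof -
  have finV: "finite V" using sg by (simp add: simple_graph_def)
  have irr: "(v, v) \<notin> D" for v
  proof
    assume "(v, v) \<in> D"
    then have "{v, v} \<in> E" using D unfolding orientation_of_def by blast
    then show False using sg unfolding simple_graph_def by fastforce
  qed
  have small: "card S < k" if "S \<subseteq> V" "acyclic_set D S" for S
  proof (rule ccontr)
    assume "\<not> card S < k"
    then have "(1/2 - \<zeta>) * real (card (induced_edges E S)) < 0"
      using large that acyclic_set_fas[OF that(2)] by (auto simp: not_less)
    moreover have "0 \<le> (1/2 - \<zeta>) * real (card (induced_edges E S))" using z by simp
    ultimately show False by linarith
  qed
  show "acyclic_number V D < k" by (rule acyclic_number_less[OF finV small])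
  show "\<forall>W\<subseteq>V. k \<le> card W \<longrightarrow>
      real (card W) / (real k - 1) \<le> real (dichromatic_number W (induced_arcs D W))"
  proof (intro allI impI)
    fix W assume W: "W \<subseteq> V"
    show "real (card W) / (real k - 1) \<le> real (dichromatic_number W (induced_arcs D W))"
    proof (rule dichromatic_number_ge[OF finite_subset[OF W finV] _ k])
      show "(v, v) \<notin> induced_arcs D W" for v using irr by (simp add: induced_arcs_def)
      fix S assume S: "S \<subseteq> W" "acyclic_set (induced_arcs D W) S"
      have "induced_arcs (induced_arcs D W) S = induced_arcs D S" using S(1) by (auto simp: induced_arcs_def)
      then have "acyclic_set D S" using S(2) by (simp add: acyclic_set_def)
      then show "card S < k" using small S(1) W by blast
    qed
  qed
  have edits: "\<tau> \<le> real m" if "(arc_edit ^^ m) D D'" "S \<subseteq> V" "card S = k" "acyclic_set D' S" for m D' S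
  proof -
    have "fas (induced_arcs D S) \<le> m" by (rule fas_le_arc_edits[OF that(1,4)])
    then show ?thesis using large[rule_format, OF that(2)] dense[OF that(2,3)] that(3) by simp
  qed
  then show "\<forall>m D' S. (arc_edit ^^ m) D D' \<and> S \<subseteq> V \<and> card S = k \<and> acyclic_set D' S \<longrightarrow> \<tau> \<le> real m"
    by blast
  show "\<forall>m D'. (arc_edit ^^ m) D D' \<and> real m < \<tau> \<longrightarrow>
      acyclic_number V D' < k \<and> real (card V) / (real k - 1) \<le> real (dichromatic_number V D')"
  proof (intro allI impI, elim conjE)
    fix m D' assume m: "(arc_edit ^^ m) D D'" "real m < \<tau>"
    have small': "card S < k" if S: "S \<subseteq> V" "acyclic_set D' S" for S
    proof (rule ccontr)
      assume "\<not> card S < k"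
      then have "k \<le> card S" by simp
      \<comment> \<open>Edits are counted for sets of order exactly \<open>k\<close>, and acyclicity
        passes to subsets.\<close>
      then obtain S' where S': "S' \<subseteq> S" "card S' = k" "finite S'" by (rule obtain_subset_with_card_n)
      then have "\<tau> \<le> real m"
        using edits[OF m(1) _ S'(2)] acyclic_set_mono[OF S(2) order_refl S'(1)] S(1) by blast
      then show False using m(2) by linarith
    qed
    show "acyclic_number V D' < k \<and> real (card V) / (real k - 1) \<le> real (dichromatic_number V D')"
      using acyclic_number_less[OF finV small']
        dichromatic_number_ge[OF finV arc_edit_irrefl[OF m(1) irr] k small'] by blast
  qed
qed

theorem theorem1p1:
  fixes \<zeta> :: real
  assumes "0 < \<zeta>" and "\<zeta> < 1/2"
  shows "\<exists>C c :: real. C > 0 \<and> c > 0 \<and>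
    (\<forall>\<^sub>F n :: nat in sequentially.
      \<exists>(V :: nat set) E (k :: nat).
        simple_graph V E \<and> card V = n \<and> triangle_free E \<and>
        real k \<le> C * sqrt (real n * ln (real n)) \<and>
        measure_pmf.prob (random_orientation E)
          {D. \<exists>U \<subseteq> V. card U \<ge> k \<and>
             real (fas (induced_arcs D U)) \<le> (1/2 - \<zeta>) * real (card (induced_edges E U))}
          \<le> exp (- (c * sqrt (real n) * ln (real n) powr (3/2))) \<and>
        (\<forall>D. orientation_of E D \<and>
             (\<forall>U \<subseteq> V. card U \<ge> k \<longrightarrow>
                real (fas (induced_arcs D U)) > (1/2 - \<zeta>) * real (card (induced_edges E U)))
           \<longrightarrow>
             acyclic_number V D < k \<and>
             (\<forall>W \<subseteq> V. card W \<ge> k \<longrightarrow>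
                real (dichromatic_number W (induced_arcs D W)) \<ge> real (card W) / (real k - 1)) \<and>
             (\<forall>m D' S. (arc_edit ^^ m) D D' \<and> S \<subseteq> V \<and> card S = k \<and> acyclic_set D' S \<longrightarrow>
                real m \<ge> c * sqrt (real n) * ln (real n) powr (3/2)) \<and>
             (\<forall>m D'. (arc_edit ^^ m) D D' \<and> real m < c * sqrt (real n) * ln (real n) powr (3/2) \<longrightarrow>
                acyclic_number V D' < k \<and>
                real (dichromatic_number V D') \<ge> real n / (real k - 1))))"
proof -
  \<comment> \<open>\<open>B / 1024\<close> has to reach \<open>4 / \<zeta>\<^sup>2\<close> for the
    union bound, whence \<open>4096\<close>; the construction itself asks for
    \<open>2 ^ 23\<close>.\<close>
  define B where "B = max (2 ^ 23) (nat \<lceil>4096 / \<zeta>\<^sup>2\<rceil>)"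
  have B23: "2 ^ 23 \<le> B" by (simp add: B_def)
  have "4096 / \<zeta>\<^sup>2 \<le> real (nat \<lceil>4096 / \<zeta>\<^sup>2\<rceil>)" by (rule of_nat_ceiling)
  also have "\<dots> \<le> real B" by (simp add: B_def)
  finally have Bz: "4096 \<le> \<zeta>\<^sup>2 * real B" using assms(1) by (simp add: pos_divide_le_eq mult.commute)
  have B1024: "1024 \<le> real B" using of_nat_mono[OF B23, where 'a = real] by simp
  \<comment> \<open>The proportion of edges that edits must overcome. As it is at most 1, it also
    serves in the probability bound.\<close>
  define c where "c = 1/2 - \<zeta>"
  have c: "0 < c" "c \<le> 1" using assms by (auto simp: c_def)
  show ?thesis
  proof (rule exI[of _ "32 * real B"], rule exI[of _ c], intro conjI)
    show "0 < 32 * real B" using B1024 by simp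
    show "0 < c" by (rule c)
    have two: "\<forall>\<^sub>F n :: nat in sequentially. 2 \<le> sqrt (real n * ln (real n))" by real_asymp
    have one: "\<forall>\<^sub>F n :: nat in sequentially. 1 \<le> n" by (rule eventually_ge_at_top)
    show "\<forall>\<^sub>F n :: nat in sequentially.
      \<exists>(V :: nat set) E (k :: nat).
        simple_graph V E \<and> card V = n \<and> triangle_free E \<and>
        real k \<le> 32 * real B * sqrt (real n * ln (real n)) \<and>
        measure_pmf.prob (random_orientation E)
          {D. \<exists>U \<subseteq> V. card U \<ge> k \<and>
             real (fas (induced_arcs D U)) \<le> (1/2 - \<zeta>) * real (card (induced_edges E U))}
          \<le> exp (- (c * sqrt (real n) * ln (real n) powr (3/2))) \<and>
        (\<forall>D. orientation_of E D \<and>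
             (\<forall>U \<subseteq> V. card U \<ge> k \<longrightarrow>
                real (fas (induced_arcs D U)) > (1/2 - \<zeta>) * real (card (induced_edges E U)))
           \<longrightarrow>
             acyclic_number V D < k \<and>
             (\<forall>W \<subseteq> V. card W \<ge> k \<longrightarrow>
                real (dichromatic_number W (induced_arcs D W)) \<ge> real (card W) / (real k - 1)) \<and>
             (\<forall>m D' S. (arc_edit ^^ m) D D' \<and> S \<subseteq> V \<and> card S = k \<and> acyclic_set D' S \<longrightarrow>
                real m \<ge> c * sqrt (real n) * ln (real n) powr (3/2)) \<and>
             (\<forall>m D'. (arc_edit ^^ m) D D' \<and> real m < c * sqrt (real n) * ln (real n) powr (3/2) \<longrightarrow>
                acyclic_number V D' < k \<and>
                real (dichromatic_number V D') \<ge> real n / (real k - 1)))"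
      using dense_triangle_free_graphs[OF B23] two one
    proof eventually_elim
      case (elim n)
      then obtain E k where sg: "simple_graph {..<n} E" and tf: "triangle_free E"
        and k: "sqrt (real n * ln (real n)) \<le> real k" "real k \<le> 32 * real B * sqrt (real n * ln (real n))"
        and dense: "\<And>U. U \<subseteq> {..<n} \<Longrightarrow> k \<le> card U \<Longrightarrow>
          real B / 1024 * ln (real n) * real (card U) \<le> real (card (induced_edges E U))"
        by blast
      let ?\<tau> = "c * sqrt (real n) * ln (real n) powr (3/2)"
      have k2: "2 \<le> k" using k(1) elim(2) by simp
      have ln0: "0 \<le> ln (real n)" using elim(3) by simp
      have tau: "?\<tau> = c * (sqrt (real n * ln (real n)) * ln (real n))"
      proof -
        have "ln (real n) powr (3/2) = ln (real n) powr (1/2 + 1)" by simp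
        also have "\<dots> = sqrt (ln (real n)) * ln (real n)"
          unfolding powr_add using ln0 by (simp add: powr_half_sqrt)
        finally show ?thesis by (simp add: real_sqrt_mult)
      qed
      \<comment> \<open>The lower bound on \<open>k\<close> converts the rate
        \<open>sqrt n * ln n powr (3/2)\<close> into \<open>k * ln n\<close>, the natural scale of
        both estimates.\<close>
      have tauk: "?\<tau> \<le> c * (real k * ln (real n))"
        unfolding tau by (intro mult_left_mono mult_right_mono k(1) ln0) (use c in auto)
      have "measure_pmf.prob (random_orientation E)
          {D. \<exists>U \<subseteq> {..<n}. k \<le> card U \<and>
             real (fas (induced_arcs D U)) \<le> (1/2 - \<zeta>) * real (card (induced_edges E U))}
          \<le> exp (- (real k * ln (real n)))"
      proof (rule prob_some_small_fas[OF sg])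
        fix U assume U: "U \<subseteq> {..<n}" "k \<le> card U"
        have "4 * (ln (real n) * real (card U)) \<le> (\<zeta>\<^sup>2 * real B / 1024) * (ln (real n) * real (card U))"
          by (rule mult_right_mono) (use Bz ln0 in auto)
        also have "\<dots> = \<zeta>\<^sup>2 * (real B / 1024 * ln (real n) * real (card U))" by simp
        also have "\<dots> \<le> \<zeta>\<^sup>2 * real (card (induced_edges E U))"
          by (rule mult_left_mono[OF dense[OF U]]) simp
        finally show "4 * ln (real n) * real (card U) \<le> \<zeta>\<^sup>2 * real (card (induced_edges E U))" by simp
      qed (use assms k2 elim(3) in auto)
      also have "\<dots> \<le> exp (- ?\<tau>)"
      proof -
        have "c * (real k * ln (real n)) \<le> 1 * (real k * ln (real n))"
          by (rule mult_right_mono) (use c ln0 in auto)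
        then show ?thesis using tauk by simp
      qed
      finally have prob: "measure_pmf.prob (random_orientation E)
          {D. \<exists>U \<subseteq> {..<n}. k \<le> card U \<and>
             real (fas (induced_arcs D U)) \<le> (1/2 - \<zeta>) * real (card (induced_edges E U))}
          \<le> exp (- ?\<tau>)" .
      have dense_k: "?\<tau> \<le> (1/2 - \<zeta>) * real (card (induced_edges E S))"
        if S: "S \<subseteq> {..<n}" "card S = k" for S
      proof -
        have "1 * (ln (real n) * real k) \<le> (real B / 1024) * (ln (real n) * real k)"
          by (rule mult_right_mono) (use B1024 ln0 in auto)
        also have "\<dots> \<le> real (card (induced_edges E S))" using dense[OF S(1)] S(2) by simp
        finally have "real k * ln (real n) \<le> real (card (induced_edges E S))" by (simp add: mult.commute)
        then have "c * (real k * ln (real n)) \<le> c * real (card (induced_edges E S))"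
          by (rule mult_left_mono) (use c in simp)
        then show ?thesis using tauk unfolding c_def by linarith
      qed
      show ?case
      proof (intro exI conjI allI impI)
        show "simple_graph {..<n} E" "triangle_free E" by (fact sg tf)+
        show "card {..<n} = n" by simp
        show "real k \<le> 32 * real B * sqrt (real n * ln (real n))" by (rule k)
        show "measure_pmf.prob (random_orientation E)
          {D. \<exists>U \<subseteq> {..<n}. k \<le> card U \<and>
             real (fas (induced_arcs D U)) \<le> (1/2 - \<zeta>) * real (card (induced_edges E U))}
          \<le> exp (- ?\<tau>)" by (rule prob)
      next
        fix D assume D: "orientation_of E D \<and> (\<forall>U \<subseteq> {..<n}. card U \<ge> k \<longrightarrow>
                real (fas (induced_arcs D U)) > (1/2 - \<zeta>) * real (card (induced_edges E U)))"
        note cons = large_fas_consequences[OF sg conjunct1[OF D] k2 assms(2) conjunct2[OF D] dense_k]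
        show "acyclic_number {..<n} D < k" by (rule cons(1))
        show "real (card W) / (real k - 1) \<le> real (dichromatic_number W (induced_arcs D W))"
          if "W \<subseteq> {..<n}" "k \<le> card W" for W using cons(2) that by blast
        show "?\<tau> \<le> real m" if "(arc_edit ^^ m) D D' \<and> S \<subseteq> {..<n} \<and> card S = k \<and> acyclic_set D' S"
          for m D' S using cons(3) that by blast
        show "acyclic_number {..<n} D' < k" "real n / (real k - 1) \<le> real (dichromatic_number {..<n} D')"
          if "(arc_edit ^^ m) D D' \<and> real m < ?\<tau>" for m D'
          using cons(4) that by auto
      qed
    qed
  qed
qed

end
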